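(* Let $R=\bigoplus_{u\ge0}R_u$ be a standard graded finitely generated algebra over a field $R_0=k$ which is a domain of Krull dimension $d>0$, with homogeneous maximal ideal $\mathfrak{m}=\bigoplus_{u\ge1}R_u$, and let $I\subseteq R$ be a nonzero homogeneous ideal. Let $S=R[U]$, where $U$ is a variable with $\deg U=1$, $\mathfrak{n}=\mathfrak{m}+(U)$ and $J=IS$. Let $\beta>0$ be an integer such that $I$ is generated in degrees $\le\beta$. For any integer $c>\beta$ there exists an integer $v_0\ge0$ (depending on $c$) such that for all integers $v\ge v_0$, $$\sum_{u=0}^{cv}\dim_k(I^v)_u=\left[\sum_{i=0}^{d}\frac{e_i(\mathfrak{n}\vert\langle J_\beta\rangle)}{i!(d-i)!}(c-\beta)^{d-i}\right]v^d+\text{lower degree terms},$$ i.e. for $v\ge v_0$ the left-hand side equals a numerical polynomial in $v$ of the form displayed, whose remaining terms have degree $<d$ in $v$.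
   Context: For an integer $\beta\ge0$, $\langle J_\beta\rangle$ is the ideal of $S$ generated by the homogeneous elements of $J$ of degree $\beta$. Mixed multiplicities: $S$ is a standard graded domain of dimension $d+1$; for a nonzero homogeneous ideal $\mathfrak{a}\subseteq S$ and all $u,v\gg0$, $\dim_k(\mathfrak{n}^u\mathfrak{a}^v/\mathfrak{n}^{u+1}\mathfrak{a}^v)$ equals a numerical polynomial $Q(u,v)$ of total degree $d$, and the integers $e_i(\mathfrak{n}\vert\mathfrak{a})$, $0\le i\le d$, are defined by $Q(u,v)=\sum_{i=0}^{d}\frac{e_i(\mathfrak{n}\vert\mathfrak{a})}{i!(d-i)!}u^{d-i}v^i+\text{lower degree terms}$. *)

theory Defs
  imports Complex_Main "HOL-Library.Extended_Nat" "HOL-Computational_Algebra.Polynomial"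
begin

section \<open>Ideals\<close>

text \<open>Ideals of a commutative ring are its submodules as a module over itself.  The locale is
  deliberately not interpreted globally: its simp rule for iterated scaling would be the
  associativity of multiplication oriented against \<open>mult.assoc\<close>.\<close>

lemma module_times: "module ((*) :: 'a::comm_ring_1 \<Rightarrow> 'a \<Rightarrow> 'a)"
  by (rule module.intro) (simp_all add: algebra_simps)

abbreviation is_ideal :: "'a::comm_ring_1 set \<Rightarrow> bool" where
  "is_ideal \<equiv> module.subspace (*)"

abbreviation ideal_span :: "'a::comm_ring_1 set \<Rightarrow> 'a set" where
  "ideal_span \<equiv> module.span (*)"

definition ideal_prod :: "'a::comm_ring_1 set \<Rightarrow> 'a set \<Rightarrow> 'a set" where
  "ideal_prod I J = ideal_span {x * y | x y. x \<in> I \<and> y \<in> J}"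

primrec ideal_pow :: "'a::comm_ring_1 set \<Rightarrow> nat \<Rightarrow> 'a set" where
  "ideal_pow I 0 = UNIV"
| "ideal_pow I (Suc n) = ideal_prod I (ideal_pow I n)"

definition prime_ideal :: "'a::comm_ring_1 set \<Rightarrow> bool" where
  "prime_ideal P \<longleftrightarrow> is_ideal P \<and> P \<noteq> UNIV \<and> (\<forall>a b. a * b \<in> P \<longrightarrow> a \<in> P \<or> b \<in> P)"

definition krull_dim :: "'a::comm_ring_1 itself \<Rightarrow> enat" where
  "krull_dim _ = Sup {enat n | n. \<exists>P :: nat \<Rightarrow> 'a set.
      (\<forall>i\<le>n. prime_ideal (P i)) \<and> (\<forall>i<n. P i \<subset> P (Suc i))}"

section \<open>Standard graded algebras\<close>

text \<open>A \<open>k\<close>-algebra structure is a ring homomorphism \<open>\<iota>\<close> from the field \<open>k\<close>, and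
  \<open>kscale \<iota>\<close> is the resulting scalar multiplication.\<close>

definition kscale :: "('k::field \<Rightarrow> 'a::comm_ring_1) \<Rightarrow> 'k \<Rightarrow> 'a \<Rightarrow> 'a" where
  "kscale \<iota> c x = \<iota> c * x"

inductive_set algebra_generated ::
    "('k::field \<Rightarrow> 'a::comm_ring_1) \<Rightarrow> 'a set \<Rightarrow> 'a set"
  for \<iota> :: "'k::field \<Rightarrow> 'a::comm_ring_1" and X :: "'a set" where
  scalar: "\<iota> c \<in> algebra_generated \<iota> X"
| gen: "x \<in> X \<Longrightarrow> x \<in> algebra_generated \<iota> X"
| add: "x \<in> algebra_generated \<iota> X \<Longrightarrow> y \<in> algebra_generated \<iota> X \<Longrightarrow>
    x + y \<in> algebra_generated \<iota> X"
| mult: "x \<in> algebra_generated \<iota> X \<Longrightarrow> y \<in> algebra_generated \<iota> X \<Longrightarrow>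
    x * y \<in> algebra_generated \<iota> X"

locale standard_graded_algebra =
  fixes \<iota> :: "'k::field \<Rightarrow> 'a::comm_ring_1" and R :: "nat \<Rightarrow> 'a set"
  assumes hom_one: "\<iota> 1 = 1"
    and hom_add: "\<iota> (a + b) = \<iota> a + \<iota> b"
    and hom_mult: "\<iota> (a * b) = \<iota> a * \<iota> b"
    and degree_zero: "R 0 = range \<iota>"
    and zero_closed: "0 \<in> R n"
    and add_closed: "x \<in> R n \<Longrightarrow> y \<in> R n \<Longrightarrow> x + y \<in> R n"
    and mult_closed: "x \<in> R m \<Longrightarrow> y \<in> R n \<Longrightarrow> x * y \<in> R (m + n)"
    and direct_sum: "\<exists>!f. (\<forall>n. f n \<in> R n) \<and> finite {n. f n \<noteq> 0} \<and> x = (\<Sum>n | f n \<noteq> 0. f n)"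
    and finitely_generated: "\<exists>X. finite X \<and> algebra_generated \<iota> X = UNIV"
    and standard: "algebra_generated \<iota> (R 1) = UNIV"
begin

lemma hom_zero: "\<iota> 0 = 0"
  using hom_add[of 0 0] by simp

sublocale vector_space "kscale \<iota>"
  by standard (simp_all add: kscale_def algebra_simps hom_one hom_add hom_mult)

end

text \<open>The direct sum of the \<open>R u\<close> with \<open>u \<ge> 1\<close>, as the \<open>k\<close>-span of their union.\<close>

definition irrelevant_ideal ::
    "('k::field \<Rightarrow> 'a::comm_ring_1) \<Rightarrow> (nat \<Rightarrow> 'a set) \<Rightarrow> 'a set" where
  "irrelevant_ideal \<iota> R = module.span (kscale \<iota>) (\<Union>u\<in>{1..}. R u)"

definition homogeneous_ideal :: "(nat \<Rightarrow> 'a::comm_ring_1 set) \<Rightarrow> 'a set \<Rightarrow> bool" where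
  "homogeneous_ideal R I \<longleftrightarrow> is_ideal I \<and> (\<exists>G. G \<subseteq> (\<Union>u. R u) \<and> I = ideal_span G)"

definition generated_in_degrees_le :: "(nat \<Rightarrow> 'a::comm_ring_1 set) \<Rightarrow> nat \<Rightarrow> 'a set \<Rightarrow> bool" where
  "generated_in_degrees_le R \<beta> I \<longleftrightarrow> (\<exists>G. G \<subseteq> (\<Union>u\<in>{..\<beta>}. R u) \<and> I = ideal_span G)"

definition degree_part_ideal :: "(nat \<Rightarrow> 'a::comm_ring_1 set) \<Rightarrow> nat \<Rightarrow> 'a set \<Rightarrow> 'a set" where
  "degree_part_ideal R \<beta> I = ideal_span (I \<inter> R \<beta>)"

section \<open>The polynomial extension \<open>S = R[U]\<close>, with \<open>deg U = 1\<close>\<close>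

definition poly_scalar :: "('k::field \<Rightarrow> 'a::comm_ring_1) \<Rightarrow> 'k \<Rightarrow> 'a poly" where
  "poly_scalar \<iota> c = [:\<iota> c:]"

definition poly_grading :: "(nat \<Rightarrow> 'a::comm_ring_1 set) \<Rightarrow> nat \<Rightarrow> 'a poly set" where
  "poly_grading R n = {p. \<forall>i. if i \<le> n then coeff p i \<in> R (n - i) else coeff p i = 0}"

definition extend_ideal :: "'a::comm_ring_1 set \<Rightarrow> 'a poly set" where
  "extend_ideal I = ideal_span ((\<lambda>r. [:r:]) ` I)"

text \<open>The ideal \<open>\<mm>S + (U)\<close> of \<open>S\<close>.\<close>

definition poly_irrelevant_ideal ::
    "('k::field \<Rightarrow> 'a::comm_ring_1) \<Rightarrow> (nat \<Rightarrow> 'a set) \<Rightarrow> 'a poly set" where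
  "poly_irrelevant_ideal \<iota> R = ideal_span (extend_ideal (irrelevant_ideal \<iota> R) \<union> {[:0, 1:]})"

section \<open>Mixed multiplicities\<close>

text \<open>\<open>X\<close> is a set of representatives of a \<open>k\<close>-basis of \<open>A/B\<close>, for \<open>k\<close>-subspaces \<open>B \<subseteq> A\<close>;
  its elements automatically have pairwise distinct classes.\<close>

definition basis_mod ::
    "('k::field \<Rightarrow> 'a::comm_ring_1) \<Rightarrow> 'a set \<Rightarrow> 'a set \<Rightarrow> 'a set \<Rightarrow> bool" where
  "basis_mod \<iota> A B X \<longleftrightarrow> X \<subseteq> A \<and> A \<subseteq> module.span (kscale \<iota>) (X \<union> B) \<and>
     (\<forall>F c. finite F \<and> F \<subseteq> X \<and> (\<Sum>x\<in>F. kscale \<iota> (c x) x) \<in> B \<longrightarrow> (\<forall>x\<in>F. c x = 0))"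

text \<open>As for \<open>vector_space.dim\<close>, the value is \<open>0\<close> when \<open>A/B\<close> is infinite-dimensional.\<close>

definition quot_dim ::
    "('k::field \<Rightarrow> 'a::comm_ring_1) \<Rightarrow> 'a set \<Rightarrow> 'a set \<Rightarrow> nat" where
  "quot_dim \<iota> A B = card (SOME X. basis_mod \<iota> A B X)"

text \<open>A polynomial \<open>Q(u,v)\<close> is an element of \<open>\<rat>[v][u]\<close>: the coefficient of \<open>u\<^sup>a v\<^sup>b\<close> is
  \<open>coeff (coeff Q a) b\<close>, and the value at \<open>(u,v)\<close> is \<open>poly (poly Q [:u:]) v\<close>. At most one \<open>Q\<close>
  can satisfy the last condition below, which also makes \<open>Q\<close> numerical, so that asking only for
  total degree at most \<open>d\<close> does not affect which \<open>Q\<close> is meant.\<close>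

definition is_bhattacharya_poly ::
    "('k::field \<Rightarrow> 's::comm_ring_1) \<Rightarrow> nat \<Rightarrow> 's set \<Rightarrow> 's set \<Rightarrow> rat poly poly \<Rightarrow> bool" where
  "is_bhattacharya_poly \<iota> d \<nn> \<aa> Q \<longleftrightarrow>
     (\<forall>a b. coeff (coeff Q a) b \<noteq> 0 \<longrightarrow> a + b \<le> d) \<and>
     (\<exists>u0 v0. \<forall>u\<ge>u0. \<forall>v\<ge>v0.
        of_nat (quot_dim \<iota> (ideal_prod (ideal_pow \<nn> u) (ideal_pow \<aa> v))
                           (ideal_prod (ideal_pow \<nn> (Suc u)) (ideal_pow \<aa> v)))
        = poly (poly Q [:of_nat u:]) (of_nat v))"

text \<open>\<open>mixed_multiplicity \<iota> d \<nn> \<aa> i\<close> is \<open>e\<^sub>i(\<nn>|\<aa>)\<close>, for a ring of dimension \<open>d + 1\<close>: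
  \<open>e\<^sub>i / (i! (d - i)!)\<close> is the coefficient of \<open>u\<^bsup>d - i\<^esup> v\<^sup>i\<close> in \<open>Q\<close>.\<close>

definition mixed_multiplicity ::
    "('k::field \<Rightarrow> 's::comm_ring_1) \<Rightarrow> nat \<Rightarrow> 's set \<Rightarrow> 's set \<Rightarrow> nat \<Rightarrow> int" where
  "mixed_multiplicity \<iota> d \<nn> \<aa> i = (THE e. \<exists>Q. is_bhattacharya_poly \<iota> d \<nn> \<aa> Q \<and>
     coeff (coeff Q (d - i)) i = of_int e / (fact i * fact (d - i)))"

definition numerical_poly :: "rat poly \<Rightarrow> bool" where
  "numerical_poly P \<longleftrightarrow> (\<exists>n0. \<forall>n\<ge>n0. poly P (of_nat n) \<in> \<int>)"

end

theory Submission
  imports Defs "HOL-Library.Multiset_Order"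
begin

text \<open>Write \<open>\<aa> = \<langle>J\<^sub>\<beta>\<rangle>\<close> and let \<open>T(u,v)\<close> be the \<open>k\<close>-span of the products of \<open>u\<close> elements of \<open>S\<^sub>1\<close> and \<open>v\<close>
  elements of \<open>J \<inter> S\<^sub>\<beta>\<close>.  Since \<open>\<nn>\<^sup>u\<aa>\<^sup>v\<close> is generated by \<open>T(u,v)\<close>, which lies in the single degree \<open>u + \<beta>v\<close>,
  the quotient \<open>\<nn>\<^sup>u\<aa>\<^sup>v/\<nn>\<^bsup>u+1\<^esup>\<aa>\<^sup>v\<close> is isomorphic to \<open>T(u,v)\<close>.  As \<open>I\<close> is generated in degrees at most \<open>\<beta>\<close>,
  \<open>T(u,v)\<close> is the whole degree \<open>u + \<beta>v\<close> part of \<open>J\<^sup>v\<close>, of dimension \<open>\<Sum>\<^bsub>j \<le> u+\<beta>v\<^esub> dim (I\<^sup>v)\<^sub>j\<close>; substituting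
  \<open>u = (c - \<beta>)v\<close> into the polynomial \<open>Q(u,v)\<close> gives the claim.

  That \<open>dim T(u,v)\<close> is eventually a polynomial \<open>Q\<close> comes from a monomial order: the monomials that do not
  reduce to smaller ones form a basis and are the complement of a monomial ideal, which is finitely
  generated by Dickson's lemma.  The total degree of \<open>Q\<close> is bounded by comparing with \<open>dim S\<^bsub>u+\<beta>v\<^esub>\<close>: if \<open>dim R\<^sub>n\<close>
  were not \<open>O(n\<^bsup>d-1\<^esup>)\<close>, a chain of \<open>d + 2\<close> graded primes would arise by repeatedly
  adjoining a linear form and passing to a graded ideal maximal among those whose quotient grows too
  fast; such a maximal ideal is prime.\<close>

section \<open>Dickson's lemma\<close>

text \<open>Counting monomials produces a polynomial Q without any link between its degree and d,
  since the number of generators is unrelated to d; yet the definition of the e_i presupposes total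
  degree at most d. Hence the Krull dimension has to enter, and passing from R to S turns O(n^(d-1))
  into O(n^d). A bound on dim T(u,v) concerns values of Q; it is transferred to coefficients along
  the rays u = p v. There Q becomes a polynomial in v whose coefficient of v^n is the homogeneous
  part of degree n of Q at (p,1), and a form that vanishes at (p,1) for all p \<ge> 1 is zero. The
  theorem itself lives on the ray with p = c - \<beta>: as c > \<beta>, u grows along with v, so the
  ray enters the quadrant where Q gives the dimension, and its coefficient of v^d is the sum of e_i
  (c - \<beta>)^(d-i) / (i! (d-i)!). Since the e_i are defined as integers, the top coefficients of
  Q times i! (d-i)! must also be shown to be integers; finite differences do this.\<close>

lemma nat_seq_mono_subseq:
  fixes s :: "nat \<Rightarrow> nat"
  shows "\<exists>g::nat \<Rightarrow> nat. strict_mono g \<and> (\<forall>i j. i \<le> j \<longrightarrow> s (g i) \<le> s (g j))"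
\<comment> \<open>If beyond every index there is one whose value no later value undercuts, iterating
  such indices gives the subsequence. Otherwise every value from some index on is undercut later, an
  infinite descent in the natural numbers.\<close>
proof (cases "\<forall>n. \<exists>p>n. \<forall>m\<ge>p. s p \<le> s m")
  case True
  then obtain h where h: "\<And>n. h n > n" "\<And>n m. m \<ge> h n \<Longrightarrow> s (h n) \<le> s m"
    by metis
  define g where "g = rec_nat (h 0) (\<lambda>_. h)"
  have g: "g (Suc n) = h (g n)" for n by (simp add: g_def)
  have sm: "strict_mono g" by (simp add: strict_mono_Suc_iff g h(1))
  have "s (g i) \<le> s (g j)" if "i \<le> j" for i j
  proof (cases i)
    case 0
    show ?thesis
      using h(2)[of 0 "g j"] strict_mono_leD[OF sm that] by (simp add: 0 g_def)
  next
    case (Suc i')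
    show ?thesis
      using h(2)[of "g i'" "g j"] strict_mono_leD[OF sm that] by (simp add: Suc g)
  qed
  with sm show ?thesis by blast
next
  case False
  then obtain N where N: "\<And>p. p > N \<Longrightarrow> \<exists>m\<ge>p. s m < s p"
    by (auto simp: not_le)
  have "p > N \<Longrightarrow> s p = v \<Longrightarrow> False" for v p
  proof (induction v arbitrary: p rule: less_induct)
    case (less v)
    obtain m where "m \<ge> p" "s m < s p" using N[OF less.prems(1)] by blast
    then show ?case using less.IH[of "s m" m] less.prems by simp
  qed
  then have False by blast
  then show ?thesis ..
qed

text \<open>Thinning for one letter at a time: a further subsequence keeps the monotonicity already
  reached for the other letters.\<close>

lemma dickson_subseq:
  fixes f :: "nat \<Rightarrow> 'x multiset"
  assumes "finite X"
  shows "\<exists>g::nat \<Rightarrow> nat. strict_mono g \<and> (\<forall>x\<in>X. \<forall>i j. i \<le> j \<longrightarrow> count (f (g i)) x \<le> count (f (g j)) x)"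
  using assms
proof (induction X rule: finite_induct)
  case empty
  show ?case by (intro exI[of _ id]) (auto simp: strict_mono_def)
next
  case (insert x X)
  then obtain g :: "nat \<Rightarrow> nat" where g: "strict_mono g"
    "\<And>x i j. x \<in> X \<Longrightarrow> i \<le> j \<Longrightarrow> count (f (g i)) x \<le> count (f (g j)) x"
    by blast
  obtain h :: "nat \<Rightarrow> nat" where h: "strict_mono h" "\<And>i j. i \<le> j \<Longrightarrow> count (f (g (h i))) x \<le> count (f (g (h j))) x"
    using nat_seq_mono_subseq[of "\<lambda>i. count (f (g i)) x"] by blast
  show ?case
  proof (intro exI[of _ "g \<circ> h"] conjI ballI allI impI)
    show "strict_mono (g \<circ> h)" using g(1) h(1) by (simp add: strict_mono_o)
    fix y i j assume "y \<in> insert x X" "i \<le> (j::nat)"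
    then show "count (f ((g \<circ> h) i)) y \<le> count (f ((g \<circ> h) j)) y"
      using g(2)[of y "h i" "h j"] h strict_mono_leD[OF h(1)] by auto
  qed
qed

lemma dickson:
  fixes f :: "nat \<Rightarrow> 'x multiset"
  assumes "finite X" and sub: "\<And>n. set_mset (f n) \<subseteq> X"
  shows "\<exists>i j. i < j \<and> f i \<subseteq># f j"
proof -
  obtain g :: "nat \<Rightarrow> nat" where g: "strict_mono g"
    "\<And>x i j. x \<in> X \<Longrightarrow> i \<le> j \<Longrightarrow> count (f (g i)) x \<le> count (f (g j)) x"
    using dickson_subseq[OF \<open>finite X\<close>, of f] by blast
  have "count (f (g 0)) x \<le> count (f (g 1)) x" for x
  proof (cases "x \<in> X")
    case False
    then have "x \<notin># f (g 0)" using sub by blast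
    then show ?thesis by (simp add: not_in_iff)
  qed (simp add: g)
  moreover have "g 0 < g 1" using g(1) by (simp add: strict_mono_def)
  ultimately show ?thesis by (auto simp: subseteq_mset_def)
qed

text \<open>\<open>G\<close> consists of the elements minimal for divisibility. They are pairwise
  incomparable, so an infinite \<open>G\<close> would contradict \<open>dickson\<close>; descent on
  the size finds a minimal element below any given one.\<close>

lemma dickson_finite_basis:
  fixes N :: "'x multiset set"
  assumes "finite X" and sub: "\<And>M. M \<in> N \<Longrightarrow> set_mset M \<subseteq> X"
  shows "\<exists>G. finite G \<and> G \<subseteq> N \<and> (\<forall>M\<in>N. \<exists>L\<in>G. L \<subseteq># M)"
proof -
  define G where "G = {M\<in>N. \<forall>L\<in>N. L \<subseteq># M \<longrightarrow> L = M}"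
  have "finite G"
  proof (rule ccontr)
    assume "infinite G"
    then obtain f :: "nat \<Rightarrow> 'x multiset" where f: "inj f" "range f \<subseteq> G"
      using infinite_countable_subset by blast
    then have "\<And>n. set_mset (f n) \<subseteq> X" using sub by (auto simp: G_def)
    then obtain i j where "i < j" "f i \<subseteq># f j" using dickson[OF \<open>finite X\<close>] by blast
    moreover have "f i \<in> G" "f j \<in> G" using f(2) by blast+
    ultimately have "f i = f j" unfolding G_def by blast
    with f(1) \<open>i < j\<close> show False by (auto dest: injD)
  qed
  moreover have "\<exists>L\<in>G. L \<subseteq># M" if "M \<in> N" for M
    using that
  proof (induction M rule: measure_induct_rule[of size])
    case (less M)
    show ?case
    proof (cases "M \<in> G")
      case False
      then obtain L where L: "L \<in> N" "L \<subseteq># M" "L \<noteq> M" using less.prems by (auto simp: G_def)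
      then have "size L < size M" by (simp add: mset_subset_size subset_mset.le_neq_trans)
      then show ?thesis using less.IH L by (meson subset_mset.order_trans)
    qed auto
  qed
  ultimately show ?thesis by (intro exI[of _ G]) (auto simp: G_def)
qed

section \<open>Counting monomials of given bidegree\<close>

text \<open>Speaking of functions rather than of Q keeps the counting arguments free of computations
  with coefficients; these matter only when degrees do.\<close>

definition polyfun2 :: "(rat \<Rightarrow> rat \<Rightarrow> rat) \<Rightarrow> bool" where
  "polyfun2 F \<longleftrightarrow> (\<exists>Q. \<forall>x y. F x y = poly (poly Q [:x:]) y)"

lemma polyfun2_const: "polyfun2 (\<lambda>x y. a)"
  unfolding polyfun2_def by (rule exI[of _ "[:[:a:]:]"]) simp

lemma polyfun2_fst: "polyfun2 (\<lambda>x y. x)"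
  unfolding polyfun2_def by (rule exI[of _ "[:0, 1:]"]) simp

lemma polyfun2_snd: "polyfun2 (\<lambda>x y. y)"
  unfolding polyfun2_def by (rule exI[of _ "[:[:0, 1:]:]"]) simp

lemma polyfun2_add: "polyfun2 F \<Longrightarrow> polyfun2 G \<Longrightarrow> polyfun2 (\<lambda>x y. F x y + G x y)"
  unfolding polyfun2_def by (metis poly_add)

lemma polyfun2_mult: "polyfun2 F \<Longrightarrow> polyfun2 G \<Longrightarrow> polyfun2 (\<lambda>x y. F x y * G x y)"
  unfolding polyfun2_def by (metis poly_mult)

lemma polyfun2_diff: "polyfun2 F \<Longrightarrow> polyfun2 G \<Longrightarrow> polyfun2 (\<lambda>x y. F x y - G x y)"
  unfolding polyfun2_def by (metis poly_diff)

text \<open>Translation by \<open>b\<close> acts on each coefficient, in the inner variable v;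
  translation by \<open>a\<close> is composition with u - a in the outer variable. Counting the
  multiples of a fixed monomial needs both.\<close>

lemma polyfun2_shift:
  assumes "polyfun2 F"
  shows "polyfun2 (\<lambda>x y. F (x - a) (y - b))"
proof -
  obtain Q where Q: "\<And>x y. F x y = poly (poly Q [:x:]) y"
    using assms by (auto simp: polyfun2_def)
  have inner: "poly (poly (map_poly (\<lambda>q. pcompose q [:- b, 1:]) Q) [:z:]) y = poly (poly Q [:z:]) (y - b)" for z y
    by (induction Q) (simp_all add: map_poly_pCons poly_pcompose algebra_simps)
  show ?thesis
    unfolding polyfun2_def
    by (rule exI[of _ "pcompose (map_poly (\<lambda>q. pcompose q [:- b, 1:]) Q) [:[:- a:], 1:]"])
       (simp add: poly_pcompose inner Q)
qed

definition eventually_poly2 :: "(nat \<Rightarrow> nat \<Rightarrow> rat) \<Rightarrow> bool" where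
  "eventually_poly2 f \<longleftrightarrow>
     (\<exists>F u0 v0. polyfun2 F \<and> (\<forall>u\<ge>u0. \<forall>v\<ge>v0. f u v = F (of_nat u) (of_nat v)))"

lemma eventually_poly2I:
  "polyfun2 F \<Longrightarrow> (\<And>u v. u \<ge> u0 \<Longrightarrow> v \<ge> v0 \<Longrightarrow> f u v = F (of_nat u) (of_nat v)) \<Longrightarrow> eventually_poly2 f"
  unfolding eventually_poly2_def by blast

lemma eventually_poly2_add:
  assumes "eventually_poly2 f" "eventually_poly2 g"
  shows "eventually_poly2 (\<lambda>u v. f u v + g u v)"
proof -
  obtain F u0 v0 where F: "polyfun2 F" "\<And>u v. u \<ge> u0 \<Longrightarrow> v \<ge> v0 \<Longrightarrow> f u v = F (of_nat u) (of_nat v)"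
    using assms(1) unfolding eventually_poly2_def by blast
  obtain G u1 v1 where G: "polyfun2 G" "\<And>u v. u \<ge> u1 \<Longrightarrow> v \<ge> v1 \<Longrightarrow> g u v = G (of_nat u) (of_nat v)"
    using assms(2) unfolding eventually_poly2_def by blast
  show ?thesis
    by (rule eventually_poly2I[OF polyfun2_add[OF F(1) G(1)], of "max u0 u1" "max v0 v1"])
       (simp add: F(2) G(2))
qed

lemma eventually_poly2_diff:
  assumes "eventually_poly2 f" "eventually_poly2 g"
  shows "eventually_poly2 (\<lambda>u v. f u v - g u v)"
proof -
  obtain F u0 v0 where F: "polyfun2 F" "\<And>u v. u \<ge> u0 \<Longrightarrow> v \<ge> v0 \<Longrightarrow> f u v = F (of_nat u) (of_nat v)"
    using assms(1) unfolding eventually_poly2_def by blast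
  obtain G u1 v1 where G: "polyfun2 G" "\<And>u v. u \<ge> u1 \<Longrightarrow> v \<ge> v1 \<Longrightarrow> g u v = G (of_nat u) (of_nat v)"
    using assms(2) unfolding eventually_poly2_def by blast
  show ?thesis
    by (rule eventually_poly2I[OF polyfun2_diff[OF F(1) G(1)], of "max u0 u1" "max v0 v1"])
       (simp add: F(2) G(2))
qed

section \<open>Counting multisets by size\<close>

lemma finite_multisets_of_size:
  assumes "finite A"
  shows "finite {M. set_mset M \<subseteq> A \<and> size M = n}"
proof -
  have "{M. set_mset M \<subseteq> A \<and> size M = n} \<subseteq> mset ` {xs. set xs \<subseteq> A \<and> length xs = n}"
  proof
    fix M assume M: "M \<in> {M. set_mset M \<subseteq> A \<and> size M = n}"
    obtain xs where "mset xs = M" using ex_mset by blast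
    with M show "M \<in> mset ` {xs. set xs \<subseteq> A \<and> length xs = n}" by auto
  qed
  then show ?thesis using finite_lists_length_eq[OF assms] finite_surj by blast
qed

text \<open>Pascal's rule: a multiset of size \<open>Suc n\<close> over \<open>insert x A\<close>
  either contains x, and removing one copy leaves size n over the same alphabet, or avoids x. Hence
  the induction on n inside the one on A.\<close>

lemma card_multisets_of_size:
  fixes A :: "'a set"
  assumes "finite A"
  shows "card {M. set_mset M \<subseteq> A \<and> size M = n} = (n + card A - 1) choose n"
  using assms
proof (induction A arbitrary: n rule: finite_induct)
  \<comment> \<open>Truncated subtraction makes the formula right: for n = 0 it reads 0 choose 0 =
    1, and for n > 0 it reads (n - 1) choose n = 0.\<close>
  case empty
  have "{M :: 'a multiset. set_mset M \<subseteq> {} \<and> size M = n} = (if n = 0 then {{#}} else {})" by auto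
  then have "card {M :: 'a multiset. set_mset M \<subseteq> {} \<and> size M = n} = card (if n = 0 then {{#} :: 'a multiset} else {})"
    by (simp only:)
  also have "\<dots> = (n + card ({} :: 'a set) - 1) choose n" by (cases n) (simp_all add: binomial_eq_0)
  finally show ?case .
next
  case (insert x A)
  show ?case
  proof (induction n)
    case 0
    have "{M. set_mset M \<subseteq> insert x A \<and> size M = 0} = {{#}}" by auto
    then show ?case by (simp only:) simp
  next
    case (Suc n)
    have fin: "finite {M. set_mset M \<subseteq> insert x A \<and> size M = n}"
         "finite {M. set_mset M \<subseteq> A \<and> size M = Suc n}"
      using insert.hyps(1) by (simp_all add: finite_multisets_of_size)
    have split: "{M. set_mset M \<subseteq> insert x A \<and> size M = Suc n} =
        add_mset x ` {M. set_mset M \<subseteq> insert x A \<and> size M = n} \<union> {M. set_mset M \<subseteq> A \<and> size M = Suc n}"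
    proof (intro set_eqI iffI)
      fix M assume M: "M \<in> {M. set_mset M \<subseteq> insert x A \<and> size M = Suc n}"
      show "M \<in> add_mset x ` {M. set_mset M \<subseteq> insert x A \<and> size M = n} \<union> {M. set_mset M \<subseteq> A \<and> size M = Suc n}"
      proof (cases "x \<in># M")
        case True
        then obtain M' where "M = add_mset x M'" using multi_member_split by metis
        with M show ?thesis by (intro UnI1) auto
      qed (use M in auto)
    qed auto
    have "card {M. set_mset M \<subseteq> insert x A \<and> size M = Suc n} =
        card {M. set_mset M \<subseteq> insert x A \<and> size M = n} + card {M. set_mset M \<subseteq> A \<and> size M = Suc n}"
      unfolding split using fin insert.hyps(2)
      by (subst card_Un_disjoint) (auto simp: card_image inj_on_def)
    also have "\<dots> = (n + card A choose n) + (n + card A choose Suc n)"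
      using Suc insert.IH[of "Suc n"] insert.hyps by simp
    finally show ?case using insert.hyps by simp
  qed
qed

lemma binomial_polyfun: "\<exists>P. \<forall>n. rat_of_nat ((n + k) choose k) = poly P (of_nat n)"
proof (induction k)
  case 0
  show ?case by (rule exI[of _ 1]) simp
next
  case (Suc k)
  then obtain P where P: "\<And>n. rat_of_nat ((n + k) choose k) = poly P (of_nat n)" by blast
  have "rat_of_nat ((n + Suc k) choose Suc k) =
      poly (smult (1 / of_nat (Suc k)) ([:of_nat (Suc k), 1:] * P)) (of_nat n)" for n
  proof -
    have "rat_of_nat (Suc k) * of_nat (Suc (n + k) choose Suc k) = of_nat (Suc (n + k)) * of_nat ((n + k) choose k)"
      by (metis Suc_times_binomial_eq of_nat_mult mult.commute)
    moreover have "rat_of_nat (Suc k) \<noteq> 0" by (simp del: of_nat_Suc)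
    ultimately show ?thesis
      using P[of n] by (simp add: field_simps)
  qed
  then show ?case by blast
qed

text \<open>The restriction n \<ge> 1 is due to the empty alphabet: it has one multiset of size 0
  and none of positive size, so the polynomial is 0.\<close>

lemma card_multisets_of_size_polyfun:
  assumes "finite A"
  shows "\<exists>P. \<forall>n\<ge>1. rat_of_nat (card {M. set_mset M \<subseteq> A \<and> size M = n}) = poly P (of_nat n)"
proof (cases "card A")
  case 0
  then show ?thesis
    by (intro exI[of _ 0]) (simp add: card_multisets_of_size[OF assms] binomial_eq_0)
next
  case (Suc k)
  obtain P where "\<And>n. rat_of_nat ((n + k) choose k) = poly P (of_nat n)"
    using binomial_polyfun by blast
  moreover have "(n + k) choose n = (n + k) choose k" for n
    using binomial_symmetric[of n "n + k"] by simp
  ultimately show ?thesis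
    by (intro exI[of _ P]) (simp add: card_multisets_of_size[OF assms] Suc)
qed

text \<open>Generators marked by \<open>p\<close> have bidegree (1,0) and will be the elements of
  S_1; the others have bidegree (0,1) and will be the elements of J in degree \<beta>. Monomials are
  kept as multisets of indices because different ones may have the same value in the ring.\<close>

definition bimonomials :: "'x set \<Rightarrow> ('x \<Rightarrow> bool) \<Rightarrow> nat \<Rightarrow> nat \<Rightarrow> 'x multiset set" where
  "bimonomials X p u v = {M. set_mset M \<subseteq> X \<and> size (filter_mset p M) = u \<and> size (filter_mset (\<lambda>x. \<not> p x) M) = v}"

lemma size_filter_compl: "size (filter_mset p M) + size (filter_mset (\<lambda>x. \<not> p x) M) = size M"
  by (metis multiset_partition size_union)

lemma finite_bimonomials: "finite X \<Longrightarrow> finite (bimonomials X p u v)"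
  by (rule finite_subset[OF _ finite_multisets_of_size[of X "u + v"]])
     (auto simp: bimonomials_def size_filter_compl)

lemma bij_betw_bimonomials:
  "bij_betw (\<lambda>(A, B). A + B)
     ({M. set_mset M \<subseteq> {x\<in>X. p x} \<and> size M = u} \<times> {M. set_mset M \<subseteq> {x\<in>X. \<not> p x} \<and> size M = v})
     (bimonomials X p u v)"
proof (rule bij_betw_byWitness[where f' = "\<lambda>M. (filter_mset p M, filter_mset (\<lambda>x. \<not> p x) M)"], goal_cases)
  case 1
  have "(filter_mset p (A + B), filter_mset (\<lambda>x. \<not> p x) (A + B)) = (A, B)"
    if "set_mset A \<subseteq> {x\<in>X. p x}" "set_mset B \<subseteq> {x\<in>X. \<not> p x}" for A B
  proof -
    have "filter_mset p A = A" "filter_mset (\<lambda>x. \<not> p x) B = B"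
      using that by (subst filter_mset_eq_conv; auto)+
    moreover have "filter_mset p B = {#}" "filter_mset (\<lambda>x. \<not> p x) A = {#}"
      using that by auto
    ultimately show ?thesis by (simp only: filter_union_mset) simp
  qed
  then show ?case by auto
next
  case 2
  show ?case by (simp flip: multiset_partition)
next
  case 3
  have szA: "size (filter_mset p A) = size A \<and> size (filter_mset (\<lambda>x. \<not> p x) A) = 0"
    if "set_mset A \<subseteq> {x\<in>X. p x}" for A
  proof -
    have "size (filter_mset (\<lambda>x. \<not> p x) A) = 0" using that by auto
    with size_filter_compl[of p A] show ?thesis by linarith
  qed
  have szB: "size (filter_mset p A) = 0 \<and> size (filter_mset (\<lambda>x. \<not> p x) A) = size A"
    if "set_mset A \<subseteq> {x\<in>X. \<not> p x}" for A
  proof -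
    have "size (filter_mset p A) = 0" using that by auto
    with size_filter_compl[of p A] show ?thesis by linarith
  qed
  have "A + B \<in> bimonomials X p u v"
    if AB: "set_mset A \<subseteq> {x\<in>X. p x}" "size A = u" "set_mset B \<subseteq> {x\<in>X. \<not> p x}" "size B = v" for A B
  proof -
    have "set_mset (A + B) \<subseteq> X" using AB(1,3) by auto
    then show ?thesis
      unfolding bimonomials_def mem_Collect_eq filter_union_mset size_union
      using szA[OF AB(1)] szB[OF AB(3)] AB(2,4) by linarith
  qed
  then show ?case by auto
next
  case 4
  show ?case by (auto simp: bimonomials_def)
qed

lemma card_bimonomials:
  "card (bimonomials X p u v) =
     card {M. set_mset M \<subseteq> {x\<in>X. p x} \<and> size M = u} * card {M. set_mset M \<subseteq> {x\<in>X. \<not> p x} \<and> size M = v}"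
  using bij_betw_same_card[OF bij_betw_bimonomials, of X p u v] by (simp only: card_cartesian_product)

lemma card_bimonomials_polyfun2:
  assumes "finite X"
  shows "\<exists>F. polyfun2 F \<and> (\<forall>u\<ge>1. \<forall>v\<ge>1. of_nat (card (bimonomials X p u v)) = F (of_nat u) (of_nat v))"
proof -
  obtain P where P: "\<forall>n\<ge>1. rat_of_nat (card {M. set_mset M \<subseteq> {x\<in>X. p x} \<and> size M = n}) = poly P (of_nat n)"
    using card_multisets_of_size_polyfun[of "{x\<in>X. p x}"] assms by auto
  obtain P' where P': "\<forall>n\<ge>1. rat_of_nat (card {M. set_mset M \<subseteq> {x\<in>X. \<not> p x} \<and> size M = n}) = poly P' (of_nat n)"
    using card_multisets_of_size_polyfun[of "{x\<in>X. \<not> p x}"] assms by auto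
  have "polyfun2 (\<lambda>x y. poly P x)"
    by (induction P) (auto intro!: polyfun2_const polyfun2_add polyfun2_mult polyfun2_fst)
  moreover have "polyfun2 (\<lambda>x y. poly P' y)"
    by (induction P') (auto intro!: polyfun2_const polyfun2_add polyfun2_mult polyfun2_snd)
  ultimately show ?thesis
    using P P' by (intro exI[of _ "\<lambda>x y. poly P x * poly P' y"]) (simp add: polyfun2_mult card_bimonomials)
qed

text \<open>Division by \<open>L\<close> lowers the bidegree by that of \<open>L\<close>, so the
  count is a translate of the polynomial for all monomials. The thresholds are \<open>Suc a\<close>
  and \<open>Suc b\<close> because that polynomial is valid from bidegree (1,1) on.\<close>

lemma card_bimonomials_multiples:
  assumes "finite X"
  shows "eventually_poly2 (\<lambda>u v. of_nat (card {M\<in>bimonomials X p u v. L \<subseteq># M}))"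
proof (cases "set_mset L \<subseteq> X")
  case False
  then have "{M\<in>bimonomials X p u v. L \<subseteq># M} = {}" for u v
    by (auto simp: bimonomials_def dest: set_mset_mono)
  then show ?thesis
    by (intro eventually_poly2I[OF polyfun2_const[of 0]]) (simp only: card.empty of_nat_0)
next
  case True
  define a where "a = size (filter_mset p L)"
  define b where "b = size (filter_mset (\<lambda>x. \<not> p x) L)"
  have "bij_betw ((+) L) (bimonomials X p (u - a) (v - b)) {M\<in>bimonomials X p u v. L \<subseteq># M}"
    if "u \<ge> a" "v \<ge> b" for u v
  proof (rule bij_betw_imageI)
    show "inj_on ((+) L) (bimonomials X p (u - a) (v - b))" by simp
    show "(+) L ` bimonomials X p (u - a) (v - b) = {M\<in>bimonomials X p u v. L \<subseteq># M}"
    proof (intro set_eqI iffI)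
      fix M assume "M \<in> {M\<in>bimonomials X p u v. L \<subseteq># M}"
      then have M: "M \<in> bimonomials X p u v" "M = L + (M - L)" by auto
      have "M - L \<in> bimonomials X p (u - a) (v - b)"
        using M(1) arg_cong[OF M(2), of "\<lambda>M. size (filter_mset p M)"]
           arg_cong[OF M(2), of "\<lambda>M. size (filter_mset (\<lambda>x. \<not> p x) M)"] in_diffD[of _ M L]
        by (auto simp: bimonomials_def a_def b_def simp del: filter_diff_mset)
      with M(2) show "M \<in> (+) L ` bimonomials X p (u - a) (v - b)" by blast
    qed (use that True in \<open>auto simp: bimonomials_def a_def b_def\<close>)
  qed
  then have card: "card {M\<in>bimonomials X p u v. L \<subseteq># M} = card (bimonomials X p (u - a) (v - b))"
    if "u \<ge> a" "v \<ge> b" for u v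
    by (rule bij_betw_same_card[symmetric]) (rule that)+
  obtain F where F: "polyfun2 F"
    "\<forall>u\<ge>1. \<forall>v\<ge>1. of_nat (card (bimonomials X p u v)) = F (of_nat u) (of_nat v)"
    using card_bimonomials_polyfun2[OF assms] by blast
  show ?thesis
    by (rule eventually_poly2I[OF polyfun2_shift[OF F(1), of "of_nat a" "of_nat b"], of "Suc a" "Suc b"])
       (use F(2) in \<open>auto simp: card of_nat_diff\<close>)
qed

text \<open>Inclusion-exclusion: the multiples of \<open>L\<close> that are also multiples of some
  member of \<open>Ls'\<close> are the multiples of the least common multiples of \<open>L\<close>
  with the members of \<open>Ls'\<close>. These form a new list as long as \<open>Ls'\<close>, which
  is why the induction is on the length.\<close>

lemma card_bimonomials_in_ideal:
  assumes "finite X"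
  shows "eventually_poly2 (\<lambda>u v. of_nat (card {M\<in>bimonomials X p u v. \<exists>L\<in>set Ls. L \<subseteq># M}))"
proof (induction "length Ls" arbitrary: Ls)
  case 0
  then show ?case by (intro eventually_poly2I[OF polyfun2_const[of 0]]) simp
next
  case (Suc n)
  then obtain L Ls' where Ls: "Ls = L # Ls'" "length Ls' = n" by (metis length_Suc_conv)
  let ?B = "\<lambda>u v. {M\<in>bimonomials X p u v. L \<subseteq># M}"
  let ?C = "\<lambda>Ls u v. {M\<in>bimonomials X p u v. \<exists>L\<in>set Ls. L \<subseteq># M}"
  have eq: "rat_of_nat (card (?C Ls u v)) =
      of_nat (card (?B u v)) + of_nat (card (?C Ls' u v)) - of_nat (card (?C (map ((\<union>#) L) Ls') u v))" for u v
  proof -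
    have fin: "finite (?B u v)" "finite (?C Ls' u v)" using finite_bimonomials[OF assms] by auto
    have "?C Ls u v = ?B u v \<union> ?C Ls' u v" by (auto simp: Ls)
    moreover have "?C (map ((\<union>#) L) Ls') u v = ?B u v \<inter> ?C Ls' u v" by (auto simp: Ls)
    ultimately have "card (?B u v) + card (?C Ls' u v) = card (?C Ls u v) + card (?C (map ((\<union>#) L) Ls') u v)"
      using card_Un_Int[OF fin] by (simp only:)
    from arg_cong[OF this, of rat_of_nat] show ?thesis by simp
  qed
  show ?case unfolding eq
    by (intro eventually_poly2_diff eventually_poly2_add card_bimonomials_multiples assms Suc.hyps(1))
       (simp_all add: Ls)
qed

section \<open>Linear algebra\<close>

context vector_space
begin

lemma finite_basis:
  assumes "finite W" "V \<subseteq> span W"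
  obtains B where "finite B" "B \<subseteq> V" "independent B" "V \<subseteq> span B" "card B = dim V"
proof -
  obtain B where B: "B \<subseteq> V" "independent B" "V \<subseteq> span B" "card B = dim V"
    using basis_exists by blast
  moreover have "finite B"
    using independent_span_bound[OF assms(1) B(2)] B(1) assms(2) by auto
  ultimately show ?thesis using that by blast
qed

lemma dim_mono_finite:
  assumes "V \<subseteq> span U" "finite W" "U \<subseteq> span W"
  shows "dim V \<le> dim U"
proof -
  obtain B where "finite B" "U \<subseteq> span B" "card B = dim U"
    using finite_basis[OF assms(2,3)] by metis
  then show ?thesis using assms(1) dim_le_card[of V B] by (metis order_trans span_minimal subspace_span)
qed

lemma dim_eq_imp_span_eq:
  assumes "U \<subseteq> V" "dim V \<le> dim U" "finite W" "V \<subseteq> span W"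
  shows "V \<subseteq> span U"
proof (rule ccontr)
  assume "\<not> V \<subseteq> span U"
  then obtain x where x: "x \<in> V" "x \<notin> span U" by blast
  obtain B where B: "finite B" "B \<subseteq> U" "independent B" "U \<subseteq> span B" "card B = dim U"
    using finite_basis[of W U] assms by blast
  have "x \<notin> span B" using x(2) B(2) span_mono by blast
  then have "independent (insert x B)" using B(3) independent_insertI by blast
  moreover have "insert x B \<subseteq> V" using x(1) B(2) assms(1) by auto
  ultimately have "card (insert x B) \<le> dim V"
  proof -
    obtain C where "finite C" "V \<subseteq> span C" "card C = dim V" using finite_basis[OF assms(3,4)] by metis
    then show ?thesis
      using independent_span_bound[of C "insert x B"] \<open>independent (insert x B)\<close> \<open>insert x B \<subseteq> V\<close> by auto
  qed
  moreover have "x \<notin> B" using \<open>x \<notin> span B\<close> span_base by blast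
  ultimately show False using B(1,5) assms(2) by simp
qed

lemma dim_insert_new:
  assumes "finite W" "U \<subseteq> span W" "x \<notin> span U"
  shows "dim (insert x U) = Suc (dim U)"
proof -
  obtain B where B: "finite B" "B \<subseteq> U" "independent B" "U \<subseteq> span B" "card B = dim U"
    using finite_basis[OF assms(1,2)] by blast
  have eq: "span B = span U" using B(2,4) by (metis span_mono span_span subset_antisym)
  then have "x \<notin> span B" using assms(3) by simp
  then have "independent (insert x B)" "x \<notin> B"
    using B(3) independent_insertI span_base by blast+
  moreover have "span (insert x B) = span (insert x U)"
    using eq by (simp add: span_insert)
  ultimately show ?thesis
    using B(1,5) dim_eq_card[of "insert x B" "insert x U"] by simp
qed

text \<open>Adding the vectors \<open>f i\<close> to \<open>Q\<close> in increasing order of i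
  raises the dimension by one exactly at the indices counted. With monomials as indices these are
  the standard monomials.\<close>

lemma card_greedy_indices:
  fixes f :: "'i::linorder \<Rightarrow> 'b"
  assumes "finite A" "finite W" "Q \<subseteq> span W"
  shows "card {i\<in>A. f i \<notin> span (Q \<union> f ` {j\<in>A. j < i})} + dim Q = dim (Q \<union> f ` A)"
  using assms(1)
proof (induction A rule: finite_linorder_max_induct)
  case empty
  show ?case by simp
next
  case (insert b A)
  let ?S = "\<lambda>A. {i\<in>A. f i \<notin> span (Q \<union> f ` {j\<in>A. j < i})}"
  have b: "{j \<in> insert b A. j < b} = A" using insert.hyps(2) by auto
  have "{j \<in> insert b A. j < i} = {j \<in> A. j < i}" if "i \<in> A" for i
    using insert.hyps(2) that by auto
  then have S: "?S (insert b A) = (if f b \<in> span (Q \<union> f ` A) then ?S A else insert b (?S A))"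
    using b by auto
  have bn: "b \<notin> ?S A" using insert.hyps(2) by auto
  have ins: "Q \<union> f ` insert b A = insert (f b) (Q \<union> f ` A)" by auto
  show ?case
  proof (cases "f b \<in> span (Q \<union> f ` A)")
    case True
    then have "span (Q \<union> f ` insert b A) = span (Q \<union> f ` A)"
      unfolding ins by (rule span_redundant)
    then have "dim (Q \<union> f ` insert b A) = dim (Q \<union> f ` A)" by (rule span_eq_dim)
    then show ?thesis unfolding S using True insert.IH by simp
  next
    case False
    have "Q \<union> f ` A \<subseteq> span (W \<union> f ` A)"
      using assms(3) span_mono[of W "W \<union> f ` A"] span_base[of _ "W \<union> f ` A"] by blast
    then have "dim (Q \<union> f ` insert b A) = Suc (dim (Q \<union> f ` A))"
      unfolding ins using False insert.hyps(1) assms(2) by (intro dim_insert_new[of "W \<union> f ` A"]) auto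
    moreover have "card (?S (insert b A)) = Suc (card (?S A))"
      unfolding S using False bn insert.hyps(1) by simp
    ultimately show ?thesis using insert.IH by simp
  qed
qed

end

section \<open>Homogeneous components and monomials\<close>

context standard_graded_algebra
begin

definition comp :: "'a \<Rightarrow> nat \<Rightarrow> 'a" where
  "comp x = (THE f. (\<forall>n. f n \<in> R n) \<and> finite {n. f n \<noteq> 0} \<and> x = (\<Sum>n | f n \<noteq> 0. f n))"

lemma comp: "comp x n \<in> R n" "finite {n. comp x n \<noteq> 0}" "x = (\<Sum>n | comp x n \<noteq> 0. comp x n)"
  using theI'[OF direct_sum[of x]] unfolding comp_def by blast+

lemma comp_eq:
  assumes "finite A" "\<And>n. n \<in> A \<Longrightarrow> f n \<in> R n" "x = (\<Sum>n\<in>A. f n)"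
  shows "comp x n = (if n \<in> A then f n else 0)"
proof -
  define g where "g n = (if n \<in> A then f n else 0)" for n
  have "{n. g n \<noteq> 0} \<subseteq> A" by (auto simp: g_def)
  moreover have "(\<Sum>n\<in>A. f n) = (\<Sum>n\<in>A. g n)" by (simp add: g_def)
  moreover have "(\<Sum>n\<in>A. g n) = (\<Sum>n | g n \<noteq> 0. g n)"
    using assms(1) by (intro sum.mono_neutral_right) (auto simp: g_def)
  ultimately have "(\<forall>n. g n \<in> R n) \<and> finite {n. g n \<noteq> 0} \<and> x = (\<Sum>n | g n \<noteq> 0. g n)"
    using assms zero_closed finite_subset by (auto simp: g_def)
  then have "comp x = g"
    unfolding comp_def by (rule the1_equality[OF direct_sum])
  then show ?thesis by (simp add: g_def)
qed

lemma comp_homogeneous: "x \<in> R m \<Longrightarrow> comp x n = (if n = m then x else 0)"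
  using comp_eq[of "{m}" "\<lambda>_. x" x n] by auto

lemma comp_0 [simp]: "comp 0 n = 0"
  using comp_eq[of "{}" "\<lambda>_. 0" 0 n] by simp

lemma subspace_R: "subspace (R n)"
proof (rule subspaceI)
  show "kscale \<iota> c x \<in> R n" if "x \<in> R n" for c x
    using mult_closed[of "\<iota> c" 0 x n] that by (simp add: kscale_def degree_zero)
qed (auto simp: zero_closed add_closed)

lemma comp_sum_superset:
  assumes "finite A" "{n. comp x n \<noteq> 0} \<subseteq> A"
  shows "x = (\<Sum>n\<in>A. comp x n)"
  using comp(3)[of x] sum.mono_neutral_left[OF assms, of "comp x"] by auto

lemma comp_add: "comp (x + y) n = comp x n + comp y n"
proof -
  let ?A = "{n. comp x n \<noteq> 0} \<union> {n. comp y n \<noteq> 0}"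
  have fin: "finite ?A" using comp(2) by simp
  have "x + y = (\<Sum>n\<in>?A. comp x n + comp y n)"
    using comp_sum_superset[OF fin, of x] comp_sum_superset[OF fin, of y] by (simp add: sum.distrib)
  from comp_eq[OF fin _ this, of n] show ?thesis using comp(1) add_closed by (auto split: if_splits)
qed

lemma comp_sum: "comp (\<Sum>i\<in>A. f i) n = (\<Sum>i\<in>A. comp (f i) n)"
  by (induction A rule: infinite_finite_induct) (simp_all add: comp_add)

lemma comp_homogeneous_mult:
  assumes "y \<in> R m"
  shows "comp (y * x) n = (if m \<le> n then y * comp x (n - m) else 0)"
proof -
  let ?A = "(+) m ` {n. comp x n \<noteq> 0}"
  have "y * x = (\<Sum>n | comp x n \<noteq> 0. y * comp x n)"
    using comp(3)[of x] by (metis sum_distrib_left)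
  also have "\<dots> = (\<Sum>n\<in>?A. y * comp x (n - m))"
    by (subst sum.reindex) auto
  finally have *: "y * x = \<dots>" .
  have "y * comp x (n - m) \<in> R n" if "n \<in> ?A" for n
    using that mult_closed[OF assms comp(1)] by auto
  then have "comp (y * x) n = (if n \<in> ?A then y * comp x (n - m) else 0)"
    by (rule comp_eq[OF _ _ *, rotated]) (use comp(2) in auto)
  moreover have "n \<in> ?A \<longleftrightarrow> m \<le> n \<and> comp x (n - m) \<noteq> 0"
    by (auto simp: image_iff)
  ultimately show ?thesis by auto
qed

lemma comp_mult: "comp (x * y) n = (\<Sum>i\<le>n. comp x i * comp y (n - i))"
proof -
  let ?A = "{i. comp x i \<noteq> 0} \<union> {..n}"
  have fin: "finite ?A" using comp(2) by simp
  have "comp (x * y) n = comp (\<Sum>i\<in>?A. comp x i * y) n"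
    using comp_sum_superset[OF fin, of x] by (metis sum_distrib_right sup_ge1)
  also have "\<dots> = (\<Sum>i\<in>?A. if i \<le> n then comp x i * comp y (n - i) else 0)"
    by (simp add: comp_sum comp_homogeneous_mult[OF comp(1)])
  also have "\<dots> = (\<Sum>i\<le>n. comp x i * comp y (n - i))"
    using fin by (intro sum.mono_neutral_cong_right) auto
  finally show ?thesis .
qed

lemma scale_mult_left: "kscale \<iota> c x * y = kscale \<iota> c (x * y)"
  by (simp add: kscale_def mult.assoc)

lemma scale_mult_right: "x * kscale \<iota> c y = kscale \<iota> c (x * y)"
  by (simp add: kscale_def mult.left_commute)

lemma comp_scale: "comp (kscale \<iota> c x) n = kscale \<iota> c (comp x n)"
  using comp_homogeneous_mult[of "\<iota> c" 0 x n] by (simp add: kscale_def degree_zero)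

lemma span_mult:
  assumes "x \<in> span A" "y \<in> span B" "\<And>a b. a \<in> A \<Longrightarrow> b \<in> B \<Longrightarrow> a * b \<in> span C"
  shows "x * y \<in> span C"
proof -
  have "a * y \<in> span C" if "a \<in> A" for a
    using assms(2)
  proof (induction rule: span_induct_alt)
    case (step c z w)
    then show ?case
      using assms(3)[OF that] span_add span_scale by (simp add: distrib_left scale_mult_right)
  qed (simp add: span_zero)
  with assms(1) show ?thesis
  proof (induction rule: span_induct_alt)
    case (step c z w)
    then show ?case using span_add span_scale by (simp add: distrib_right scale_mult_left)
  qed (simp add: span_zero)
qed

section \<open>Monomials in homogeneous elements and generation in degree one\<close>

definition monomial :: "('i \<Rightarrow> 'a) \<Rightarrow> 'i multiset \<Rightarrow> 'a" where
  "monomial f M = (\<Prod>i\<in>#M. f i)"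

lemma monomial_empty [simp]: "monomial f {#} = 1"
  and monomial_add_mset [simp]: "monomial f (add_mset i M) = f i * monomial f M"
  and monomial_union: "monomial f (M + N) = monomial f M * monomial f N"
  by (simp_all add: monomial_def)

lemma one_in_R0: "1 \<in> R 0"
  using degree_zero hom_one by (metis rangeI)

lemma monomial_in_R:
  "(\<And>i. i \<in># M \<Longrightarrow> f i \<in> R (w i)) \<Longrightarrow> monomial f M \<in> R (\<Sum>i\<in>#M. w i)"
  by (induction M) (auto simp: one_in_R0 mult_closed)

text \<open>The degree one components of finitely many algebra generators suffice, because the
  degree one component of xy is x_0 y_1 + x_1 y_0 with x_0 and y_0 scalars.\<close>

lemma finite_span_R1: "\<exists>Y. finite Y \<and> Y \<subseteq> R 1 \<and> R 1 \<subseteq> span Y"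
proof -
  obtain X where X: "finite X" "algebra_generated \<iota> X = UNIV" using finitely_generated by blast
  let ?Y = "(\<lambda>x. comp x 1) ` X"
  have "comp x 1 \<in> span ?Y" if "x \<in> algebra_generated \<iota> X" for x
    using that
  proof induction
    case (scalar c)
    have "\<iota> c \<in> R 0" by (simp add: degree_zero)
    from comp_homogeneous[OF this] show ?case by (simp add: span_zero)
  next
    case (gen x)
    then show ?case by (simp add: span_base)
  next
    case (add x y)
    then show ?case by (simp add: comp_add span_add)
  next
    case (mult x y)
    obtain a b where ab: "comp x 0 = \<iota> a" "comp y 0 = \<iota> b"
      using comp(1)[of x 0] comp(1)[of y 0] by (auto simp: degree_zero)
    have "comp (x * y) 1 = kscale \<iota> a (comp y 1) + kscale \<iota> b (comp x 1)"
      by (simp add: comp_mult ab kscale_def mult.commute)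
    then show ?case using mult by (simp add: span_add span_scale)
  qed
  then have "comp x 1 \<in> span ?Y" for x using X(2) by blast
  moreover have "comp x 1 = x" if "x \<in> R 1" for x
    using comp_homogeneous[OF that] by simp
  ultimately have "R 1 \<subseteq> span ?Y" by (metis subsetI)
  then show ?thesis using X(1) comp(1) by (intro exI[of _ ?Y]) auto
qed

lemma generators_R1: "\<exists>(f :: nat \<Rightarrow> 'a) m. (\<forall>i<m. f i \<in> R 1) \<and> R 1 \<subseteq> span (f ` {..<m})"
proof -
  obtain Y where Y: "finite Y" "Y \<subseteq> R 1" "R 1 \<subseteq> span Y" using finite_span_R1 by blast
  obtain f :: "nat \<Rightarrow> 'a" and m where "Y = f ` {i::nat. i < m}"
    using finite_imp_nat_seg_image_inj_on[OF Y(1)] by blast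
  with Y show ?thesis by (intro exI[of _ f] exI[of _ m]) (auto simp: lessThan_def)
qed

text \<open>The spans \<open>T n\<close> of the monomials of size n are multiplicative, so induction
  over the generation of an element by \<open>R 1\<close> places its component of degree n in
  \<open>T n\<close>; by \<open>standard\<close> this covers every element.\<close>

lemma R_eq_span_monomials:
  assumes f: "\<And>i. i < m \<Longrightarrow> f i \<in> R 1" "R 1 \<subseteq> span (f ` {..<m})"
  shows "R n = span (monomial f ` {M. set_mset M \<subseteq> {..<m} \<and> size M = n})"
proof -
  define T where "T n = span (monomial f ` {M. set_mset M \<subseteq> {..<m} \<and> size M = n})" for n
  have T_mult: "x * y \<in> T (i + j)" if "x \<in> T i" "y \<in> T j" for x y i j
    using that unfolding T_def
  proof (rule span_mult)
    fix a b assume "a \<in> monomial f ` {M. set_mset M \<subseteq> {..<m} \<and> size M = i}"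
      "b \<in> monomial f ` {M. set_mset M \<subseteq> {..<m} \<and> size M = j}"
    then obtain M N where "a = monomial f M" "set_mset M \<subseteq> {..<m}" "size M = i"
      "b = monomial f N" "set_mset N \<subseteq> {..<m}" "size N = j" by blast
    then show "a * b \<in> span (monomial f ` {M. set_mset M \<subseteq> {..<m} \<and> size M = i + j})"
      by (intro span_base image_eqI[of _ _ "M + N"]) (auto simp: monomial_union)
  qed
  have T0: "0 \<in> T n" for n by (simp add: T_def span_zero)
  have "\<forall>n. comp x n \<in> T n" if "x \<in> algebra_generated \<iota> (R 1)" for x
    using that
  proof induction
    case (scalar c)
    have "\<iota> c \<in> R 0" by (simp add: degree_zero)
    moreover have "\<iota> c \<in> T 0"
    proof -
      have "1 \<in> monomial f ` {M. set_mset M \<subseteq> {..<m} \<and> size M = 0}"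
        by (rule image_eqI[of _ _ "{#}"]) auto
      from span_scale[OF span_base[OF this], of c] show ?thesis by (simp add: T_def kscale_def)
    qed
    ultimately show ?case using T0 by (simp add: comp_homogeneous)
  next
    case (gen x)
    have "f i \<in> T 1" if "i < m" for i
      unfolding T_def using that by (intro span_base image_eqI[of _ _ "{#i#}"]) auto
    then have "f ` {..<m} \<subseteq> T 1" by blast
    moreover have "subspace (T 1)" by (simp add: T_def)
    ultimately have "x \<in> T 1" using gen f(2) span_minimal by blast
    then show ?case using T0 gen by (simp add: comp_homogeneous)
  next
    case (add x y)
    then show ?case by (simp add: comp_add T_def span_add)
  next
    case (mult x y)
    have "comp x i * comp y (n - i) \<in> T n" if "i \<le> n" for i n
      using T_mult[of "comp x i" i "comp y (n - i)" "n - i"] mult that by simp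
    then show ?case unfolding comp_mult T_def by (auto intro!: span_sum)
  qed
  then have comp_T: "comp x n \<in> T n" for x n using standard by blast
  show ?thesis
  proof
    show "R n \<subseteq> span (monomial f ` {M. set_mset M \<subseteq> {..<m} \<and> size M = n})"
    proof
      fix x assume "x \<in> R n"
      then have "comp x n = x" by (simp add: comp_homogeneous)
      then show "x \<in> span (monomial f ` {M. set_mset M \<subseteq> {..<m} \<and> size M = n})"
        using comp_T[of x n] by (simp add: T_def)
    qed
    have "monomial f M \<in> R n" if "set_mset M \<subseteq> {..<m}" "size M = n" for M
      using monomial_in_R[of M f "\<lambda>_. 1"] f(1) that by (simp add: subset_iff)
    then show "span (monomial f ` {M. set_mset M \<subseteq> {..<m} \<and> size M = n}) \<subseteq> R n"
      by (intro span_minimal subspace_R) auto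
  qed
qed

end

section \<open>Graded ideals and their growth\<close>

context standard_graded_algebra
begin

text \<open>These are the leading monomials of the relations among the \<open>f i\<close> modulo
  \<open>V\<close>. The order \<open><\<close> is the multiset order, which is total for indices in
  \<open>nat\<close> and compatible with \<open>add_mset\<close>. The type of degrees is left open
  so that one construction serves both the grading by size with a graded ideal as \<open>V\<close>
  and the bigrading with \<open>V\<close> empty.\<close>

definition nonstandard :: "(nat \<Rightarrow> 'a) \<Rightarrow> nat set \<Rightarrow> (nat multiset \<Rightarrow> 'd) \<Rightarrow> ('d \<Rightarrow> 'a set) \<Rightarrow> nat multiset set" where
  "nonstandard f X deg V = {M. set_mset M \<subseteq> X \<and>
     monomial f M \<in> span (V (deg M) \<union> monomial f ` {N. set_mset N \<subseteq> X \<and> deg N = deg M \<and> N < M})}"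

text \<open>Multiplying a reduction of \<open>M\<close> by \<open>f i\<close> gives a reduction of
  \<open>add_mset i M\<close>, as \<open>V\<close> and the order respect multiplication. So the
  nonstandard monomials form a monomial ideal, to which Dickson's lemma applies.\<close>

lemma nonstandard_add_mset:
  assumes "M \<in> nonstandard f X deg V" "i \<in> X"
    and deg: "\<And>M N i. deg M = deg N \<Longrightarrow> deg (add_mset i M) = deg (add_mset i N)"
    and V: "\<And>i M y. i \<in> X \<Longrightarrow> y \<in> V (deg M) \<Longrightarrow> f i * y \<in> V (deg (add_mset i M))"
  shows "add_mset i M \<in> nonstandard f X deg V"
proof -
  have "f i * monomial f M \<in> span (V (deg (add_mset i M)) \<union>
    monomial f ` {N. set_mset N \<subseteq> X \<and> deg N = deg (add_mset i M) \<and> N < add_mset i M})" (is "_ \<in> span ?C")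
  proof (rule span_mult[OF span_base])
    show "f i \<in> {f i}" by simp
    show "monomial f M \<in> span (V (deg M) \<union> monomial f ` {N. set_mset N \<subseteq> X \<and> deg N = deg M \<and> N < M})"
      using assms(1) by (simp add: nonstandard_def)
    fix a b assume "a \<in> {f i}" "b \<in> V (deg M) \<union> monomial f ` {N. set_mset N \<subseteq> X \<and> deg N = deg M \<and> N < M}"
    then consider "a = f i" "b \<in> V (deg M)" |
      N where "a = f i" "b = monomial f N" "set_mset N \<subseteq> X" "deg N = deg M" "N < M" by blast
    then show "a * b \<in> span ?C"
    proof cases
      case 1
      then show ?thesis using V[OF assms(2)] by (auto intro: span_base)
    next
      case 2
      then show ?thesis
        using deg[of N M i] assms(2)
        by (intro span_base UnI2 image_eqI[of _ _ "add_mset i N"]) auto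
    qed
  qed
  then show ?thesis using assms(1,2) by (simp add: nonstandard_def)
qed

lemma nonstandard_mono:
  assumes "M \<in> nonstandard f X deg V" "set_mset N \<subseteq> X" "M \<subseteq># N"
    and deg: "\<And>M N i. deg M = deg N \<Longrightarrow> deg (add_mset i M) = deg (add_mset i N)"
    and V: "\<And>i M y. i \<in> X \<Longrightarrow> y \<in> V (deg M) \<Longrightarrow> f i * y \<in> V (deg (add_mset i M))"
  shows "N \<in> nonstandard f X deg V"
proof -
  have "set_mset K \<subseteq> X \<Longrightarrow> K + M \<in> nonstandard f X deg V" for K
  proof (induction K)
    case empty
    show ?case using assms(1) by simp
  next
    case (add i K)
    have "add_mset i (K + M) \<in> nonstandard f X deg V"
    proof (rule nonstandard_add_mset)
      show "K + M \<in> nonstandard f X deg V" "i \<in> X" using add by auto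
    qed (fact deg V)+
    then show ?case by simp
  qed
  moreover have "set_mset (N - M) \<subseteq> X" using assms(2) by (auto dest: in_diffD)
  ultimately have "N - M + M \<in> nonstandard f X deg V" by blast
  then show ?thesis using assms(3) by simp
qed

text \<open>Macaulay's basis theorem in counting form: modulo \<open>V n\<close>, the standard
  monomials of degree n form a basis of the span of all monomials of degree n.\<close>

lemma card_standard:
  assumes "finite {M. set_mset M \<subseteq> X \<and> deg M = n}" "finite W" "V n \<subseteq> span W"
  shows "card ({M. set_mset M \<subseteq> X \<and> deg M = n} - nonstandard f X deg V) + dim (V n) =
     dim (V n \<union> monomial f ` {M. set_mset M \<subseteq> X \<and> deg M = n})"
proof -
  let ?A = "{M. set_mset M \<subseteq> X \<and> deg M = n}"
  have "{N \<in> ?A. N < M} = {N. set_mset N \<subseteq> X \<and> deg N = deg M \<and> N < M}" if "M \<in> ?A" for M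
    using that by auto
  then have "?A - nonstandard f X deg V =
      {M \<in> ?A. monomial f M \<notin> span (V n \<union> monomial f ` {N \<in> ?A. N < M})}"
    by (auto simp: nonstandard_def)
  then show ?thesis using card_greedy_indices[OF assms, of "monomial f"] by simp
qed

section \<open>Graded ideals and the ascending chain condition\<close>

lemma finite_dim_R: "\<exists>W. finite W \<and> R n \<subseteq> span W"
proof -
  obtain f m where "\<forall>i<m. f i \<in> R 1" "R 1 \<subseteq> span (f ` {..<m::nat})" using generators_R1 by blast
  then have "R n = span (monomial f ` {M. set_mset M \<subseteq> {..<m} \<and> size M = n})"
    using R_eq_span_monomials[of m f n] by simp
  then show ?thesis
    by (intro exI[of _ "monomial f ` {M. set_mset M \<subseteq> {..<m} \<and> size M = n}"])
       (simp add: finite_multisets_of_size)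
qed

lemma dim_mono_R: "U \<subseteq> span V \<Longrightarrow> V \<subseteq> R n \<Longrightarrow> dim U \<le> dim V"
  using finite_dim_R[of n] dim_mono_finite by (meson order_trans)

text \<open>A graded ideal is the family of its homogeneous parts, ordered pointwise, so that
  dimensions can be compared degree by degree; \<open>homogeneous_sum\<close> later yields the
  subset of the ring.\<close>

definition graded_ideal :: "(nat \<Rightarrow> 'a set) \<Rightarrow> bool" where
  "graded_ideal Q \<longleftrightarrow> (\<forall>n. subspace (Q n) \<and> Q n \<subseteq> R n) \<and>
     (\<forall>m n x y. x \<in> R m \<longrightarrow> y \<in> Q n \<longrightarrow> x * y \<in> Q (m + n))"

definition hilbert :: "(nat \<Rightarrow> 'a set) \<Rightarrow> nat \<Rightarrow> nat" where
  "hilbert Q n = dim (R n) - dim (Q n)"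

lemma graded_idealD:
  assumes "graded_ideal Q"
  shows "subspace (Q n)" "Q n \<subseteq> R n" "x \<in> R m \<Longrightarrow> y \<in> Q n \<Longrightarrow> x * y \<in> Q (m + n)"
  using assms by (auto simp: graded_ideal_def)

text \<open>A strict inclusion must create a new nonstandard monomial \<open>M i\<close>, as
  otherwise the dimensions, and hence the ideals, would agree in every degree. Dickson's lemma
  yields i < j with \<open>M i\<close> dividing \<open>M j\<close>; but then \<open>M j\<close> is
  already nonstandard for \<open>Q j\<close>, so it is not new.\<close>

lemma acc_graded_ideals:
  assumes gr: "\<And>i. graded_ideal (Q i)" and lt: "\<And>i. Q i < Q (Suc i)"
  shows False
proof -
  obtain f m where f: "\<forall>i<m. f i \<in> R 1" "R 1 \<subseteq> span (f ` {..<m::nat})" using generators_R1 by blast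
  let ?N = "\<lambda>i. nonstandard f {..<m} size (Q i)"
  let ?A = "\<lambda>n. {M. set_mset M \<subseteq> {..<m} \<and> size M = n}"
  have mono: "Q i \<le> Q j" if "i \<le> j" for i j
    using that lt by (meson lift_Suc_mono_le order_less_imp_le)
  have N_mono: "?N i \<subseteq> ?N j" if "i \<le> j" for i j
  proof -
    have "Q i n \<subseteq> Q j n" for n using mono[OF that] by (simp add: le_fun_def)
    then show ?thesis
      unfolding nonstandard_def using span_mono[OF Un_mono[OF _ subset_refl]] by blast
  qed
  have R: "R n = span (monomial f ` ?A n)" for n
    using R_eq_span_monomials[of m f n] f by simp
  have card: "card (?A n - ?N i) + dim (Q i n) = dim (R n)" for i n
  proof -
    obtain W where W: "finite W" "R n \<subseteq> span W" using finite_dim_R by blast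
    have "Q i n \<subseteq> span W" using W(2) graded_idealD(2)[OF gr] by blast
    moreover have "span (Q i n \<union> monomial f ` ?A n) = span (R n)"
    proof -
      have "monomial f ` ?A n \<subseteq> R n" by (subst R) (rule span_superset)
      then have "Q i n \<union> monomial f ` ?A n \<subseteq> R n" using graded_idealD(2)[OF gr] by blast
      then have "span (Q i n \<union> monomial f ` ?A n) \<subseteq> span (R n)" by (rule span_mono)
      moreover have "R n \<subseteq> span (Q i n \<union> monomial f ` ?A n)" unfolding R by (rule span_mono) auto
      then have "span (R n) \<subseteq> span (Q i n \<union> monomial f ` ?A n)" by (rule span_minimal) simp
      ultimately show ?thesis by blast
    qed
    ultimately show ?thesis
      using card_standard[of "{..<m}" size n W "Q i" f] finite_multisets_of_size[of "{..<m}" n] W(1)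
        span_eq_dim[of "Q i n \<union> monomial f ` ?A n" "R n"] by simp
  qed
  have "\<exists>M. M \<in> ?N (Suc i) - ?N i" for i
  proof (rule ccontr)
    assume "\<nexists>M. M \<in> ?N (Suc i) - ?N i"
    then have eq: "?N (Suc i) = ?N i" using N_mono[of i "Suc i"] by auto
    have "Q i n = Q (Suc i) n" for n
    proof -
      have dim: "dim (Q (Suc i) n) \<le> dim (Q i n)" using card[of n i] card[of n "Suc i"] eq by simp
      have sub: "Q i n \<subseteq> Q (Suc i) n" using mono[of i "Suc i"] by (simp add: le_fun_def)
      obtain W where W: "finite W" "R n \<subseteq> span W" using finite_dim_R by blast
      have "Q (Suc i) n \<subseteq> span (Q i n)"
        using graded_idealD(2)[OF gr, of "Suc i" n] W by (intro dim_eq_imp_span_eq[OF sub dim W(1)]) auto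
      moreover have "span (Q i n) = Q i n" using graded_idealD(1)[OF gr] by simp
      ultimately show ?thesis using sub by auto
    qed
    then show False using lt[of i] by (metis ext less_irrefl)
  qed
  then obtain M where M: "\<And>i. M i \<in> ?N (Suc i)" "\<And>i. M i \<notin> ?N i" by (metis DiffE)
  have X: "set_mset (M i) \<subseteq> {..<m}" for i using M(1) by (simp add: nonstandard_def)
  then obtain i j where ij: "i < j" "M i \<subseteq># M j" using dickson[of "{..<m}" M] by auto
  have "M j \<in> ?N j"
  proof (rule nonstandard_mono[OF _ X ij(2)])
    show "M i \<in> ?N j" using M(1)[of i] N_mono[of "Suc i" j] ij(1) by auto
    show "f i * y \<in> Q j (size (add_mset i M))" if "i \<in> {..<m}" "y \<in> Q j (size M)" for i M y
      using graded_idealD(3)[OF gr, of "f i" 1 y j "size M"] that f(1) by simp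
  qed auto
  with M(2) show False by blast
qed

lemma maximal_graded_ideal:
  assumes "graded_ideal Q0" "P Q0"
  obtains Q where "graded_ideal Q" "P Q" "Q0 \<le> Q" "\<And>Q'. graded_ideal Q' \<Longrightarrow> Q < Q' \<Longrightarrow> \<not> P Q'"
proof (rule ccontr)
  assume "\<not> thesis"
  then have "\<forall>Q. graded_ideal Q \<and> P Q \<and> Q0 \<le> Q \<longrightarrow> (\<exists>Q'. graded_ideal Q' \<and> Q < Q' \<and> P Q')"
    using that by blast
  then obtain F where F: "\<And>Q. graded_ideal Q \<Longrightarrow> P Q \<Longrightarrow> Q0 \<le> Q \<Longrightarrow> graded_ideal (F Q) \<and> Q < F Q \<and> P (F Q)"
    by metis
  define s where "s = rec_nat Q0 (\<lambda>_. F)"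
  have s: "s 0 = Q0" "s (Suc i) = F (s i)" for i by (simp_all add: s_def)
  have inv: "graded_ideal (s i) \<and> P (s i) \<and> Q0 \<le> s i" for i
  proof (induction i)
    case (Suc i)
    then show ?case using F[of "s i"] s(2)[of i] by (metis order_less_imp_le order_trans)
  qed (simp add: s assms)
  then have "s i < s (Suc i)" for i using F[of "s i"] s(2)[of i] by simp
  then show False using acc_graded_ideals[of s] inv by blast
qed

end

text \<open>For \<open>e > 0\<close> this is \<open>h n = O(n\<^bsup>e - 1\<^esup>)\<close>, and for \<open>e = 0\<close> it forces \<open>h\<close> to vanish eventually.\<close>

definition growth_le :: "nat \<Rightarrow> (nat \<Rightarrow> nat) \<Rightarrow> bool" where
  "growth_le e h \<longleftrightarrow> (\<exists>C. \<forall>n. h n * Suc n \<le> C * Suc n ^ e)"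

section \<open>Closure properties of the growth bound\<close>

lemma growth_le_mono: "growth_le e g \<Longrightarrow> (\<And>n. h n \<le> g n) \<Longrightarrow> growth_le e h"
  unfolding growth_le_def by (meson mult_le_mono1 order_trans)

lemma growth_le_add:
  assumes "growth_le e g" "growth_le e h"
  shows "growth_le e (\<lambda>n. g n + h n)"
proof -
  obtain C D where "\<And>n. g n * Suc n \<le> C * Suc n ^ e" "\<And>n. h n * Suc n \<le> D * Suc n ^ e"
    using assms unfolding growth_le_def by blast
  then have "(g n + h n) * Suc n \<le> (C + D) * Suc n ^ e" for n
    unfolding add_mult_distrib by (rule add_mono)
  then show ?thesis unfolding growth_le_def by blast
qed

text \<open>The factor \<open>Suc s\<close> in the new constant comes from k + s + 1 \<le> (s + 1)(k
  + 1). The shift is the degree of the form by which a colon ideal is taken.\<close>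

lemma growth_le_shift:
  assumes "growth_le e h"
  shows "growth_le e (\<lambda>n. if s \<le> n then h (n - s) else 0)"
proof -
  obtain C where C: "\<And>n. h n * Suc n \<le> C * Suc n ^ e" using assms unfolding growth_le_def by blast
  have "h k * Suc (k + s) \<le> Suc s * C * Suc (k + s) ^ e" for k
  proof -
    have "h k * Suc (k + s) \<le> Suc s * (h k * Suc k)" by (simp add: algebra_simps)
    also have "\<dots> \<le> Suc s * (C * Suc k ^ e)" by (rule mult_le_mono2[OF C])
    also have "\<dots> \<le> Suc s * (C * Suc (k + s) ^ e)" by (intro mult_le_mono2 power_mono) auto
    finally show ?thesis by (simp only: mult.assoc)
  qed
  then have "(if s \<le> n then h (n - s) else 0) * Suc n \<le> Suc s * C * Suc n ^ e" for n
    by (cases "s \<le> n") (metis le_add_diff_inverse2, simp)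
  then show ?thesis unfolding growth_le_def by blast
qed

text \<open>Summation costs one power of n. For e = 0 the reason is different: a nonzero
  \<open>g i\<close> would give i + 1 \<le> C, so \<open>g\<close> vanishes from index C on and its
  sums are bounded.\<close>

lemma growth_le_sum:
  assumes "growth_le e g" and step: "\<And>n. h (Suc n) \<le> g (Suc n) + h n"
  shows "growth_le (Suc e) h"
proof -
  obtain C where C: "\<And>n. g n * Suc n \<le> C * Suc n ^ e" using assms unfolding growth_le_def by blast
  have h: "h n \<le> h 0 + (\<Sum>i\<le>n. g i)" for n
  proof (induction n)
    case (Suc n)
    then show ?case using step[of n] by simp
  qed simp
  have "\<exists>D. \<forall>n. (\<Sum>i\<le>n. g i) \<le> D * Suc n ^ e"
  proof (cases e)
    case 0
    have "g i = 0" if "i \<ge> C" for i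
    proof (rule ccontr)
      assume "g i \<noteq> 0"
      then have "1 * Suc i \<le> g i * Suc i" by (intro mult_le_mono1) simp
      with C[of i] that show False by (simp add: 0)
    qed
    then have "(\<Sum>i\<le>n. g i) \<le> (\<Sum>i<C. g i)" for n
    proof -
      assume z: "\<And>i. C \<le> i \<Longrightarrow> g i = 0"
      have "(\<Sum>i\<le>n. g i) = (\<Sum>i\<in>{..n} \<inter> {..<C}. g i)"
        by (rule sum.mono_neutral_right) (auto simp: not_less z)
      also have "\<dots> \<le> (\<Sum>i<C. g i)" by (rule sum_mono2) auto
      finally show ?thesis .
    qed
    then show ?thesis by (auto simp: 0)
  next
    case (Suc k)
    have "g i \<le> C * Suc n ^ k" if "i \<le> n" for i n
    proof -
      have "g i * Suc i \<le> (C * Suc i ^ k) * Suc i" using C[of i] by (simp add: Suc mult_ac)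
      then have "g i \<le> C * Suc i ^ k" by (metis mult_le_cancel2 zero_less_Suc)
      also have "\<dots> \<le> C * Suc n ^ k" using that by (intro mult_le_mono2 power_mono) auto
      finally show ?thesis .
    qed
    then have "(\<Sum>i\<le>n. g i) \<le> of_nat (card {..n}) * (C * Suc n ^ k)" for n
      by (intro sum_bounded_above) auto
    then show ?thesis by (intro exI[of _ C]) (simp add: Suc mult_ac)
  qed
  then obtain D where D: "\<And>n. (\<Sum>i\<le>n. g i) \<le> D * Suc n ^ e" by blast
  have "h n * Suc n \<le> (h 0 + D) * Suc n ^ Suc e" for n
  proof -
    have "1 \<le> Suc n ^ e" by simp
    then have "h n \<le> h 0 * Suc n ^ e + D * Suc n ^ e"
      using h[of n] D[of n] mult_le_mono2[of 1 "Suc n ^ e" "h 0"] by linarith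
    then have "h n \<le> (h 0 + D) * Suc n ^ e" by (simp add: add_mult_distrib)
    from mult_le_mono1[OF this, of "Suc n"] show ?thesis by (simp only: power_Suc mult_ac)
  qed
  then show ?thesis unfolding growth_le_def by blast
qed

section \<open>Graded primes and Krull dimension\<close>

context standard_graded_algebra
begin

text \<open>The homogeneous parts of Q + (a), with a of degree s. Writing n = s + k instead of using
  n - s keeps multiples of a out of the degrees below s.\<close>

definition adjoin :: "(nat \<Rightarrow> 'a set) \<Rightarrow> 'a \<Rightarrow> nat \<Rightarrow> nat \<Rightarrow> 'a set" where
  "adjoin Q a s n = span (Q n \<union> {a * r | r k. n = s + k \<and> r \<in> R k})"

definition colon :: "(nat \<Rightarrow> 'a set) \<Rightarrow> 'a \<Rightarrow> nat \<Rightarrow> nat \<Rightarrow> 'a set" where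
  "colon Q a s n = {r \<in> R n. a * r \<in> Q (s + n)}"

lemma graded_ideal_adjoin:
  assumes Q: "graded_ideal Q" and a: "a \<in> R s"
  shows "graded_ideal (adjoin Q a s)"
  unfolding graded_ideal_def
proof (intro conjI allI impI)
  show "subspace (adjoin Q a s n)" for n by (simp add: adjoin_def)
  show "adjoin Q a s n \<subseteq> R n" for n
    unfolding adjoin_def using graded_idealD(2)[OF Q] mult_closed[OF a]
    by (intro span_minimal subspace_R) auto
  fix m n x y assume x: "x \<in> R m" and y: "y \<in> adjoin Q a s n"
  show "x * y \<in> adjoin Q a s (m + n)"
    unfolding adjoin_def
  proof (rule span_mult[OF span_base[of x "{x}"]])
    show "y \<in> span (Q n \<union> {a * r | r k. n = s + k \<and> r \<in> R k})" using y by (simp add: adjoin_def)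
    fix x' b assume "x' \<in> {x}" "b \<in> Q n \<union> {a * r | r k. n = s + k \<and> r \<in> R k}"
    then consider "x' = x" "b \<in> Q n" | r k where "x' = x" "b = a * r" "n = s + k" "r \<in> R k" by blast
    then show "x' * b \<in> span (Q (m + n) \<union> {a * r | r k. m + n = s + k \<and> r \<in> R k})"
    proof cases
      case 1
      then show ?thesis using graded_idealD(3)[OF Q x] by (auto intro: span_base)
    next
      case 2
      then have "x' * b = a * (x * r)" "m + n = s + (m + k)" "x * r \<in> R (m + k)"
        using mult_closed[OF x] by (simp_all add: mult.left_commute)
      then show ?thesis by (intro span_base) blast
    qed
  qed simp
qed

lemma adjoin_superset: "Q \<le> adjoin Q a s"
  unfolding adjoin_def le_fun_def using span_superset by blast

lemma adjoin_mem: "a \<in> adjoin Q a s s"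
proof -
  have "a = a * 1 \<and> s = s + 0 \<and> 1 \<in> R 0" by (simp add: one_in_R0)
  then show ?thesis unfolding adjoin_def by (intro span_base) blast
qed

lemma graded_ideal_colon:
  assumes Q: "graded_ideal Q" and a: "a \<in> R s"
  shows "graded_ideal (colon Q a s)"
  unfolding graded_ideal_def
proof (intro conjI allI impI)
  show "subspace (colon Q a s n)" for n
  proof (rule subspaceI)
    show "0 \<in> colon Q a s n"
      using subspace_0[OF graded_idealD(1)[OF Q]] by (simp add: colon_def zero_closed)
    show "x + y \<in> colon Q a s n" if "x \<in> colon Q a s n" "y \<in> colon Q a s n" for x y
      using that subspace_add[OF graded_idealD(1)[OF Q]] by (simp add: colon_def add_closed distrib_left)
    show "kscale \<iota> c x \<in> colon Q a s n" if "x \<in> colon Q a s n" for c x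
      using that subspace_scale[OF graded_idealD(1)[OF Q]] subspace_scale[OF subspace_R]
      by (simp add: colon_def scale_mult_right)
  qed
  show "colon Q a s n \<subseteq> R n" for n by (auto simp: colon_def)
  fix m n x y assume "x \<in> R m" "y \<in> colon Q a s n"
  then show "x * y \<in> colon Q a s (m + n)"
    using mult_closed graded_idealD(3)[OF Q, of x m "a * y" "s + n"]
    by (simp add: colon_def mult.left_commute add.left_commute)
qed

lemma colon_superset: "graded_ideal Q \<Longrightarrow> a \<in> R s \<Longrightarrow> Q \<le> colon Q a s"
  unfolding le_fun_def colon_def using graded_idealD(2,3) by blast

text \<open>One inequality from the exact sequence 0 \<rightarrow> (R/(Q:a))(-s) \<rightarrow> R/Q
  \<rightarrow> R/(Q + (a)) \<rightarrow> 0. A basis of (Q:a) in degree k is extended to one of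
  \<open>R k\<close>; multiplication by a sends the old vectors into Q, so only the added ones can
  contribute to Q + (a).\<close>

lemma dim_adjoin_le:
  assumes Q: "graded_ideal Q" and a: "a \<in> R s"
  shows "dim (adjoin Q a s (s + k)) + dim (colon Q a s k) \<le> dim (Q (s + k)) + dim (R k)"
proof -
  obtain Wk where Wk: "finite Wk" "R k \<subseteq> span Wk" using finite_dim_R by blast
  obtain Wn where Wn: "finite Wn" "R (s + k) \<subseteq> span Wn" using finite_dim_R by blast
  have col: "colon Q a s k \<subseteq> R k" by (auto simp: colon_def)
  obtain B0 where B0: "finite B0" "B0 \<subseteq> colon Q a s k" "independent B0" "card B0 = dim (colon Q a s k)"
    by (rule finite_basis[OF Wk(1) order_trans[OF col Wk(2)]])
  obtain B where B: "B0 \<subseteq> B" "B \<subseteq> R k" "independent B" "R k \<subseteq> span B"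
    by (rule maximal_independent_subset_extend[OF order_trans[OF B0(2) col] B0(3)])
  have finB: "finite B" using independent_span_bound[OF Wk(1) B(3)] B(2) Wk(2) by blast
  obtain C where C: "finite C" "C \<subseteq> Q (s + k)" "Q (s + k) \<subseteq> span C" "card C = dim (Q (s + k))"
    by (rule finite_basis[OF Wn(1) order_trans[OF graded_idealD(2)[OF Q] Wn(2)]])
  let ?E = "C \<union> (*) a ` (B - B0)"
  have aB: "a * b \<in> span ?E" if "b \<in> B" for b
  proof (cases "b \<in> B0")
    case True
    then have "a * b \<in> Q (s + k)" using B0(2) by (auto simp: colon_def)
    then show ?thesis using C(3) span_mono[of C ?E] by blast
  next
    case False
    then show ?thesis using that by (intro span_base) blast
  qed
  have aR: "a * r \<in> span ?E" if "r \<in> R k" for r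
    by (rule span_mult[of a "{a}" r B]) (use that B(4) aB in \<open>auto intro: span_base\<close>)
  have QE: "Q (s + k) \<subseteq> span ?E"
    using C(3) span_mono[of C ?E] by blast
  have "Q (s + k) \<union> {a * r | r k'. s + k = s + k' \<and> r \<in> R k'} \<subseteq> span ?E"
    using aR QE by auto
  then have "adjoin Q a s (s + k) \<subseteq> span ?E"
    unfolding adjoin_def by (rule span_minimal) simp
  then have "dim (adjoin Q a s (s + k)) \<le> card ?E"
    using C(1) finB by (intro dim_le_card) auto
  also have "\<dots> \<le> card C + card (B - B0)"
    by (meson card_Un_le card_image_le finB finite_Diff add_left_mono order_trans)
  finally have "dim (adjoin Q a s (s + k)) \<le> dim (Q (s + k)) + (card B - dim (colon Q a s k))"
    using C(4) B0 B(1) by (simp add: card_Diff_subset)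
  moreover have "card B = dim (R k)" using basis_card_eq_dim[OF B(2,4,3)] .
  moreover have "dim (colon Q a s k) \<le> dim (R k)"
    using dim_mono_R[of "colon Q a s k" "R k" k] col span_superset by blast
  ultimately show ?thesis by simp
qed

lemma hilbert_le_adjoin_colon:
  assumes Q: "graded_ideal Q" and a: "a \<in> R s"
  shows "hilbert Q n \<le> hilbert (adjoin Q a s) n + (if s \<le> n then hilbert (colon Q a s) (n - s) else 0)"
proof (cases "s \<le> n")
  case True
  then obtain k where "n = s + k" using le_Suc_ex by blast
  then show ?thesis using dim_adjoin_le[OF assms, of k] by (simp add: hilbert_def)
next
  case False
  then have "{a * r | r k. n = s + k \<and> r \<in> R k} = {}" by auto
  then have "adjoin Q a s n = Q n"
    using graded_idealD(1)[OF Q, of n] by (simp only: adjoin_def Un_empty_right span_eq_iff)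
  then show ?thesis by (simp add: hilbert_def)
qed

section \<open>Graded primes and ideals maximal among those of fast growth\<close>

definition graded_prime :: "(nat \<Rightarrow> 'a set) \<Rightarrow> bool" where
  "graded_prime Q \<longleftrightarrow> graded_ideal Q \<and> 1 \<notin> Q 0 \<and>
     (\<forall>a b m n. a \<in> R m \<longrightarrow> b \<in> R n \<longrightarrow> a * b \<in> Q (m + n) \<longrightarrow> a \<in> Q m \<or> b \<in> Q n)"

lemma growth_le_zero: "growth_le e (\<lambda>n. 0)"
  by (simp add: growth_le_def)

text \<open>If ab lies in Q while a and b do not, then Q + (a) contains a and Q : a contains b, so
  both are strictly larger than Q and have slow growth. By \<open>hilbert_le_adjoin_colon\<close>
  their Hilbert functions together bound that of Q.\<close>

lemma maximal_imp_graded_prime: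
  assumes Q: "graded_ideal Q" and big: "\<not> growth_le e (hilbert Q)"
    and max: "\<And>Q'. graded_ideal Q' \<Longrightarrow> Q < Q' \<Longrightarrow> growth_le e (hilbert Q')"
  shows "graded_prime Q"
  unfolding graded_prime_def
proof (intro conjI allI impI)
  show "1 \<notin> Q 0"
  proof
    assume "1 \<in> Q 0"
    then have "x \<in> Q n" if "x \<in> R n" for x n
      using graded_idealD(3)[OF Q that, of 1 0] by simp
    then have "Q n = R n" for n using graded_idealD(2)[OF Q] by blast
    then have "hilbert Q = (\<lambda>n. 0)" by (simp add: hilbert_def fun_eq_iff)
    then show False using big growth_le_zero by metis
  qed
  fix a b m n assume ab: "a \<in> R m" "b \<in> R n" "a * b \<in> Q (m + n)"
  show "a \<in> Q m \<or> b \<in> Q n"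
  proof (rule ccontr)
    assume n: "\<not> (a \<in> Q m \<or> b \<in> Q n)"
    have "b \<in> colon Q a m n" using ab by (simp add: colon_def)
    then have "Q \<noteq> colon Q a m" using n by metis
    then have 1: "growth_le e (hilbert (colon Q a m))"
      using max graded_ideal_colon[OF Q ab(1)] colon_superset[OF Q ab(1)] by (simp add: less_le)
    have "Q \<noteq> adjoin Q a m" using n adjoin_mem by metis
    then have 2: "growth_le e (hilbert (adjoin Q a m))"
      using max graded_ideal_adjoin[OF Q ab(1)] adjoin_superset by (simp add: less_le)
    have "growth_le e (hilbert Q)"
      by (rule growth_le_mono[OF growth_le_add[OF 2 growth_le_shift[OF 1, of m]]])
         (rule hilbert_le_adjoin_colon[OF Q ab(1)])
    with big show False ..
  qed
qed (rule Q)

definition homogeneous_sum :: "(nat \<Rightarrow> 'a set) \<Rightarrow> 'a set" where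
  "homogeneous_sum Q = {x. \<forall>n. comp x n \<in> Q n}"

text \<open>Take the lowest components of a and b outside Q, in degrees i and j. In degree i + j
  every other summand of ab has a factor in Q, so the product of these two components lies in Q,
  against graded primality.\<close>

lemma prime_homogeneous_sum:
  assumes "graded_prime Q"
  shows "prime_ideal (homogeneous_sum Q)"
proof -
  have Q: "graded_ideal Q" and one: "1 \<notin> Q 0"
    and prime: "\<And>a b m n. a \<in> R m \<Longrightarrow> b \<in> R n \<Longrightarrow> a * b \<in> Q (m + n) \<Longrightarrow> a \<in> Q m \<or> b \<in> Q n"
    using assms unfolding graded_prime_def by blast+
  note sub = graded_idealD(1)[OF Q]
  have mult: "comp x i * comp y j \<in> Q (i + j)" if "comp x i \<in> Q i \<or> comp y j \<in> Q j" for x y i j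
    using that graded_idealD(3)[OF Q comp(1)[of x i], of "comp y j" j]
      graded_idealD(3)[OF Q comp(1)[of y j], of "comp x i" i] by (auto simp: mult.commute add.commute)
  show ?thesis
    unfolding prime_ideal_def
  proof (intro conjI allI impI)
    show "is_ideal (homogeneous_sum Q)"
    proof (rule module.subspaceI[OF module_times])
      show "0 \<in> homogeneous_sum Q" by (simp add: homogeneous_sum_def subspace_0[OF sub])
      show "x + y \<in> homogeneous_sum Q" if "x \<in> homogeneous_sum Q" "y \<in> homogeneous_sum Q" for x y
        using that by (simp add: homogeneous_sum_def comp_add subspace_add[OF sub])
      show "c * x \<in> homogeneous_sum Q" if "x \<in> homogeneous_sum Q" for c x
      proof -
        have "comp c i * comp x (n - i) \<in> Q n" if "i \<le> n" for i n
          using mult[of c i x "n - i"] \<open>x \<in> _\<close> that by (simp add: homogeneous_sum_def)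
        then show ?thesis
          by (auto simp: homogeneous_sum_def comp_mult intro!: subspace_sum[OF sub])
      qed
    qed
    have "comp 1 0 \<notin> Q 0" using one comp_homogeneous[OF one_in_R0] by simp
    then show "homogeneous_sum Q \<noteq> UNIV" unfolding homogeneous_sum_def by blast
    fix a b assume ab: "a * b \<in> homogeneous_sum Q"
    show "a \<in> homogeneous_sum Q \<or> b \<in> homogeneous_sum Q"
    proof (rule ccontr)
      assume "\<not> (a \<in> homogeneous_sum Q \<or> b \<in> homogeneous_sum Q)"
      then have ex: "\<exists>i. comp a i \<notin> Q i" "\<exists>j. comp b j \<notin> Q j" by (auto simp: homogeneous_sum_def)
      define i where "i = (LEAST i. comp a i \<notin> Q i)"
      define j where "j = (LEAST j. comp b j \<notin> Q j)"
      have i: "comp a i \<notin> Q i" "\<And>k. k < i \<Longrightarrow> comp a k \<in> Q k"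
        using LeastI_ex[OF ex(1)] not_less_Least by (auto simp: i_def)
      have j: "comp b j \<notin> Q j" "\<And>k. k < j \<Longrightarrow> comp b k \<in> Q k"
        using LeastI_ex[OF ex(2)] not_less_Least by (auto simp: j_def)
      have "comp a k * comp b (i + j - k) \<in> Q (i + j)" if "k \<in> {..i + j} - {i}" for k
      proof -
        have "k < i \<or> i + j - k < j" using that by auto
        then show ?thesis using mult[of a k b "i + j - k"] i(2) j(2) that by auto
      qed
      then have rest: "(\<Sum>k\<in>{..i + j} - {i}. comp a k * comp b (i + j - k)) \<in> Q (i + j)"
        by (rule subspace_sum[OF sub])
      have "comp (a * b) (i + j) =
          comp a i * comp b j + (\<Sum>k\<in>{..i + j} - {i}. comp a k * comp b (i + j - k))"
        unfolding comp_mult by (subst sum.remove[of _ i]) auto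
      moreover have "comp (a * b) (i + j) \<in> Q (i + j)" using ab by (simp add: homogeneous_sum_def)
      ultimately have "comp a i * comp b j \<in> Q (i + j)"
        using subspace_diff[OF sub _ rest] by (metis add_diff_cancel_right')
      then show False using prime[OF comp(1) comp(1)] i(1) j(1) by blast
    qed
  qed
qed

lemma homogeneous_sum_strict_mono:
  assumes "graded_ideal P" "graded_ideal Q" "P < Q"
  shows "homogeneous_sum P \<subset> homogeneous_sum Q"
proof -
  have le: "P n \<subseteq> Q n" for n using assms(3) by (simp add: less_le le_fun_def)
  obtain n where "P n \<noteq> Q n" using assms(3) by (metis ext less_irrefl)
  then obtain x where x: "x \<in> Q n" "x \<notin> P n" using le by blast
  then have c: "comp x k = (if k = n then x else 0)" for k
    using graded_idealD(2)[OF assms(2)] comp_homogeneous by blast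
  have "x \<in> homogeneous_sum Q"
    using x(1) subspace_0[OF graded_idealD(1)[OF assms(2)]] by (simp add: homogeneous_sum_def c)
  moreover have "x \<notin> homogeneous_sum P"
    using x(2) c[of n] by (auto simp: homogeneous_sum_def intro!: exI[of _ n])
  moreover have "homogeneous_sum P \<subseteq> homogeneous_sum Q" using le by (auto simp: homogeneous_sum_def)
  ultimately show ?thesis by blast
qed

lemma R1_subset_imp:
  assumes Q: "graded_ideal Q" and "R 1 \<subseteq> Q 1"
  shows "Q (Suc n) = R (Suc n)"
proof
  show "Q (Suc n) \<subseteq> R (Suc n)" by (rule graded_idealD(2)[OF Q])
  obtain f m where f: "\<forall>i<m. f i \<in> R 1" "R 1 \<subseteq> span (f ` {..<m::nat})" using generators_R1 by blast
  have "monomial f M \<in> Q (Suc n)" if M: "set_mset M \<subseteq> {..<m}" "size M = Suc n" for M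
  proof -
    obtain i M' where M': "M = add_mset i M'" using M(2) size_eq_Suc_imp_eq_union by blast
    have "monomial f M' \<in> R n"
      using monomial_in_R[of M' f "\<lambda>_. 1"] f(1) M by (simp add: M' subset_iff)
    moreover have "f i \<in> Q 1" using f(1) assms(2) M(1) by (auto simp: M')
    ultimately show ?thesis using graded_idealD(3)[OF Q, of "monomial f M'" n "f i" 1] by (simp add: M' mult.commute)
  qed
  then have "span (monomial f ` {M. set_mset M \<subseteq> {..<m} \<and> size M = Suc n}) \<subseteq> Q (Suc n)"
    by (intro span_minimal graded_idealD(1)[OF Q]) auto
  then show "R (Suc n) \<subseteq> Q (Suc n)" using R_eq_span_monomials[of m f "Suc n"] f by simp
qed

text \<open>Used in the contrapositive: an ideal of fast growth leaves out some linear form, and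
  this is the form adjoined in building the chain.\<close>

lemma growth_le_R1_subset:
  assumes Q: "graded_ideal Q" and "R 1 \<subseteq> Q 1"
  shows "growth_le e (hilbert Q)"
proof -
  have "hilbert Q n * Suc n \<le> hilbert Q 0 * Suc n ^ e" for n
    by (cases n) (simp_all add: hilbert_def R1_subset_imp[OF assms])
  then show ?thesis unfolding growth_le_def by blast
qed

lemma graded_prime_irrelevant: "graded_prime (\<lambda>n. if n = 0 then {0} else R n)"
proof -
  have nz: "\<iota> c \<noteq> 0" if "c \<noteq> 0" for c
    using hom_mult[of c "inverse c"] hom_one that by auto
  show ?thesis
    unfolding graded_prime_def graded_ideal_def
  proof (intro conjI allI impI)
    show "subspace (if n = 0 then {0} else R n)" for n by (simp add: subspace_R)
    show "(if n = 0 then {0} else R n) \<subseteq> R n" for n by (simp add: zero_closed)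
    show "x * y \<in> (if m + n = 0 then {0} else R (m + n))"
      if "x \<in> R m" "y \<in> (if n = 0 then {0} else R n)" for m n x y
      using that mult_closed[of x m y n] zero_closed by (auto split: if_splits)
    fix a b m n assume "a \<in> R m" "b \<in> R n" "a * b \<in> (if m + n = 0 then {0} else R (m + n))"
    then show "a \<in> (if m = 0 then {0} else R m) \<or> b \<in> (if n = 0 then {0} else R n)"
      using nz by (auto simp: degree_zero simp flip: hom_mult split: if_splits) (metis mult_eq_0_iff)
  qed auto
qed

text \<open>A linear form x outside the prime P satisfies P : x = P, so by
  \<open>growth_le_sum\<close> a slow growth for P + (x) would give P growth with exponent one
  higher. Hence P + (x) still grows too fast for e, and so does a maximal such ideal above it, which
  is prime. At e = 0 the irrelevant ideal ends the chain.\<close>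

lemma graded_prime_chain:
  assumes "graded_prime P" "\<not> growth_le e (hilbert P)"
  shows "\<exists>p. p 0 = P \<and> (\<forall>i\<le>Suc e. graded_prime (p i)) \<and> (\<forall>i<Suc e. p i < p (Suc i))"
  using assms
proof (induction e arbitrary: P)
  case 0
  let ?m = "\<lambda>n. if n = 0 then {0} else R n"
  have P: "graded_ideal P" "1 \<notin> P 0" using 0(1) by (simp_all add: graded_prime_def)
  \<comment> \<open>\<open>R 0\<close> is a copy of the field, so a nonzero element of
    \<open>P 0\<close> would be a unit and put 1 into P.\<close>
  have "x \<in> {0}" if "x \<in> P 0" for x
  proof (rule ccontr)
    assume "x \<notin> {0}"
    obtain c where c: "x = \<iota> c" using \<open>x \<in> P 0\<close> graded_idealD(2)[OF P(1), of 0] by (auto simp: degree_zero)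
    then have "c \<noteq> 0" using \<open>x \<notin> {0}\<close> hom_zero by auto
    then have "\<iota> (inverse c) * x = 1" using hom_mult[of "inverse c" c] hom_one by (simp add: c)
    then show False
      using graded_idealD(3)[OF P(1), of "\<iota> (inverse c)" 0 x 0] \<open>x \<in> P 0\<close> P(2) by (simp add: degree_zero)
  qed
  then have "P \<le> ?m" using graded_idealD(2)[OF P(1)] by (auto simp: le_fun_def)
  moreover have "P \<noteq> ?m" using growth_le_R1_subset[OF P(1)] 0(2) by auto
  ultimately have "P < ?m" by (simp add: less_le)
  then show ?case
    using 0(1) graded_prime_irrelevant
    by (intro exI[of _ "\<lambda>i. if i = 0 then P else ?m"]) auto
next
  case (Suc e)
  have P: "graded_ideal P"
    and prime: "\<And>a b m n. a \<in> R m \<Longrightarrow> b \<in> R n \<Longrightarrow> a * b \<in> P (m + n) \<Longrightarrow> a \<in> P m \<or> b \<in> P n"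
    using Suc.prems(1) unfolding graded_prime_def by blast+
  obtain x where x: "x \<in> R 1" "x \<notin> P 1"
    using growth_le_R1_subset[OF P] Suc.prems(2) by blast
  have "colon P x 1 = P"
    using colon_superset[OF P x(1)] prime[OF x(1)] x(2) by (intro antisym) (auto simp: le_fun_def colon_def)
  have ad: "graded_ideal (adjoin P x 1)" by (rule graded_ideal_adjoin[OF P x(1)])
  have "\<not> growth_le e (hilbert (adjoin P x 1))"
  proof
    assume "growth_le e (hilbert (adjoin P x 1))"
    moreover have "hilbert P (Suc n) \<le> hilbert (adjoin P x 1) (Suc n) + hilbert P n" for n
      using hilbert_le_adjoin_colon[OF P x(1), of "Suc n"] \<open>colon P x 1 = P\<close> by simp
    ultimately have "growth_le (Suc e) (hilbert P)" by (rule growth_le_sum)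
    with Suc.prems(2) show False ..
  qed
  then obtain Q where Q: "graded_ideal Q" "\<not> growth_le e (hilbert Q)" "adjoin P x 1 \<le> Q"
    "\<And>Q'. graded_ideal Q' \<Longrightarrow> Q < Q' \<Longrightarrow> \<not> \<not> growth_le e (hilbert Q')"
    using maximal_graded_ideal[OF ad, of "\<lambda>Q. \<not> growth_le e (hilbert Q)"] by metis
  have "graded_prime Q" using maximal_imp_graded_prime[OF Q(1,2)] Q(4) by blast
  then obtain p where p: "p 0 = Q" "\<And>i. i \<le> Suc e \<Longrightarrow> graded_prime (p i)" "\<And>i. i < Suc e \<Longrightarrow> p i < p (Suc i)"
    using Suc.IH[OF _ Q(2)] by blast
  have "P \<le> Q" using adjoin_superset Q(3) by (rule order_trans)
  moreover have "x \<in> Q 1" using adjoin_mem[of x P 1] le_funD[OF Q(3), of 1] by blast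
  ultimately have "P < Q" using x(2) by (auto simp: less_le)
  show ?case
  proof (intro exI[of _ "case_nat P p"] conjI allI impI)
    show "graded_prime (case_nat P p i)" if "i \<le> Suc (Suc e)" for i
      using that Suc.prems(1) p(2) by (cases i) auto
    show "case_nat P p i < case_nat P p (Suc i)" if "i < Suc (Suc e)" for i
      using that \<open>P < Q\<close> p(1,3) by (cases i) auto
  qed simp
qed

theorem growth_le_krull_dim:
  assumes "krull_dim TYPE('a) = enat d" and dom: "\<And>a b :: 'a. a * b = 0 \<Longrightarrow> a = 0 \<or> b = 0"
  shows "growth_le d (\<lambda>n. dim (R n))"
proof (rule ccontr)
  assume big: "\<not> growth_le d (\<lambda>n. dim (R n))"
  \<comment> \<open>The zero ideal starts the chain; the ring being a domain makes it prime, and its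
    Hilbert function is the one to be bounded.\<close>
  have "graded_prime (\<lambda>n. {0})"
    using dom by (auto simp: graded_prime_def graded_ideal_def zero_closed)
  moreover have "dim {0} = 0" using dim_span[of "{}"] dim_eq_card_independent[OF independent_empty] by simp
  then have "hilbert (\<lambda>n. {0}) = (\<lambda>n. dim (R n))" by (simp add: hilbert_def fun_eq_iff)
  ultimately obtain p where p: "\<And>i. i \<le> Suc d \<Longrightarrow> graded_prime (p i)" "\<And>i. i < Suc d \<Longrightarrow> p i < p (Suc i)"
    using graded_prime_chain[of "\<lambda>n. {0}" d] big by metis
  define P where "P i = homogeneous_sum (p i)" for i
  have "\<forall>i\<le>Suc d. prime_ideal (P i)" using p(1) prime_homogeneous_sum by (simp add: P_def)
  moreover have "\<forall>i<Suc d. P i \<subset> P (Suc i)"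
    using p homogeneous_sum_strict_mono unfolding P_def by (simp add: graded_prime_def)
  ultimately have "enat (Suc d) \<le> krull_dim TYPE('a)"
    unfolding krull_dim_def by (intro Sup_upper) blast
  then show False using assms(1) by simp
qed

end

section \<open>Bigraded Hilbert functions\<close>

lemmas ideal_subspace_span = module.subspace_span[OF module_times]
  and ideal_span_base = module.span_base[OF module_times]
  and ideal_span_minimal = module.span_minimal[OF module_times]
  and ideal_span_mono = module.span_mono[OF module_times]
  and ideal_span_superset = module.span_superset[OF module_times]
  and ideal_span_zero = module.span_zero[OF module_times]
  and ideal_span_add = module.span_add[OF module_times]
  and ideal_span_scale = module.span_scale[OF module_times]
  and ideal_span_induct = module.span_induct_alt[OF module_times, consumes 1, case_names base step]

lemma ideal_span_mult:
  fixes x y :: "'a::comm_ring_1"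
  assumes "x \<in> ideal_span A" "y \<in> ideal_span B" "\<And>a b. a \<in> A \<Longrightarrow> b \<in> B \<Longrightarrow> a * b \<in> ideal_span C"
  shows "x * y \<in> ideal_span C"
proof -
  have "a * y \<in> ideal_span C" if "a \<in> A" for a
    using assms(2)
  proof (induction rule: ideal_span_induct)
    case (step c z w)
    have "c * (a * z) + a * w \<in> ideal_span C"
      by (intro ideal_span_add ideal_span_scale assms(3) that step)
    then show ?case by (simp add: algebra_simps)
  qed (simp add: ideal_span_zero)
  with assms(1) show ?thesis
  proof (induction rule: ideal_span_induct)
    case (step c z w)
    have "c * (z * y) + w * y \<in> ideal_span C"
      by (intro ideal_span_add ideal_span_scale step)
    then show ?case by (simp add: algebra_simps)
  qed (simp add: ideal_span_zero)
qed

lemma ideal_prod_span: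
  "ideal_prod (ideal_span A) (ideal_span B) = ideal_span {a * b | a b. a \<in> A \<and> b \<in> (B :: 'a::comm_ring_1 set)}"
proof
  have "x * y \<in> ideal_span {a * b | a b. a \<in> A \<and> b \<in> B}" if "x \<in> ideal_span A" "y \<in> ideal_span B" for x y
    by (rule ideal_span_mult[OF that]) (auto intro: ideal_span_base)
  then show "ideal_prod (ideal_span A) (ideal_span B) \<subseteq> ideal_span {a * b | a b. a \<in> A \<and> b \<in> B}"
    unfolding ideal_prod_def by (intro ideal_span_minimal ideal_subspace_span) auto
  show "ideal_span {a * b | a b. a \<in> A \<and> b \<in> B} \<subseteq> ideal_prod (ideal_span A) (ideal_span B)"
    unfolding ideal_prod_def by (intro ideal_span_mono) (auto intro: ideal_span_base)
qed

lemma ideal_span_one: "ideal_span {1 :: 'a::comm_ring_1} = UNIV"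
proof -
  have "x \<in> ideal_span {1}" for x :: 'a
    using ideal_span_scale[OF ideal_span_base[of 1 "{1}"], of x] by simp
  then show ?thesis by blast
qed

context standard_graded_algebra
begin

lemma ideal_pow_span:
  "ideal_pow (ideal_span (f ` Y)) u = ideal_span (monomial f ` {M. set_mset M \<subseteq> Y \<and> size M = u})"
proof (induction u)
  case 0
  have "monomial f ` {M. set_mset M \<subseteq> Y \<and> size M = 0} = {1}" by auto
  then show ?case by (simp only: ideal_pow.simps ideal_span_one)
next
  case (Suc u)
  have "{a * b | a b. a \<in> f ` Y \<and> b \<in> monomial f ` {M. set_mset M \<subseteq> Y \<and> size M = u}} =
      monomial f ` {M. set_mset M \<subseteq> Y \<and> size M = Suc u}" (is "?A = ?B")
  proof
    show "?A \<subseteq> ?B"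
    proof
      fix x assume "x \<in> ?A"
      then obtain i M where "x = f i * monomial f M" "i \<in> Y" "set_mset M \<subseteq> Y" "size M = u" by blast
      then show "x \<in> ?B" by (intro image_eqI[of _ _ "add_mset i M"]) auto
    qed
    show "?B \<subseteq> ?A"
    proof
      fix x assume "x \<in> ?B"
      then obtain M where M: "x = monomial f M" "set_mset M \<subseteq> Y" "size M = Suc u" by blast
      then obtain i M' where "M = add_mset i M'" using size_eq_Suc_imp_eq_union by blast
      then have "x = f i * monomial f M' \<and> f i \<in> f ` Y \<and> monomial f M' \<in> monomial f ` {M. set_mset M \<subseteq> Y \<and> size M = u}"
        using M by auto
      then show "x \<in> ?A" by blast
    qed
  qed
  then show ?case by (simp add: Suc ideal_prod_span)
qed

lemma ideal_prod_pow_span: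
  "ideal_prod (ideal_pow (ideal_span (f ` {i\<in>X. p i})) u) (ideal_pow (ideal_span (f ` {i\<in>X. \<not> p i})) v) =
     ideal_span (monomial f ` bimonomials X p u v)"
proof -
  let ?A = "{M. set_mset M \<subseteq> {i\<in>X. p i} \<and> size M = u}" and ?B = "{M. set_mset M \<subseteq> {i\<in>X. \<not> p i} \<and> size M = v}"
  have "{a * b | a b. a \<in> monomial f ` ?A \<and> b \<in> monomial f ` ?B} = monomial f ` (\<lambda>(A, B). A + B) ` (?A \<times> ?B)"
    (is "?L = ?R")
  proof (intro set_eqI iffI)
    fix x assume "x \<in> ?L"
    then obtain A B where "x = monomial f A * monomial f B" "A \<in> ?A" "B \<in> ?B" by blast
    then show "x \<in> ?R"
      by (intro image_eqI[of _ _ "A + B"] image_eqI[of _ _ "(A, B)"]) (simp_all add: monomial_union)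
  next
    fix x assume "x \<in> ?R"
    then obtain z where z: "z \<in> ?A \<times> ?B" "x = monomial f ((\<lambda>(A, B). A + B) z)" by blast
    obtain A B where "z = (A, B)" by (cases z)
    with z have "A \<in> ?A" "B \<in> ?B" "x = monomial f A * monomial f B"
      by (simp_all add: monomial_union)
    then show "x \<in> ?L" by blast
  qed
  also have "\<dots> = monomial f ` bimonomials X p u v"
    using bij_betw_bimonomials[of X p u v] by (simp only: bij_betw_def)
  finally show ?thesis by (simp only: ideal_pow_span ideal_prod_span)
qed

lemma hilbert_eventually_poly2:
  fixes f :: "nat \<Rightarrow> 'a"
  assumes "finite X"
  shows "eventually_poly2 (\<lambda>u v. of_nat (dim (span (monomial f ` bimonomials X p u v))))"
proof -
  define deg :: "nat multiset \<Rightarrow> nat \<times> nat" where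
    "deg M = (size (filter_mset p M), size (filter_mset (\<lambda>x. \<not> p x) M))" for M
  define N where "N = nonstandard f X deg (\<lambda>_. {})"
  have bim: "{M. set_mset M \<subseteq> X \<and> deg M = (u, v)} = bimonomials X p u v" for u v
    by (simp add: bimonomials_def deg_def)
  have deg: "deg (add_mset i K) = deg (add_mset i L)" if "deg K = deg L" for i K L
    using that by (simp add: deg_def)
  \<comment> \<open>With \<open>V\<close> empty the standard monomials of a bidegree give a basis of
    the span itself.\<close>
  have "card (bimonomials X p u v - N) + dim {} = dim ({} \<union> monomial f ` bimonomials X p u v)" for u v
    using card_standard[of X deg "(u, v)" "{}" "\<lambda>_. {}" f] finite_bimonomials[OF assms, of p u v]
    by (simp add: bim N_def)
  moreover have "dim {} = 0" using dim_eq_card_independent[OF independent_empty] by simp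
  ultimately have card: "dim (span (monomial f ` bimonomials X p u v)) = card (bimonomials X p u v - N)" for u v
    by simp
  obtain G where G: "finite G" "G \<subseteq> N" "\<forall>M\<in>N. \<exists>L\<in>G. L \<subseteq># M"
    using dickson_finite_basis[OF assms, of N] by (auto simp: N_def nonstandard_def)
  obtain Ls where Ls: "set Ls = G" using finite_list[OF G(1)] by blast
  have up: "M \<in> N" if "L \<in> G" "L \<subseteq># M" "M \<in> bimonomials X p u v" for L M u v
    unfolding N_def
  proof (rule nonstandard_mono)
    show "L \<in> nonstandard f X deg (\<lambda>_. {})" using that(1) G(2) by (auto simp: N_def)
    show "set_mset M \<subseteq> X" using that(3) by (simp add: bimonomials_def)
    show "deg (add_mset i K) = deg (add_mset i L)" if "deg K = deg L" for i K L using that by (rule deg)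
  qed (use that(2) in simp_all)
  have N: "bimonomials X p u v \<inter> N = {M\<in>bimonomials X p u v. \<exists>L\<in>set Ls. L \<subseteq># M}" for u v
  proof (intro set_eqI iffI)
    fix M assume "M \<in> {M\<in>bimonomials X p u v. \<exists>L\<in>set Ls. L \<subseteq># M}"
    then obtain L where L: "L \<in> G" "L \<subseteq># M" "M \<in> bimonomials X p u v" by (auto simp: Ls)
    with up[OF L] show "M \<in> bimonomials X p u v \<inter> N" by simp
  next
    fix M assume M: "M \<in> bimonomials X p u v \<inter> N"
    then obtain L where "L \<in> G" "L \<subseteq># M" using G(3) by (metis IntD2)
    with M show "M \<in> {M\<in>bimonomials X p u v. \<exists>L\<in>set Ls. L \<subseteq># M}" by (auto simp: Ls)
  qed
  have "rat_of_nat (dim (span (monomial f ` bimonomials X p u v))) =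
     of_nat (card (bimonomials X p u v)) - of_nat (card {M\<in>bimonomials X p u v. \<exists>L\<in>set Ls. L \<subseteq># M})" for u v
  proof -
    have "card (bimonomials X p u v) = card (bimonomials X p u v \<inter> N) + card (bimonomials X p u v - N)"
      by (rule card_Int_Diff[OF finite_bimonomials[OF assms]])
    then show ?thesis by (simp add: card N del: dim_span)
  qed
  moreover have "eventually_poly2 (\<lambda>u v. of_nat (card (bimonomials X p u v)))"
  proof -
    obtain F where "polyfun2 F" "\<forall>u\<ge>1. \<forall>v\<ge>1. of_nat (card (bimonomials X p u v)) = F (of_nat u) (of_nat v)"
      using card_bimonomials_polyfun2[OF assms, of p] by blast
    then show ?thesis by (intro eventually_poly2I[of F 1 1]) auto
  qed
  ultimately show ?thesis
    by (simp only: eventually_poly2_diff[OF _ card_bimonomials_in_ideal[OF assms]])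
qed

text \<open>The linear map \<pi> carries A onto T, and the elements of A that it kills lie in B, so
  A/B is identified with T and representatives of a basis go to a basis of T. The claim concerns an
  arbitrary \<open>X\<close> because \<open>quot_dim\<close> measures one picked by
  \<open>SOME\<close>.\<close>

lemma basis_mod_card:
  assumes lin: "\<And>x y. \<pi> (x + y) = \<pi> x + \<pi> y" "\<And>c x. \<pi> (kscale \<iota> c x) = kscale \<iota> c (\<pi> x)"
    and T: "subspace T" "T \<subseteq> A" and A: "subspace A" and B: "subspace B"
    and decomp: "\<And>x. x \<in> A \<Longrightarrow> \<exists>t\<in>T. \<exists>b\<in>B. x = t + b"
    and id: "\<And>t. t \<in> T \<Longrightarrow> \<pi> t = t" and zero: "\<And>b. b \<in> B \<Longrightarrow> \<pi> b = 0"
    and X: "basis_mod \<iota> A B X"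
  shows "card X = dim T"
proof -
  have XA: "X \<subseteq> A" "A \<subseteq> span (X \<union> B)"
    and ind: "\<And>F c. finite F \<Longrightarrow> F \<subseteq> X \<Longrightarrow> (\<Sum>x\<in>F. kscale \<iota> (c x) x) \<in> B \<Longrightarrow> \<forall>x\<in>F. c x = 0"
    using X by (auto simp: basis_mod_def)
  have \<pi>0: "\<pi> 0 = 0" using zero[OF subspace_0[OF B]] .
  have \<pi>sum: "\<pi> (\<Sum>x\<in>F. kscale \<iota> (c x) x) = (\<Sum>x\<in>F. kscale \<iota> (c x) (\<pi> x))" for F c
    by (induction F rule: infinite_finite_induct) (simp_all add: lin \<pi>0)
  have ker: "x \<in> B" if "x \<in> A" "\<pi> x = 0" for x
  proof -
    obtain t b where tb: "t \<in> T" "b \<in> B" "x = t + b" using decomp[OF \<open>x \<in> A\<close>] by blast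
    then have "t = 0" using that(2) lin(1)[of t b] id[of t] zero[of b] by simp
    with tb show ?thesis by simp
  qed
  have ind\<pi>: "\<forall>x\<in>F. c x = 0" if F: "finite F" "F \<subseteq> X" "(\<Sum>x\<in>F. kscale \<iota> (c x) (\<pi> x)) = 0" for F c
  proof -
    have "(\<Sum>x\<in>F. kscale \<iota> (c x) x) \<in> A"
      using F(2) XA(1) by (intro subspace_sum[OF A] subspace_scale[OF A]) auto
    then have "(\<Sum>x\<in>F. kscale \<iota> (c x) x) \<in> B" using ker \<pi>sum F(3) by simp
    then show ?thesis using ind F(1,2) by blast
  qed
  have inj: "inj_on \<pi> X"
  proof (rule inj_onI, rule ccontr)
    fix x y assume xy: "x \<in> X" "y \<in> X" "\<pi> x = \<pi> y" "x \<noteq> y"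
    then have "(\<Sum>z\<in>{x, y}. kscale \<iota> (if z = x then 1 else - 1) (\<pi> z)) = 0" by simp
    then show False using ind\<pi>[of "{x, y}" "\<lambda>z. if z = x then 1 else - 1"] xy by simp
  qed
  have "independent (\<pi> ` X)"
    unfolding independent_explicit_module
  proof (intro allI impI)
    fix t c v assume t: "finite t" "t \<subseteq> \<pi> ` X" "(\<Sum>v\<in>t. kscale \<iota> (c v) v) = 0" "v \<in> t"
    then obtain F where F: "F \<subseteq> X" "finite F" "t = \<pi> ` F" by (meson finite_subset_image)
    have "(\<Sum>x\<in>F. kscale \<iota> (c (\<pi> x)) (\<pi> x)) = 0"
      using t(3) inj_on_subset[OF inj F(1)] by (simp add: F(3) sum.reindex)
    then show "c v = 0" using ind\<pi>[OF F(2,1), of "\<lambda>x. c (\<pi> x)"] t(4) F(3) by blast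
  qed
  moreover have "span (\<pi> ` X) = span T"
  proof -
    have "\<pi> x \<in> T" if "x \<in> A" for x
    proof -
      obtain t b where "t \<in> T" "b \<in> B" "x = t + b" using decomp[OF \<open>x \<in> A\<close>] by blast
      then show ?thesis by (simp add: lin id zero)
    qed
    then have "\<pi> ` X \<subseteq> T" using XA(1) by blast
    moreover have "\<pi> x \<in> span (\<pi> ` X)" if "x \<in> span (X \<union> B)" for x
      using that
    proof (induction rule: span_induct_alt)
      case base
      show ?case by (simp add: \<pi>0 span_zero)
    next
      case (step c x y)
      have "\<pi> x \<in> span (\<pi> ` X)"
        using step(1) zero by (auto intro: span_base simp: span_zero)
      then show ?case using step by (simp add: lin span_add span_scale)
    qed
    then have "T \<subseteq> span (\<pi> ` X)" using T(2) XA(2) id by (metis subsetD subsetI)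
    ultimately show ?thesis unfolding span_eq using span_superset by blast
  qed
  ultimately show ?thesis using dim_eq_card card_image[OF inj] by metis
qed

lemma quot_dim_eq:
  assumes lin: "\<And>x y. \<pi> (x + y) = \<pi> x + \<pi> y" "\<And>c x. \<pi> (kscale \<iota> c x) = kscale \<iota> c (\<pi> x)"
    and T: "subspace T" "T \<subseteq> A" and A: "subspace A" and B: "subspace B"
    and decomp: "\<And>x. x \<in> A \<Longrightarrow> \<exists>t\<in>T. \<exists>b\<in>B. x = t + b"
    and id: "\<And>t. t \<in> T \<Longrightarrow> \<pi> t = t" and zero: "\<And>b. b \<in> B \<Longrightarrow> \<pi> b = 0"
  shows "quot_dim \<iota> A B = dim T"
proof -
  obtain X where X: "X \<subseteq> T" "independent X" "T \<subseteq> span X" using basis_exists by metis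
  have "basis_mod \<iota> A B X"
    unfolding basis_mod_def
  proof (intro conjI allI impI)
    show "X \<subseteq> A" using X(1) T(2) by blast
    show "A \<subseteq> span (X \<union> B)"
    proof
      fix x assume "x \<in> A"
      then obtain t b where "t \<in> T" "b \<in> B" "x = t + b" using decomp by blast
      moreover have "t \<in> span (X \<union> B)" using X(3) \<open>t \<in> T\<close> span_mono[of X "X \<union> B"] by blast
      ultimately show "x \<in> span (X \<union> B)" by (simp add: span_add span_base)
    qed
    fix F c assume F: "finite F \<and> F \<subseteq> X \<and> (\<Sum>x\<in>F. kscale \<iota> (c x) x) \<in> B"
    then have "(\<Sum>x\<in>F. kscale \<iota> (c x) x) \<in> T"
      using X(1) by (intro subspace_sum[OF T(1)] subspace_scale[OF T(1)]) auto
    then have "(\<Sum>x\<in>F. kscale \<iota> (c x) x) = 0" using id zero F by metis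
    then show "\<forall>x\<in>F. c x = 0" using independentD[OF X(2)] F by blast
  qed
  then have some: "basis_mod \<iota> A B (SOME X. basis_mod \<iota> A B X)" by (rule someI)
  show ?thesis
    unfolding quot_dim_def
    by (rule basis_mod_card[where \<pi> = \<pi> and A = A and B = B]) (fact some | fact assms)+
qed

lemma is_ideal_imp_subspace: "is_ideal I \<Longrightarrow> subspace I"
  by (rule subspaceI)
     (auto simp: kscale_def module.subspace_0[OF module_times] module.subspace_add[OF module_times]
       module.subspace_scale[OF module_times])

lemma monomial_in_R_bimonomials:
  assumes "M \<in> bimonomials X p u v"
    and f: "\<And>i. i \<in> X \<Longrightarrow> p i \<Longrightarrow> f i \<in> R 1" "\<And>i. i \<in> X \<Longrightarrow> \<not> p i \<Longrightarrow> f i \<in> R \<beta>"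
  shows "monomial f M \<in> R (u + \<beta> * v)"
proof -
  have "(\<Sum>i\<in>#M. if p i then 1 else \<beta>) = size (filter_mset p M) + \<beta> * size (filter_mset (\<lambda>x. \<not> p x) M)"
    by (induction M) (auto simp: algebra_simps)
  then have "(\<Sum>i\<in>#M. if p i then 1 else \<beta>) = u + \<beta> * v" using assms(1) by (simp add: bimonomials_def)
  moreover have "monomial f M \<in> R (\<Sum>i\<in>#M. if p i then 1 else \<beta>)"
    using assms by (intro monomial_in_R) (auto simp: bimonomials_def)
  ultimately show ?thesis by simp
qed

text \<open>Modulo an ideal containing \<open>R 1\<close> only scalars survive, as
  \<open>R 1\<close> generates the algebra; for products use xy - ab = y(x - a) + a(y - b).\<close>

lemma scalar_plus_ideal_R1:
  assumes "R 1 \<subseteq> ideal_span Y"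
  shows "\<exists>c. x - \<iota> c \<in> ideal_span Y"
proof -
  have "x \<in> algebra_generated \<iota> (R 1)" using standard by simp
  then show ?thesis
  proof induction
    case (scalar c)
    show ?case by (rule exI[of _ c]) (simp add: ideal_span_zero)
  next
    case (gen x)
    then show ?case using assms by (intro exI[of _ 0]) (auto simp: hom_zero)
  next
    case (add x y)
    then obtain a b where "x - \<iota> a \<in> ideal_span Y" "y - \<iota> b \<in> ideal_span Y" by blast
    from ideal_span_add[OF this] show ?case
      by (intro exI[of _ "a + b"]) (simp add: hom_add algebra_simps)
  next
    case (mult x y)
    then obtain a b where "x - \<iota> a \<in> ideal_span Y" "y - \<iota> b \<in> ideal_span Y" by blast
    then have "y * (x - \<iota> a) + \<iota> a * (y - \<iota> b) \<in> ideal_span Y"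
      by (intro ideal_span_add ideal_span_scale)
    then show ?case by (intro exI[of _ "a * b"]) (simp add: hom_mult algebra_simps)
  qed
qed

text \<open>The projection required by \<open>quot_dim_eq\<close> is the component in degree u +
  \<beta>v, since the generators of the smaller ideal sit one degree higher. A multiple c x of a
  generator x is split into a scalar multiple of x and (c - \<iota> a) x, where c - \<iota> a lies
  in the ideal of the marked generators and thus moves x into the smaller ideal.\<close>

lemma quot_dim_bimonomials:
  assumes f: "\<And>i. i \<in> X \<Longrightarrow> p i \<Longrightarrow> f i \<in> R 1" "\<And>i. i \<in> X \<Longrightarrow> \<not> p i \<Longrightarrow> f i \<in> R \<beta>"
    and gen: "R 1 \<subseteq> span (f ` {i\<in>X. p i})"
  shows "quot_dim \<iota> (ideal_span (monomial f ` bimonomials X p u v))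
      (ideal_span (monomial f ` bimonomials X p (Suc u) v)) = dim (span (monomial f ` bimonomials X p u v))"
proof (rule quot_dim_eq)
  let ?A = "ideal_span (monomial f ` bimonomials X p u v)" and ?T = "span (monomial f ` bimonomials X p u v)"
  let ?B = "ideal_span (monomial f ` bimonomials X p (Suc u) v)"
  let ?w = "u + \<beta> * v"
  show "comp (x + y) ?w = comp x ?w + comp y ?w" for x y by (rule comp_add)
  show "comp (kscale \<iota> c x) ?w = kscale \<iota> c (comp x ?w)" for c x by (rule comp_scale)
  show "subspace ?T" by simp
  show A: "subspace ?A" and B: "subspace ?B" by (auto intro!: is_ideal_imp_subspace ideal_subspace_span)
  show "?T \<subseteq> ?A" using ideal_span_superset by (intro span_minimal A)
  show "comp t ?w = t" if "t \<in> ?T" for t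
  proof -
    have "?T \<subseteq> R ?w" using monomial_in_R_bimonomials[where f = f, OF _ f] by (intro span_minimal subspace_R) blast
    then show ?thesis using comp_homogeneous that by auto
  qed
  show "comp b ?w = 0" if "b \<in> ?B" for b
    using that
  proof (induction rule: ideal_span_induct)
    case (step c x y)
    then have "x \<in> R (Suc u + \<beta> * v)" using monomial_in_R_bimonomials[where f = f, OF _ f] by blast
    then have "comp (x * c) ?w = 0" by (simp add: comp_homogeneous_mult)
    then show ?case using step by (simp add: comp_add mult.commute)
  qed simp
  show "\<exists>t\<in>?T. \<exists>b\<in>?B. x = t + b" if "x \<in> ?A" for x
    using that
  proof (induction rule: ideal_span_induct)
    case base
    show ?case using span_zero ideal_span_zero by (metis add_0)
  next
    case (step c x y)
    obtain M where M: "x = monomial f M" "M \<in> bimonomials X p u v" using step(1) by blast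
    obtain t b where tb: "t \<in> ?T" "b \<in> ?B" "y = t + b" using step(2) by blast
    have "span (f ` {i\<in>X. p i}) \<subseteq> ideal_span (f ` {i\<in>X. p i})"
      by (intro span_minimal ideal_span_superset is_ideal_imp_subspace ideal_subspace_span)
    then obtain a where a: "c - \<iota> a \<in> ideal_span (f ` {i\<in>X. p i})"
      using scalar_plus_ideal_R1[of "f ` {i\<in>X. p i}" c] gen by auto
    have "(c - \<iota> a) * x \<in> ?B"
    proof (rule ideal_span_mult[OF a ideal_span_base[of x "{x}"]])
      fix g x' assume "g \<in> f ` {i\<in>X. p i}" "x' \<in> {x}"
      then obtain i where "g = f i" "i \<in> X" "p i" "x' = monomial f M" using M by blast
      moreover have "add_mset i M \<in> bimonomials X p (Suc u) v"
        using M(2) \<open>i \<in> X\<close> \<open>p i\<close> by (auto simp: bimonomials_def)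
      ultimately show "g * x' \<in> ?B" by (intro ideal_span_base image_eqI[of _ _ "add_mset i M"]) auto
    qed simp
    then have "(c - \<iota> a) * x + b \<in> ?B" using tb(2) by (rule ideal_span_add)
    moreover have "kscale \<iota> a x + t \<in> ?T" by (rule span_add[OF span_scale[OF span_base[OF step(1)]] tb(1)])
    moreover have "c * x + y = (kscale \<iota> a x + t) + ((c - \<iota> a) * x + b)"
      by (simp add: tb(3) kscale_def algebra_simps)
    ultimately show ?case by blast
  qed
qed

end

section \<open>Bivariate polynomials and mixed multiplicities\<close>

lemma poly_eq_0_if_zero_on_nats:
  fixes P :: "'a::{idom, ring_char_0} poly"
  assumes "\<And>n. n \<ge> N \<Longrightarrow> poly P (of_nat n) = 0"
  shows "P = 0"
proof (rule ccontr)
  assume "P \<noteq> 0"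
  then have "finite {x. poly P x = 0}" by (rule poly_roots_finite)
  moreover have "of_nat ` {N..} \<subseteq> {x. poly P x = 0}" using assms by auto
  ultimately have "finite (of_nat ` {N..} :: 'a set)" by (rule rev_finite_subset)
  then have "finite {N..}" by (rule finite_imageD) (simp add: inj_on_def)
  then show False by (simp add: infinite_Ici)
qed

lemma poly_ge_lead_coeff:
  fixes p :: "'a::linordered_field poly"
  assumes "lead_coeff p > 0"
  shows "\<exists>n. \<forall>x\<ge>n. poly p x \<ge> lead_coeff p"
  using assms
proof (induction p)
  case (pCons a p)
  show ?case
  proof (cases "p = 0")
    case False
    then have lc: "lead_coeff p > 0" using pCons.prems by simp
    then obtain n1 where n1: "\<And>x. x \<ge> n1 \<Longrightarrow> lead_coeff p \<le> poly p x" using pCons.IH by blast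
    \<comment> \<open>The bound on x is chosen so that x times the leading coefficient exceeds that
      coefficient by at least \<bar>a\<bar>, which absorbs the constant term.\<close>
    have "lead_coeff (pCons a p) \<le> poly (pCons a p) x" if x: "x \<ge> max n1 (1 + \<bar>a\<bar> / lead_coeff p)" for x
    proof -
      have x1: "1 + \<bar>a\<bar> / lead_coeff p \<le> x" using x by simp
      have "(1 + \<bar>a\<bar> / lead_coeff p) * lead_coeff p = lead_coeff p + \<bar>a\<bar>"
        using False by (simp add: distrib_right)
      then have "lead_coeff p + \<bar>a\<bar> \<le> x * lead_coeff p"
        using lc mult_right_mono[OF x1, of "lead_coeff p"] by simp
      moreover have "0 \<le> \<bar>a\<bar> / lead_coeff p" using lc by simp
      then have "x * lead_coeff p \<le> x * poly p x"
        using n1[of x] x x1 by (intro mult_left_mono) (auto intro: order_trans)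
      ultimately show ?thesis using False abs_ge_minus_self[of a] by simp
    qed
    then show ?thesis by blast
  qed simp
qed simp

text \<open>If the degree of W exceeded d, then W and W - C t^d would have the same leading
  coefficient; the upper bound excludes a positive one and the lower bound a negative one.\<close>

lemma degree_le_if_poly_bounded:
  fixes W :: "rat poly"
  assumes "\<And>t. t \<ge> N \<Longrightarrow> 0 \<le> poly W (of_nat t)" "\<And>t. t \<ge> N \<Longrightarrow> poly W (of_nat t) \<le> C * of_nat t ^ d"
  shows "degree W \<le> d"
proof (rule ccontr)
  assume "\<not> degree W \<le> d"
  then have dW: "d < degree W" by simp
  then have "W \<noteq> 0" by auto
  have ub: False if pos: "lead_coeff p > 0" and le: "\<And>t. t \<ge> N \<Longrightarrow> poly p (of_nat t) \<le> 0" for p :: "rat poly"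
  proof -
    obtain n where n: "\<And>x. x \<ge> n \<Longrightarrow> poly p x \<ge> lead_coeff p" using poly_ge_lead_coeff[OF pos] by blast
    obtain t0 where t0: "n \<le> of_nat t0" using real_arch_simple by blast
    have "n \<le> of_nat (max N t0)" using t0 by (simp add: order_trans[OF t0])
    then have "lead_coeff p \<le> poly p (of_nat (max N t0))" by (rule n)
    moreover have "poly p (of_nat (max N t0)) \<le> 0" by (rule le) simp
    ultimately show False using pos by linarith
  qed
  show False
  proof (cases "lead_coeff W > 0")
    case False
    then have "lead_coeff (- W) > 0" using \<open>W \<noteq> 0\<close> by (simp add: not_less less_le)
    then show False by (rule ub) (simp add: assms(1))
  next
    case True
    have "degree (monom C d) < degree W" using dW degree_monom_le[of C d] by linarith
    then have "lead_coeff (W - monom C d) = lead_coeff W"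
      by (metis diff_conv_add_uminus add.commute degree_minus lead_coeff_add_le)
    with True have "lead_coeff (W - monom C d) > 0" by simp
    then show False by (rule ub) (simp add: assms(2) poly_monom)
  qed
qed

text \<open>Substituting the polynomial \<open>[:0, p:]\<close>, that is p v, for u restricts Q to
  the ray u = p v.\<close>

lemma poly_ray: "poly (poly Q [:0, p:]) t = poly (poly Q [:p * t:]) (t :: 'a::comm_ring_1)"
  by (induction Q) (simp_all add: algebra_simps)

text \<open>The right-hand side is the value at (p,1) of the homogeneous part of degree n of
  Q.\<close>

lemma coeff_ray:
  "coeff (poly Q [:0, p:]) n = (\<Sum>a\<le>n. p ^ a * coeff (coeff Q a) (n - a :: nat))" for p :: "'a::comm_ring_1"
proof (induction Q arbitrary: n)
  case (pCons q Q)
  show ?case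
  proof (cases n)
    case (Suc m)
    have "coeff (poly (pCons q Q) [:0, p:]) n = coeff q n + p * coeff (poly Q [:0, p:]) m"
      by (simp add: Suc)
    also have "\<dots> = coeff q n + (\<Sum>a\<le>m. p ^ Suc a * coeff (coeff Q a) (m - a))"
      by (simp add: pCons.IH sum_distrib_left mult.assoc)
    also have "\<dots> = (\<Sum>a\<le>n. p ^ a * coeff (coeff (pCons q Q) a) (n - a))"
      unfolding Suc by (subst sum.atMost_Suc_shift) simp
    finally show ?thesis .
  qed simp
qed simp

definition total_degree_le :: "nat \<Rightarrow> rat poly poly \<Rightarrow> bool" where
  "total_degree_le d Q \<longleftrightarrow> (\<forall>a b. coeff (coeff Q a) b \<noteq> 0 \<longrightarrow> a + b \<le> d)"

text \<open>The homogeneous part of degree a + b, dehomogenised at v = 1, is the univariate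
  polynomial \<open>G\<close>; it vanishes at all integers p \<ge> 1 and is therefore zero.\<close>

lemma total_degree_leI:
  assumes "\<And>p n. p \<ge> 1 \<Longrightarrow> n > d \<Longrightarrow> coeff (poly Q [:0, of_nat p:]) n = 0"
  shows "total_degree_le d Q"
  unfolding total_degree_le_def
proof (intro allI impI)
  fix a b assume nz: "coeff (coeff Q a) b \<noteq> 0"
  show "a + b \<le> d"
  proof (rule ccontr)
    assume "\<not> a + b \<le> d"
    define G where "G = (\<Sum>i\<le>a + b. monom (coeff (coeff Q i) (a + b - i)) i)"
    have "poly G (of_nat p) = 0" if "p \<ge> 1" for p
      using assms[OF that, of "a + b"] \<open>\<not> a + b \<le> d\<close>
      by (simp add: G_def poly_sum poly_monom coeff_ray mult.commute)
    then have "G = 0" by (rule poly_eq_0_if_zero_on_nats)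
    moreover have "coeff G a = coeff (coeff Q a) b"
      by (simp add: G_def coeff_sum)
    ultimately show False using nz by simp
  qed
qed

lemma bounded_hilbert_poly:
  fixes h :: "nat \<Rightarrow> nat \<Rightarrow> nat"
  assumes "eventually_poly2 (\<lambda>u v. of_nat (h u v))" and bound: "\<And>u v. h u v \<le> C * Suc (u + \<beta> * v) ^ d"
  shows "\<exists>Q u0 v0. total_degree_le d Q \<and>
    (\<forall>u\<ge>u0. \<forall>v\<ge>v0. of_nat (h u v) = poly (poly Q [:of_nat u:]) (of_nat v))"
proof -
  obtain Q :: "rat poly poly" and u0 v0
    where Q: "\<And>u v. u \<ge> u0 \<Longrightarrow> v \<ge> v0 \<Longrightarrow> of_nat (h u v) = poly (poly Q [:of_nat u:]) (of_nat v)"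
  proof -
    obtain F u0 v0 where F: "polyfun2 F" "\<And>u v. u \<ge> u0 \<Longrightarrow> v \<ge> v0 \<Longrightarrow> of_nat (h u v) = F (of_nat u) (of_nat v)"
      using assms(1) unfolding eventually_poly2_def by blast
    moreover obtain Q where "\<And>x y. F x y = poly (poly Q [:x:]) y"
      using F(1) unfolding polyfun2_def by blast
    ultimately show ?thesis using that[of u0 v0 Q] by simp
  qed
  have "total_degree_le d Q"
  proof (rule total_degree_leI)
    fix p n :: nat assume p: "p \<ge> 1" and n: "n > d"
    \<comment> \<open>The 1 in \<open>?N\<close> ensures t \<ge> 1, so that the successor in the
      bound can be absorbed: pt + \<beta>t + 1 \<le> (p + \<beta> + 1) t.\<close>
    let ?W = "poly Q [:0, of_nat p:]" and ?N = "max 1 (max u0 v0)"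
    have W: "poly ?W (of_nat t) = of_nat (h (p * t) t)" if "t \<ge> ?N" for t
    proof -
      have "t \<le> p * t" using p by simp
      moreover have "u0 \<le> t" "v0 \<le> t" using that by simp_all
      ultimately have "of_nat (h (p * t) t) = poly (poly Q [:of_nat (p * t):]) (of_nat t)"
        by (intro Q) (auto intro: order_trans)
      then show ?thesis by (simp add: poly_ray)
    qed
    have "degree ?W \<le> d"
    proof (rule degree_le_if_poly_bounded)
      show "0 \<le> poly ?W (of_nat t)" if "t \<ge> ?N" for t using W[OF that] by simp
      show "poly ?W (of_nat t) \<le> of_nat (C * (p + \<beta> + 1) ^ d) * of_nat t ^ d" if "t \<ge> ?N" for t
      proof -
        have "Suc (p * t + \<beta> * t) \<le> (p + \<beta> + 1) * t" using that by (simp add: algebra_simps)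
        then have "Suc (p * t + \<beta> * t) ^ d \<le> (p + \<beta> + 1) ^ d * t ^ d"
          using power_mono[of "Suc (p * t + \<beta> * t)" "(p + \<beta> + 1) * t" d] by (simp only: power_mult_distrib)
        then have "h (p * t) t \<le> C * (p + \<beta> + 1) ^ d * t ^ d"
          using order_trans[OF bound[of "p * t" t] mult_le_mono2] by (simp add: mult.assoc)
        then have "of_nat (h (p * t) t) \<le> (of_nat (C * (p + \<beta> + 1) ^ d * t ^ d) :: rat)"
          by (simp only: of_nat_le_iff)
        then show ?thesis using W[OF that] by simp
      qed
    qed
    then show "coeff ?W n = 0" using n by (simp add: coeff_eq_0)
  qed
  with Q show ?thesis by blast
qed

section \<open>Uniqueness and integrality of the top coefficients\<close>

lemma bivariate_poly_unique:
  fixes Q Q' :: "rat poly poly"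
  assumes "\<And>u v. u \<ge> u0 \<Longrightarrow> v \<ge> v0 \<Longrightarrow>
    poly (poly Q [:of_nat u:]) (of_nat v) = poly (poly Q' [:of_nat u:]) (of_nat v)"
  shows "Q = Q'"
proof -
  have "poly (Q - Q') (of_nat u) = 0" if "u \<ge> u0" for u
  proof (rule poly_eq_0_if_zero_on_nats)
    show "poly (poly (Q - Q') (of_nat u)) (of_nat v) = 0" if "v \<ge> v0" for v
      using assms[OF \<open>u \<ge> u0\<close> that] by (simp add: of_nat_poly)
  qed
  then have "Q - Q' = 0" by (rule poly_eq_0_if_zero_on_nats)
  then show ?thesis by simp
qed

lemma coeff_pcompose_shift:
  fixes P :: "'a::comm_ring_1 poly"
  assumes "degree P \<le> N"
  shows "coeff (pcompose P [:1, 1:]) n = (\<Sum>i\<le>N. of_nat (i choose n) * coeff P i)"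
proof -
  have "P = (\<Sum>i\<le>N. monom (coeff P i) i)" using poly_as_sum_of_monoms'[OF assms] by simp
  then have "pcompose P [:1, 1:] = (\<Sum>i\<le>N. pcompose (monom (coeff P i) i) [:1, 1:])"
    by (metis pcompose_sum)
  also have "\<dots> = (\<Sum>i\<le>N. smult (coeff P i) ([:1, 1:] ^ i))"
  proof (rule sum.cong[OF refl])
    have monom: "pcompose (monom c i) [:1, 1:] = smult c ([:1, 1:] ^ i)" for c :: 'a and i
      by (induction i) (simp_all add: monom_0 monom_Suc pcompose_pCons)
    show "pcompose (monom (coeff P i) i) [:1, 1:] = smult (coeff P i) ([:1, 1:] ^ i)" for i
      by (rule monom)
  qed
  finally have "coeff (pcompose P [:1, 1:]) n = (\<Sum>i\<le>N. coeff P i * coeff ([:1, 1:] ^ i) n)"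
    by (simp add: coeff_sum)
  moreover have "coeff ([:1, 1 :: 'a:] ^ i) n = of_nat (i choose n)" for i
    by (cases "n \<le> i") (simp_all add: coeff_linear_poly_power binomial_eq_0 coeff_eq_0 degree_linear_power)
  ultimately show ?thesis by (simp add: mult.commute)
qed

text \<open>The term of index \<open>Suc n\<close> is split off because in the top degree of the
  difference it is the only one left. Over a polynomial coefficient ring this is the difference in u
  alone.\<close>

lemma coeff_difference:
  fixes P :: "'a::comm_ring_1 poly"
  shows "coeff (pcompose P [:1, 1:] - P) n =
    of_nat (Suc n) * coeff P (Suc n) + (\<Sum>i\<in>{Suc n<..degree P}. of_nat (i choose n) * coeff P i)"
proof -
  let ?g = "\<lambda>i. of_nat (i choose n) * coeff P i"
  define N where "N = max (Suc n) (degree P)"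
  have "coeff (pcompose P [:1, 1:]) n = (\<Sum>i\<le>N. ?g i)"
    by (rule coeff_pcompose_shift) (simp add: N_def)
  also have "\<dots> = (\<Sum>i\<in>{n, Suc n} \<union> {Suc n<..degree P}. ?g i)"
  proof (rule sum.mono_neutral_right)
    show "\<forall>i\<in>{..N} - ({n, Suc n} \<union> {Suc n<..degree P}). ?g i = 0"
    proof
      fix i assume "i \<in> {..N} - ({n, Suc n} \<union> {Suc n<..degree P})"
      then have "i < n \<or> degree P < i" by auto
      then show "?g i = 0" by (auto simp: binomial_eq_0 coeff_eq_0)
    qed
  qed (auto simp: N_def)
  also have "\<dots> = ?g n + ?g (Suc n) + (\<Sum>i\<in>{Suc n<..degree P}. ?g i)"
    by (subst sum.union_disjoint) auto
  finally show ?thesis by simp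
qed

text \<open>A forward difference keeps the values integral, lowers the degree bound by one and
  multiplies the top coefficient by the old bound; d of them produce the factor d!.\<close>

lemma fact_coeff_in_Ints:
  fixes P :: "rat poly"
  assumes "degree P \<le> d" "\<And>n. n \<ge> N \<Longrightarrow> poly P (of_nat n) \<in> \<int>"
  shows "fact d * coeff P d \<in> \<int>"
  using assms
proof (induction d arbitrary: P)
  case 0
  then obtain a where "P = [:a:]" by (metis degree_eq_zeroE le_zero_eq)
  then show ?case using 0(2)[of N] by simp
next
  case (Suc d)
  let ?D = "pcompose P [:1, 1:] - P"
  have zero: "(\<Sum>i\<in>{Suc n<..degree P}. of_nat (i choose n) * coeff P i) = 0" if "n \<ge> d" for n
    using Suc.prems(1) that by (intro sum.neutral) (auto simp: coeff_eq_0)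
  have "coeff ?D n = 0" if "n > d" for n
    using Suc.prems(1) that zero[of n] by (simp only: coeff_difference) (simp add: coeff_eq_0)
  then have deg: "degree ?D \<le> d" by (intro degree_le) blast
  have "fact d * coeff ?D d \<in> \<int>"
  proof (rule Suc.IH[OF deg])
    fix n assume "n \<ge> N"
    then have "poly P (of_nat (Suc n)) \<in> \<int>" "poly P (of_nat n) \<in> \<int>" using Suc.prems(2) by (metis le_Suc_eq, blast)
    then show "poly ?D (of_nat n) \<in> \<int>" by (simp add: poly_pcompose)
  qed
  also have "coeff ?D d = of_nat (Suc d) * coeff P (Suc d)"
    using zero[OF order_refl] by (simp only: coeff_difference add_0_right)
  finally show ?case by (simp add: algebra_simps)
qed

text \<open>Differences in u reduce to a = 0. Then u can be frozen at \<open>u0\<close>: total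
  degree at most b leaves only the term u^0 v^b to contribute to v^b.\<close>

lemma total_degree_coeff_in_Ints:
  fixes Q :: "rat poly poly"
  assumes "total_degree_le (a + b) Q"
    "\<And>u v. u \<ge> u0 \<Longrightarrow> v \<ge> v0 \<Longrightarrow> poly (poly Q [:of_nat u:]) (of_nat v) \<in> \<int>"
  shows "fact a * fact b * coeff (coeff Q a) b \<in> \<int>"
  using assms
proof (induction a arbitrary: Q)
  case 0
  let ?P = "poly Q [:of_nat u0:]"
  have z: "coeff (coeff Q i) n = 0" if "i + n > b" for i n
    using 0(1) that unfolding total_degree_le_def by force
  have P: "coeff ?P n = (\<Sum>i\<le>degree Q. of_nat u0 ^ i * coeff (coeff Q i) n)" for n
  proof -
    have "coeff (q * [:c:] ^ i) n = c ^ i * coeff q n" for q i and c :: rat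
      by (induction i) (simp_all add: mult.assoc mult.left_commute[of q])
    then show ?thesis by (simp add: poly_altdef coeff_sum)
  qed
  have "coeff ?P n = 0" if "n > b" for n
    using that by (simp add: P z)
  then have "degree ?P \<le> b" by (intro degree_le) blast
  then have "fact b * coeff ?P b \<in> \<int>" by (rule fact_coeff_in_Ints) (rule 0(2)[of u0], auto)
  moreover have "coeff ?P b = coeff (coeff Q 0) b"
    unfolding P by (subst sum.remove[of _ 0]) (auto intro!: sum.neutral simp: z)
  ultimately show ?case by simp
next
  case (Suc a)
  let ?D = "pcompose Q [:1, 1:] - Q"
  have z: "coeff (coeff Q i) n = 0" if "i + n > Suc a + b" for i n
    using Suc.prems(1) that unfolding total_degree_le_def by force
  have D: "coeff (coeff ?D i) n = of_nat (Suc i) * coeff (coeff Q (Suc i)) n +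
      (\<Sum>j\<in>{Suc i<..degree Q}. of_nat (j choose i) * coeff (coeff Q j) n)" for i n
    unfolding coeff_difference by (simp add: coeff_sum of_nat_mult_conv_smult del: of_nat_Suc)
  have zero: "(\<Sum>j\<in>{Suc i<..degree Q}. of_nat (j choose i) * coeff (coeff Q j) n) = 0" if "i + n \<ge> a + b" for i n
    using that by (intro sum.neutral) (auto simp: z)
  have "total_degree_le (a + b) ?D"
    unfolding total_degree_le_def
  proof (intro allI impI, rule ccontr)
    fix i n assume "coeff (coeff ?D i) n \<noteq> 0" "\<not> i + n \<le> a + b"
    then show False using zero[of i n] z[of "Suc i" n] by (simp add: D del: coeff_diff of_nat_Suc)
  qed
  then have "fact a * fact b * coeff (coeff ?D a) b \<in> \<int>"
  proof (rule Suc.IH)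
    fix u v assume uv: "u \<ge> u0" "v \<ge> v0"
    have "poly (poly Q [:of_nat (Suc u):]) (of_nat v) \<in> \<int>" "poly (poly Q [:of_nat u:]) (of_nat v) \<in> \<int>"
      using Suc.prems(2)[of "Suc u" v] Suc.prems(2)[of u v] uv by auto
    then show "poly (poly ?D [:of_nat u:]) (of_nat v) \<in> \<int>"
      by (simp add: poly_pcompose one_pCons)
  qed
  also have "coeff (coeff ?D a) b = of_nat (Suc a) * coeff (coeff Q (Suc a)) b"
    using zero[of a b] by (simp add: D del: coeff_diff of_nat_Suc)
  finally show ?case by (simp add: algebra_simps)
qed

text \<open>The definition by \<open>THE\<close> over integers has a value only if the coefficient
  times i! (d-i)! is an integer and Q is determined by its values on a quadrant; both are
  established here.\<close>

lemma mixed_multiplicity_coeff: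
  assumes Q: "is_bhattacharya_poly \<iota> d \<nn> \<aa> Q" and i: "i \<le> d"
  shows "coeff (coeff Q (d - i)) i = of_int (mixed_multiplicity \<iota> d \<nn> \<aa> i) / (fact i * fact (d - i))"
proof -
  let ?h = "\<lambda>u v. quot_dim \<iota> (ideal_prod (ideal_pow \<nn> u) (ideal_pow \<aa> v))
                           (ideal_prod (ideal_pow \<nn> (Suc u)) (ideal_pow \<aa> v))"
  have td: "total_degree_le d Q"
    using Q unfolding is_bhattacharya_poly_def total_degree_le_def by blast
  obtain u0 v0 where uv: "\<And>u v. u \<ge> u0 \<Longrightarrow> v \<ge> v0 \<Longrightarrow> of_nat (?h u v) = poly (poly Q [:of_nat u:]) (of_nat v)"
    using Q unfolding is_bhattacharya_poly_def by blast
  have "poly (poly Q [:of_nat u:]) (of_nat v) \<in> \<int>" if "u \<ge> u0" "v \<ge> v0" for u v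
    using uv[OF that] by (metis Ints_of_nat)
  then have "fact (d - i) * fact i * coeff (coeff Q (d - i)) i \<in> \<int>"
    using total_degree_coeff_in_Ints[of "d - i" i Q u0 v0] td i by simp
  then obtain e where e: "fact (d - i) * fact i * coeff (coeff Q (d - i)) i = of_int e" by (auto elim: Ints_cases)
  have unique: "Q' = Q" if Q': "is_bhattacharya_poly \<iota> d \<nn> \<aa> Q'" for Q'
  proof -
    obtain u1 v1 where uv': "\<And>u v. u \<ge> u1 \<Longrightarrow> v \<ge> v1 \<Longrightarrow> of_nat (?h u v) = poly (poly Q' [:of_nat u:]) (of_nat v)"
      using Q' unfolding is_bhattacharya_poly_def by blast
    show ?thesis
      by (rule bivariate_poly_unique[of "max u0 u1" "max v0 v1"]) (use uv uv' in \<open>simp flip: uv uv'\<close>)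
  qed
  have coeff: "coeff (coeff Q (d - i)) i = of_int e / (fact i * fact (d - i))"
    using e by (simp add: field_simps)
  have "mixed_multiplicity \<iota> d \<nn> \<aa> i = e"
    unfolding mixed_multiplicity_def
  proof (rule the_equality)
    show "\<exists>Q. is_bhattacharya_poly \<iota> d \<nn> \<aa> Q \<and> coeff (coeff Q (d - i)) i = of_int e / (fact i * fact (d - i))"
      using Q coeff by blast
    fix e' assume "\<exists>Q. is_bhattacharya_poly \<iota> d \<nn> \<aa> Q \<and> coeff (coeff Q (d - i)) i = of_int e' / (fact i * fact (d - i))"
    then have "coeff (coeff Q (d - i)) i = of_int e' / (fact i * fact (d - i))" using unique by blast
    with coeff show "e' = e" by simp
  qed
  with coeff show ?thesis by simp
qed

section \<open>The polynomial extension\<close>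

lemma algebra_generated_mono:
  assumes "x \<in> algebra_generated \<iota> X" "X \<subseteq> Y"
  shows "x \<in> algebra_generated \<iota> Y"
  using assms(1) by induction (use assms(2) in \<open>auto intro: algebra_generated.intros\<close>)

lemma algebra_generated_poly:
  fixes \<iota> :: "'k::field \<Rightarrow> 'a::comm_ring_1"
  assumes "algebra_generated \<iota> X = UNIV"
  shows "algebra_generated (poly_scalar \<iota>) ((\<lambda>r. [:r:]) ` X \<union> {[:0, 1:]}) = UNIV"
proof -
  let ?Y = "(\<lambda>r. [:r:]) ` X \<union> {[:0, 1:]}"
  have const: "[:r:] \<in> algebra_generated (poly_scalar \<iota>) ?Y" if "r \<in> algebra_generated \<iota> X" for r
    using that
  proof induction
    case (scalar c)
    have "[:\<iota> c:] = poly_scalar \<iota> c" by (simp add: poly_scalar_def)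
    then show ?case by (simp only: algebra_generated.scalar)
  next
    case (gen x)
    then show ?case by (intro algebra_generated.gen) blast
  next
    case (add x y)
    from algebra_generated.add[OF add.IH] show ?case by simp
  next
    case (mult x y)
    from algebra_generated.mult[OF mult.IH] show ?case by (simp add: mult.commute)
  qed
  have "p \<in> algebra_generated (poly_scalar \<iota>) ?Y" for p
  proof (induction p)
    case 0
    show ?case using const[of 0] assms by simp
  next
    case (pCons a p)
    have "[:0, 1:] \<in> algebra_generated (poly_scalar \<iota>) ?Y" by (intro algebra_generated.gen) blast
    from algebra_generated.mult[OF this pCons.IH] have "[:a:] + [:0, 1:] * p \<in> algebra_generated (poly_scalar \<iota>) ?Y"
      using const[of a] assms by (intro algebra_generated.add) auto
    then show ?case by simp
  qed
  then show ?thesis by blast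
qed

section \<open>Dimensions of direct sums and of injective images\<close>

lemma (in vector_space) independent_Un_disjoint:
  assumes "independent B" "independent C" "finite C" "span B \<inter> span C = {0}"
  shows "independent (B \<union> C)"
  using assms(3,2,4)
proof (induction C rule: finite_induct)
  case empty
  then show ?case using assms(1) by simp
next
  case (insert x C)
  have C: "independent C" "x \<notin> span C"
    using insert.prems(1) insert.hyps(2) by (auto simp: independent_insert)
  have le: "span C \<subseteq> span (insert x C)" by (rule span_mono) auto
  then have IH: "independent (B \<union> C)"
    using insert.prems(2) span_zero by (intro insert.IH C) blast
  have "x \<notin> span (B \<union> C)"
  proof
    assume "x \<in> span (B \<union> C)"
    then obtain y z where yz: "y \<in> span B" "z \<in> span C" "x = y + z" by (auto simp: span_Un)
    then have "y = x - z" by simp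
    then have "y \<in> span (insert x C)"
      using yz(2) le span_base[of x "insert x C"] span_diff by blast
    then have "y = 0" using yz(1) insert.prems(2) by blast
    then show False using yz C(2) by simp
  qed
  then show ?case using IH independent_insertI by simp
qed

lemma (in vector_space) dim_Un_disjoint:
  assumes "finite W" "U \<subseteq> span W" "V \<subseteq> span W" "span U \<inter> span V = {0}"
  shows "dim (U \<union> V) = dim U + dim V"
proof -
  obtain B where B: "finite B" "B \<subseteq> U" "independent B" "U \<subseteq> span B" "card B = dim U"
    by (rule finite_basis[OF assms(1,2)])
  obtain C where C: "finite C" "C \<subseteq> V" "independent C" "V \<subseteq> span C" "card C = dim V"
    by (rule finite_basis[OF assms(1,3)])
  have sp: "span B = span U" "span C = span V"
    using B(2,4) C(2,4) by (metis span_mono span_span subset_antisym)+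
  then have "independent (B \<union> C)" using assms(4) B C by (intro independent_Un_disjoint) auto
  moreover have "span (B \<union> C) = span (U \<union> V)"
    using sp by (simp add: span_Un)
  moreover have "B \<inter> C = {}"
  proof -
    have "x \<notin> C" if "x \<in> B" for x
    proof
      assume "x \<in> C"
      with that have "x \<in> span U \<inter> span V" using span_base sp by blast
      then have "x = 0" using assms(4) by blast
      then show False using that B(3) dependent_zero by blast
    qed
    then show ?thesis by blast
  qed
  ultimately show ?thesis
    using dim_eq_card B C by (metis card_Un_disjoint)
qed

lemma dim_inj_image:
  assumes "module_hom s1 s2 f" "vector_space s1" "vector_space s2" "inj f"
  shows "vector_space.dim s2 (f ` V) = vector_space.dim s1 V"
proof -
  interpret v1: vector_space s1 by fact
  interpret v2: vector_space s2 by fact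
  interpret f: module_hom s1 s2 f by fact
  obtain B where B: "B \<subseteq> V" "v1.independent B" "V \<subseteq> v1.span B" "card B = v1.dim V"
    using v1.basis_exists by blast
  have "v2.independent (f ` B)"
    using B(2) assms(4) by (intro f.independent_injective_image) (auto intro: inj_on_subset)
  moreover have "v2.span (f ` B) = v2.span (f ` V)"
    using B(1,3) by (metis f.span_image v1.span_mono v1.span_span subset_antisym)
  ultimately have "v2.dim (f ` V) = card (f ` B)" using v2.dim_eq_card by metis
  then show ?thesis using B(4) assms(4) by (simp add: card_image inj_on_subset)
qed

context standard_graded_algebra
begin

section \<open>The standard grading of S and its ideal \<nn>\<close>

lemma poly_grading_iff:
  "p \<in> poly_grading R n \<longleftrightarrow> (\<forall>i\<le>n. coeff p i \<in> R (n - i)) \<and> (\<forall>i>n. coeff p i = 0)"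
  unfolding poly_grading_def by (auto simp: not_le)

lemma R_sum: "(\<And>i. i \<in> A \<Longrightarrow> f i \<in> R n) \<Longrightarrow> sum f A \<in> R n"
  by (rule subspace_sum[OF subspace_R])

lemma poly_grading_mult:
  assumes "p \<in> poly_grading R m" "q \<in> poly_grading R n"
  shows "p * q \<in> poly_grading R (m + n)"
  unfolding poly_grading_iff
proof (intro conjI allI impI)
  have p: "\<And>i. i \<le> m \<Longrightarrow> coeff p i \<in> R (m - i)" "\<And>i. i > m \<Longrightarrow> coeff p i = 0"
    and q: "\<And>i. i \<le> n \<Longrightarrow> coeff q i \<in> R (n - i)" "\<And>i. i > n \<Longrightarrow> coeff q i = 0"
    using assms by (auto simp: poly_grading_iff)
  show "coeff (p * q) i \<in> R (m + n - i)" if "i \<le> m + n" for i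
    unfolding coeff_mult
  proof (rule R_sum)
    fix j assume "j \<in> {..i}"
    show "coeff p j * coeff q (i - j) \<in> R (m + n - i)"
    proof (cases "j \<le> m \<and> i - j \<le> n")
      case True
      then have "m - j + (n - (i - j)) = m + n - i" using \<open>j \<in> {..i}\<close> by auto
      then show ?thesis using mult_closed[OF p(1)[of j] q(1)[of "i - j"]] True by simp
    qed (auto simp: p(2) q(2) zero_closed not_le)
  qed
  show "coeff (p * q) i = 0" if "i > m + n" for i
    unfolding coeff_mult
  proof (rule sum.neutral, rule ballI)
    fix j assume "j \<in> {..i}"
    then have "j > m \<or> i - j > n" using that by auto
    then show "coeff p j * coeff q (i - j) = 0" by (auto simp: p(2) q(2))
  qed
qed

definition poly_comp :: "'a poly \<Rightarrow> nat \<Rightarrow> 'a poly" where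
  "poly_comp x n = (\<Sum>i\<le>n. monom (comp (coeff x i) (n - i)) i)"

lemma coeff_poly_comp: "coeff (poly_comp x n) i = (if i \<le> n then comp (coeff x i) (n - i) else 0)"
  by (simp add: poly_comp_def coeff_sum)

lemma poly_direct_sum:
  "\<exists>!f. (\<forall>n. f n \<in> poly_grading R n) \<and> finite {n. f n \<noteq> 0} \<and> x = (\<Sum>n | f n \<noteq> 0. f n)"
proof (rule ex1I)
  let ?A = "{n. poly_comp x n \<noteq> 0}"
  have "?A \<subseteq> (\<Union>i\<le>degree x. (+) i ` {k. comp (coeff x i) k \<noteq> 0})"
  proof
    fix n assume "n \<in> ?A"
    then obtain i where "coeff (poly_comp x n) i \<noteq> 0" using poly_eqI[of "poly_comp x n" 0] by auto
    then have i: "i \<le> n" "comp (coeff x i) (n - i) \<noteq> 0" by (auto simp: coeff_poly_comp split: if_splits)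
    then have "i \<le> degree x" by (intro le_degree) auto
    then show "n \<in> (\<Union>i\<le>degree x. (+) i ` {k. comp (coeff x i) k \<noteq> 0})"
      using i by (intro UN_I[of i] image_eqI[of _ _ "n - i"]) auto
  qed
  from finite_subset[OF this] have fin: "finite ?A" by (simp add: comp(2))
  have "coeff (\<Sum>n\<in>?A. poly_comp x n) i = coeff x i" for i
  proof -
    let ?K = "{k. comp (coeff x i) k \<noteq> 0}"
    have sub: "(+) i ` ?K \<subseteq> ?A"
    proof
      fix n assume "n \<in> (+) i ` ?K"
      then have "coeff (poly_comp x n) i \<noteq> 0" by (auto simp: coeff_poly_comp)
      then show "n \<in> ?A" by auto
    qed
    have "coeff (\<Sum>n\<in>?A. poly_comp x n) i = (\<Sum>n\<in>?A. coeff (poly_comp x n) i)" by (simp add: coeff_sum)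
    also have "\<dots> = (\<Sum>n\<in>(+) i ` ?K. coeff (poly_comp x n) i)"
    proof (rule sum.mono_neutral_right[OF fin sub], rule ballI)
      fix n assume "n \<in> ?A - (+) i ` ?K"
      then have "\<not> (i \<le> n \<and> comp (coeff x i) (n - i) \<noteq> 0)"
        by (auto simp: image_iff)
      then show "coeff (poly_comp x n) i = 0" by (auto simp: coeff_poly_comp)
    qed
    also have "\<dots> = (\<Sum>k\<in>?K. comp (coeff x i) k)" by (subst sum.reindex) (auto simp: coeff_poly_comp)
    finally show ?thesis using comp(3)[of "coeff x i"] by simp
  qed
  then have "x = (\<Sum>n\<in>?A. poly_comp x n)" by (intro poly_eqI) simp
  moreover have "poly_comp x n \<in> poly_grading R n" for n
    by (auto simp: poly_grading_iff coeff_poly_comp comp(1))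
  ultimately show "(\<forall>n. poly_comp x n \<in> poly_grading R n) \<and> finite ?A \<and> x = (\<Sum>n\<in>?A. poly_comp x n)"
    using fin by blast
  fix f assume "(\<forall>n. f n \<in> poly_grading R n) \<and> finite {n. f n \<noteq> 0} \<and> x = (\<Sum>n | f n \<noteq> 0. f n)"
  then have f: "\<And>n. f n \<in> poly_grading R n" "finite {n. f n \<noteq> 0}" "x = (\<Sum>n | f n \<noteq> 0. f n)" by blast+
  have "coeff (f n) i = coeff (poly_comp x n) i" for n i
  proof (cases "i \<le> n")
    case True
    have "comp (coeff x i) (n - i) = (\<Sum>m | f m \<noteq> 0. comp (coeff (f m) i) (n - i))"
      by (subst f(3)) (simp add: coeff_sum comp_sum)
    also have "\<dots> = (\<Sum>m | f m \<noteq> 0. if m = n then coeff (f m) i else 0)"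
    proof (rule sum.cong[OF refl])
      fix m
      show "comp (coeff (f m) i) (n - i) = (if m = n then coeff (f m) i else 0)"
      proof (cases "i \<le> m")
        case im: True
        then have "coeff (f m) i \<in> R (m - i)" using f(1)[of m] by (simp add: poly_grading_iff)
        then show ?thesis using comp_homogeneous[of "coeff (f m) i" "m - i" "n - i"] im True by auto
      next
        case False
        then have "coeff (f m) i = 0" using f(1)[of m] by (simp add: poly_grading_iff)
        then show ?thesis by (simp only: comp_0 if_cancel)
      qed
    qed
    also have "\<dots> = coeff (f n) i" using f(2) by (auto simp: sum.delta)
    finally show ?thesis using True by (simp add: coeff_poly_comp)
  next
    case False
    then show ?thesis using f(1)[of n] by (simp add: poly_grading_iff coeff_poly_comp)
  qed
  then show "f = poly_comp x" by (intro ext poly_eqI)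
qed

lemma const_in_poly_grading: "r \<in> R n \<Longrightarrow> [:r:] \<in> poly_grading R n"
  by (auto simp: poly_grading_iff coeff_pCons zero_closed split: nat.splits)

lemma monom_in_poly_grading: "r \<in> R n \<Longrightarrow> monom r i \<in> poly_grading R (i + n)"
  by (auto simp: poly_grading_iff zero_closed)

lemma standard_graded_algebra_poly: "standard_graded_algebra (poly_scalar \<iota>) (poly_grading R)"
proof
  show "poly_scalar \<iota> 1 = 1" by (simp add: poly_scalar_def hom_one one_pCons)
  show "poly_scalar \<iota> (a + b) = poly_scalar \<iota> a + poly_scalar \<iota> b" for a b
    by (simp add: poly_scalar_def hom_add)
  show "poly_scalar \<iota> (a * b) = poly_scalar \<iota> a * poly_scalar \<iota> b" for a b
    by (simp add: poly_scalar_def hom_mult)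
  show "poly_grading R 0 = range (poly_scalar \<iota>)"
  proof
    show "range (poly_scalar \<iota>) \<subseteq> poly_grading R 0"
      by (auto simp: poly_scalar_def degree_zero intro!: const_in_poly_grading)
    show "poly_grading R 0 \<subseteq> range (poly_scalar \<iota>)"
    proof
      fix p assume p: "p \<in> poly_grading R 0"
      then obtain c where "coeff p 0 = \<iota> c" by (auto simp: poly_grading_iff degree_zero)
      with p have "p = poly_scalar \<iota> c"
        by (intro poly_eqI) (auto simp: poly_grading_iff poly_scalar_def coeff_pCons split: nat.splits)
      then show "p \<in> range (poly_scalar \<iota>)" by blast
    qed
  qed
  show "0 \<in> poly_grading R n" for n by (simp add: poly_grading_iff zero_closed)
  show "x + y \<in> poly_grading R n" if "x \<in> poly_grading R n" "y \<in> poly_grading R n" for x y n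
    using that by (simp add: poly_grading_iff add_closed)
  show "x * y \<in> poly_grading R (m + n)" if "x \<in> poly_grading R m" "y \<in> poly_grading R n" for x y m n
    by (rule poly_grading_mult[OF that])
  show "\<exists>!f. (\<forall>n. f n \<in> poly_grading R n) \<and> finite {n. f n \<noteq> 0} \<and> x = (\<Sum>n | f n \<noteq> 0. f n)" for x
    by (rule poly_direct_sum)
  obtain X where "finite X" "algebra_generated \<iota> X = UNIV" using finitely_generated by blast
  then show "\<exists>X. finite X \<and> algebra_generated (poly_scalar \<iota>) X = UNIV"
    using algebra_generated_poly[of \<iota> X] by (intro exI[of _ "(\<lambda>r. [:r:]) ` X \<union> {[:0, 1:]}"]) simp
  have "(\<lambda>r. [:r:]) ` R 1 \<union> {[:0, 1:]} \<subseteq> poly_grading R 1"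
    using const_in_poly_grading[of _ 1] monom_in_poly_grading[OF one_in_R0, of 1]
    by (auto simp: monom_altdef)
  then show "algebra_generated (poly_scalar \<iota>) (poly_grading R 1) = UNIV"
    using algebra_generated_poly[OF standard] algebra_generated_mono[of _ "poly_scalar \<iota>"] by blast
qed

text \<open>By standard generation, each form of positive degree in R is a combination of multiples
  of linear forms. Generators in degree one make the powers of \<nn> accessible through
  monomials.\<close>

lemma poly_irrelevant_ideal_eq: "poly_irrelevant_ideal \<iota> R = ideal_span (poly_grading R 1)"
proof
  have R1: "[:r:] \<in> ideal_span (poly_grading R 1)" if "r \<in> R (Suc n)" for r n
  proof -
    obtain f m where f: "\<forall>i<m. f i \<in> R 1" "R 1 \<subseteq> span (f ` {..<m::nat})" using generators_R1 by blast
    have "r \<in> span (monomial f ` {M. set_mset M \<subseteq> {..<m} \<and> size M = Suc n})"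
      using R_eq_span_monomials[of m f "Suc n"] f that by simp
    then show ?thesis
    proof (induction rule: span_induct_alt)
      case base
      show ?case by (simp add: ideal_span_zero)
    next
      case (step c x y)
      then obtain M where M: "x = monomial f M" "set_mset M \<subseteq> {..<m}" "size M = Suc n" by blast
      then obtain i M' where "M = add_mset i M'" using size_eq_Suc_imp_eq_union by blast
      then have x: "x = f i * monomial f M'" "f i \<in> R 1" using M f(1) by auto
      have "[:\<iota> c * monomial f M':] * [:f i:] + [:y:] \<in> ideal_span (poly_grading R 1)"
        by (intro ideal_span_add step(2) ideal_span_scale ideal_span_base const_in_poly_grading x(2))
      then show ?case by (simp add: x(1) kscale_def mult_ac)
    qed
  qed
  have "[:r:] \<in> ideal_span (poly_grading R 1)" if "r \<in> irrelevant_ideal \<iota> R" for r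
    using that unfolding irrelevant_ideal_def
  proof (induction rule: span_induct_alt)
    case base
    show ?case by (simp add: ideal_span_zero)
  next
    case (step c x y)
    then obtain n where "x \<in> R (Suc n)" by (auto elim: less_eqE simp: Suc_le_eq gr0_conv_Suc)
    then have "[:\<iota> c:] * [:x:] + [:y:] \<in> ideal_span (poly_grading R 1)"
      using R1 step(2) by (intro ideal_span_add ideal_span_scale)
    then show ?case by (simp add: kscale_def mult.commute)
  qed
  then have "extend_ideal (irrelevant_ideal \<iota> R) \<subseteq> ideal_span (poly_grading R 1)"
    unfolding extend_ideal_def by (intro ideal_span_minimal ideal_subspace_span) auto
  moreover have "[:0, 1:] \<in> poly_grading R 1"
    using monom_in_poly_grading[OF one_in_R0, of 1] by (simp add: monom_altdef)
  then have "[:0, 1:] \<in> ideal_span (poly_grading R 1)" by (rule ideal_span_base)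
  ultimately show "poly_irrelevant_ideal \<iota> R \<subseteq> ideal_span (poly_grading R 1)"
    unfolding poly_irrelevant_ideal_def by (intro ideal_span_minimal ideal_subspace_span) auto
  show "ideal_span (poly_grading R 1) \<subseteq> poly_irrelevant_ideal \<iota> R"
    unfolding poly_irrelevant_ideal_def
  proof (rule ideal_span_minimal[OF _ ideal_subspace_span], rule subsetI)
    let ?I = "ideal_span (extend_ideal (irrelevant_ideal \<iota> R) \<union> {[:0, 1:]})"
    fix p assume p: "p \<in> poly_grading R 1"
    then have "coeff p 0 \<in> R 1" "\<forall>i>1. coeff p i = 0" by (auto simp: poly_grading_iff)
    then have "coeff p 0 \<in> irrelevant_ideal \<iota> R"
      unfolding irrelevant_ideal_def by (intro span_base) auto
    then have "[:coeff p 0:] \<in> extend_ideal (irrelevant_ideal \<iota> R)"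
      unfolding extend_ideal_def by (intro ideal_span_base) blast
    then have "[:coeff p 0:] + [:coeff p 1:] * [:0, 1:] \<in> ?I"
      by (intro ideal_span_add ideal_span_scale ideal_span_base) auto
    moreover have "p = [:coeff p 0:] + [:coeff p 1:] * [:0, 1:]"
      using \<open>\<forall>i>1. coeff p i = 0\<close>
      by (intro poly_eqI) (auto simp: coeff_pCons split: nat.splits)
    ultimately show "p \<in> ?I" by metis
  qed
qed

text \<open>Splitting off the constant coefficient writes the space for w + 1 as the direct sum of
  \<open>A \<inter> R (Suc w)\<close> and U times the space for w. With \<open>A = UNIV\<close> this
  gives the dimension of S_w, with a power of I that of a graded piece of the power of J.\<close>

lemma dim_poly_grading_coeffs:
  assumes A: "subspace A"
  shows "vector_space.dim (kscale (poly_scalar \<iota>)) {p \<in> poly_grading R w. \<forall>i. coeff p i \<in> A} =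
    (\<Sum>u=0..w. dim (A \<inter> R u))"
proof -
  interpret S: standard_graded_algebra "poly_scalar \<iota>" "poly_grading R"
    by (rule standard_graded_algebra_poly)
  define V where "V w = {p \<in> poly_grading R w. \<forall>i. coeff p i \<in> A}" for w
  have A0: "0 \<in> A" by (rule subspace_0[OF A])
  have hom_const: "module_hom (kscale \<iota>) (kscale (poly_scalar \<iota>)) (\<lambda>r. [:r:])"
    by (intro module_hom.intro module_hom_axioms.intro module_axioms S.module_axioms)
       (simp_all add: kscale_def poly_scalar_def)
  have hom_shift: "module_hom (kscale (poly_scalar \<iota>)) (kscale (poly_scalar \<iota>)) (pCons 0)"
    by (intro module_hom.intro module_hom_axioms.intro S.module_axioms)
       (simp_all add: kscale_def poly_scalar_def)
  have V_sub: "S.subspace (V w)" for w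
  proof (rule S.subspaceI)
    show "kscale (poly_scalar \<iota>) c x \<in> V w" if "x \<in> V w" for c x
      using that subspace_scale[OF A] S.subspace_scale[OF S.subspace_R, of x w c]
      by (simp add: V_def kscale_def poly_scalar_def)
  qed (auto simp: V_def S.zero_closed S.add_closed A0 subspace_add[OF A])
  have dim_const: "S.dim ((\<lambda>r. [:r:]) ` (A \<inter> R w)) = dim (A \<inter> R w)" for w
    by (rule dim_inj_image[OF hom_const vector_space_axioms S.vector_space_axioms]) (simp add: inj_def)
  have "S.dim (V w) = (\<Sum>u=0..w. dim (A \<inter> R u))"
  proof (induction w)
    case 0
    have "V 0 = (\<lambda>r. [:r:]) ` (A \<inter> R 0)"
    proof
      show "V 0 \<subseteq> (\<lambda>r. [:r:]) ` (A \<inter> R 0)"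
      proof
        fix p assume "p \<in> V 0"
        then show "p \<in> (\<lambda>r. [:r:]) ` (A \<inter> R 0)"
          by (intro image_eqI[of _ _ "coeff p 0"] poly_eqI)
             (auto simp: V_def poly_grading_iff coeff_pCons split: nat.splits)
      qed
    qed (auto simp: V_def A0 coeff_pCons const_in_poly_grading split: nat.splits)
    then show ?case using dim_const[of 0] by simp
  next
    case (Suc w)
    let ?C = "(\<lambda>r. [:r:]) ` (A \<inter> R (Suc w))" and ?D = "pCons 0 ` V w"
    have C: "?C \<subseteq> V (Suc w)"
      by (auto simp: V_def A0 coeff_pCons const_in_poly_grading split: nat.splits)
    have D: "?D \<subseteq> V (Suc w)"
      by (auto simp: V_def A0 coeff_pCons poly_grading_iff zero_closed split: nat.splits)
    have "V (Suc w) \<subseteq> S.span (?C \<union> ?D)"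
    proof
      fix p assume p: "p \<in> V (Suc w)"
      obtain a q where pa: "p = pCons a q" by (cases p)
      have cq: "coeff q i = coeff p (Suc i)" for i by (simp add: pa)
      have "coeff p 0 \<in> A \<inter> R (Suc w)" using p by (auto simp: V_def poly_grading_iff)
      then have "[:a:] \<in> ?C" by (simp add: pa)
      moreover have "pCons 0 q \<in> ?D"
        using p by (intro imageI) (auto simp: V_def poly_grading_iff cq)
      ultimately have "[:a:] + pCons 0 q \<in> S.span (?C \<union> ?D)"
        by (intro S.span_add S.span_base) auto
      then show "p \<in> S.span (?C \<union> ?D)" by (simp add: pa)
    qed
    moreover have "S.span (?C \<union> ?D) \<subseteq> V (Suc w)"
      using C D by (intro S.span_minimal V_sub) auto
    ultimately have "S.dim (V (Suc w)) = S.dim (?C \<union> ?D)" by (metis S.dim_span subset_antisym)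
    also have "\<dots> = S.dim ?C + S.dim ?D"
    proof -
      obtain W where W: "finite W" "poly_grading R (Suc w) \<subseteq> S.span W" using S.finite_dim_R by blast
      have "V (Suc w) \<subseteq> S.span W" using W(2) by (auto simp: V_def)
      moreover have "S.span ?C \<inter> S.span ?D = {0}"
      proof -
        have "subspace (A \<inter> R (Suc w))" by (rule subspace_inter[OF A subspace_R])
        then have C: "S.span ?C = ?C"
          using module_hom.subspace_image[OF hom_const] S.span_eq_iff by blast
        have D: "S.span ?D = ?D"
          using module_hom.subspace_image[OF hom_shift V_sub] S.span_eq_iff by blast
        have "0 \<in> ?C" using A0 zero_closed by (intro image_eqI[of _ _ 0]) auto
        moreover have "0 \<in> ?D" using S.subspace_0[OF V_sub] by (intro image_eqI[of _ _ 0]) auto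
        moreover have "?C \<inter> ?D \<subseteq> {0}" by auto
        ultimately show ?thesis unfolding C D by blast
      qed
      ultimately show ?thesis using C D W(1) by (intro S.dim_Un_disjoint[of W]) auto
    qed
    also have "S.dim ?D = S.dim (V w)"
      by (rule dim_inj_image[OF hom_shift S.vector_space_axioms S.vector_space_axioms]) (simp add: inj_def)
    finally show ?case using dim_const Suc by simp
  qed
  then show ?thesis by (simp add: V_def)
qed

end

section \<open>Powers of the extended ideal\<close>

lemma ideal_subspace_pow: "is_ideal (ideal_pow (I :: 'a::comm_ring_1 set) v)"
  by (cases v) (simp_all add: ideal_prod_def ideal_subspace_span module.subspace_UNIV[OF module_times])

lemma coeff_extend_ideal:
  assumes "is_ideal I" "p \<in> extend_ideal I"
  shows "coeff p i \<in> I"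
proof -
  have "\<forall>i. coeff p i \<in> I"
    using assms(2) unfolding extend_ideal_def
  proof (induction rule: ideal_span_induct)
    case base
    show ?case by (simp add: module.subspace_0[OF module_times assms(1)])
  next
    case (step c x y)
    then show ?case
      by (auto simp: mult.commute[of c]
          intro!: module.subspace_add[OF module_times assms(1)])
         (metis assms(1) module.subspace_scale[OF module_times] mult.commute)
  qed
  then show ?thesis ..
qed

lemma coeff_mult_ideal_pow:
  assumes "\<And>i. coeff p i \<in> I" "\<And>i. coeff q i \<in> ideal_pow I v"
  shows "coeff (p * q) i \<in> ideal_pow I (Suc v)"
  unfolding coeff_mult
proof (rule module.subspace_sum[OF module_times ideal_subspace_pow])
  fix j
  show "coeff p j * coeff q (i - j) \<in> ideal_pow I (Suc v)"
    using assms unfolding ideal_pow.simps ideal_prod_def by (intro ideal_span_base) blast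
qed

context standard_graded_algebra
begin

interpretation S: standard_graded_algebra "poly_scalar \<iota>" "poly_grading R"
  by (rule standard_graded_algebra_poly)

lemma coeff_monomial_ideal_pow:
  assumes I: "is_ideal I" and f: "\<And>i. i \<in> X \<Longrightarrow> \<not> p i \<Longrightarrow> f i \<in> extend_ideal I"
  shows "set_mset M \<subseteq> X \<Longrightarrow> coeff (S.monomial f M) i \<in> ideal_pow I (size (filter_mset (\<lambda>x. \<not> p x) M))"
proof (induction M arbitrary: i)
  case (add j M)
  let ?v = "size (filter_mset (\<lambda>x. \<not> p x) M)"
  have IH: "coeff (S.monomial f M) i \<in> ideal_pow I ?v" for i using add by simp
  show ?case
  proof (cases "p j")
    case True
    have "coeff (f j * S.monomial f M) i \<in> ideal_pow I ?v"
      unfolding coeff_mult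
      by (intro module.subspace_sum[OF module_times ideal_subspace_pow]
          module.subspace_scale[OF module_times ideal_subspace_pow] IH)
    with True show ?thesis by simp
  next
    case False
    have "coeff (f j * S.monomial f M) i \<in> ideal_pow I (Suc ?v)"
      using add.prems False by (intro coeff_mult_ideal_pow IH coeff_extend_ideal[OF I] f) auto
    with False show ?thesis by simp
  qed
qed simp

text \<open>The form \<open>s\<close> is split so that each generator is raised to degree exactly \<open>\<beta>\<close>.\<close>

lemma mult_generators_in_span:
  assumes I: "I = ideal_span G" and \<delta>: "\<And>g. g \<in> G \<Longrightarrow> g \<in> R (\<delta> g) \<and> \<delta> g \<le> \<beta>"
    and gen1: "\<And>n. poly_grading R n \<subseteq> S.span (S.monomial f ` bimonomials X p n 0)"
    and f1: "\<And>i. i \<in> X \<Longrightarrow> p i \<Longrightarrow> f i \<in> poly_grading R 1"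
    and gen2: "extend_ideal I \<inter> poly_grading R \<beta> \<subseteq> S.span (f ` {i\<in>X. \<not> p i})"
  shows "set_mset M \<subseteq> G \<Longrightarrow> s \<in> poly_grading R w \<Longrightarrow> w + (\<Sum>g\<in>#M. \<delta> g) = u + \<beta> * size M \<Longrightarrow>
    s * [:\<Prod>g\<in>#M. g:] \<in> S.span (S.monomial f ` bimonomials X p u (size M))"
proof (induction M arbitrary: s w)
  case empty
  then show ?case using gen1[of u] by (simp flip: one_pCons) blast
next
  case (add g M)
  let ?T = "\<lambda>u v. S.span (S.monomial f ` bimonomials X p u v)"
  have g: "g \<in> R (\<delta> g)" "\<delta> g \<le> \<beta>" "g \<in> G" using \<delta> add.prems(1) by auto
  have "\<forall>g\<in>#M. \<delta> g \<le> \<beta>" using add.prems(1) \<delta> by auto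
  then have "(\<Sum>g\<in>#M. \<delta> g) \<le> \<beta> * size M" by (induction M) auto
  \<comment> \<open>A factor of degree \<beta> - \<delta> g is reserved for lifting
    \<open>g\<close>, and w' is left for the rest. It is a natural number because the remaining
    generators have total degree at most \<beta> times their number.\<close>
  then obtain w' where w: "w = w' + (\<beta> - \<delta> g)" "w' + (\<Sum>g\<in>#M. \<delta> g) = u + \<beta> * size M"
    using add.prems(3) g(2) by (intro that[of "w - (\<beta> - \<delta> g)"]) auto
  have *: "x * y * [:\<Prod>g\<in>#add_mset g M. g:] \<in> ?T u (size (add_mset g M))"
    if x: "x \<in> poly_grading R w'" and y: "y \<in> poly_grading R (\<beta> - \<delta> g)" for x y
  proof -
    have 1: "x * [:\<Prod>g\<in>#M. g:] \<in> ?T u (size M)" using add.IH[OF _ x w(2)] add.prems(1) by simp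
    have "y * [:g:] \<in> poly_grading R \<beta>"
      using S.mult_closed[OF y const_in_poly_grading[OF g(1)]] g(2) by simp
    moreover have "y * [:g:] \<in> extend_ideal I"
      unfolding extend_ideal_def using g(3) I ideal_span_base[of g G] by (intro ideal_span_scale ideal_span_base) auto
    ultimately have 2: "y * [:g:] \<in> S.span (f ` {i\<in>X. \<not> p i})" using gen2 by blast
    have "x * [:\<Prod>g\<in>#M. g:] * (y * [:g:]) \<in> ?T u (Suc (size M))"
    proof (rule S.span_mult[OF 1 2])
      fix a b assume "a \<in> S.monomial f ` bimonomials X p u (size M)" "b \<in> f ` {i\<in>X. \<not> p i}"
      then obtain N i where N: "a = S.monomial f N" "N \<in> bimonomials X p u (size M)" "b = f i" "i \<in> X" "\<not> p i" by blast
      then have "add_mset i N \<in> bimonomials X p u (Suc (size M))" by (auto simp: bimonomials_def)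
      with N show "a * b \<in> ?T u (Suc (size M))"
        by (intro S.span_base image_eqI[of _ _ "add_mset i N"]) (auto simp: mult.commute)
    qed
    moreover have "x * [:\<Prod>g\<in>#M. g:] * (y * [:g:]) = x * y * [:\<Prod>g\<in>#add_mset g M. g:]"
      by (simp add: mult_ac)
    ultimately show ?thesis by simp
  qed
  \<comment> \<open>The form s need not factor itself, but it is a combination of products of linear
    generators, and each such product can be cut after w' factors.\<close>
  have "s \<in> S.span {x * y | x y. x \<in> poly_grading R w' \<and> y \<in> poly_grading R (\<beta> - \<delta> g)}"
  proof -
    have "S.monomial f N \<in> {x * y | x y. x \<in> poly_grading R w' \<and> y \<in> poly_grading R (\<beta> - \<delta> g)}"
      if N: "N \<in> bimonomials X p w 0" for N
    proof -
      have Np: "i \<in> X \<and> p i" if "i \<in># N" for i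
        using N that by (auto simp: bimonomials_def)
      have "size N = w" using N size_filter_compl[of p N] unfolding bimonomials_def mem_Collect_eq by linarith
      obtain xs where xs: "mset xs = N" using ex_mset by blast
      define N1 N2 where "N1 = mset (take w' xs)" and "N2 = mset (drop w' xs)"
      have N12: "N = N1 + N2" by (simp add: N1_def N2_def xs flip: mset_append)
      have len: "length xs = w" using \<open>size N = w\<close> xs by auto
      have sz: "size N1 = w'" "size N2 = \<beta> - \<delta> g"
        using len w(1) by (simp_all add: N1_def N2_def)
      have deg: "S.monomial f K \<in> poly_grading R (size K)" if "set_mset K \<subseteq> set_mset N" for K
      proof -
        have "f i \<in> poly_grading R 1" if "i \<in># K" for i
          using f1 Np \<open>set_mset K \<subseteq> set_mset N\<close> that by blast
        from S.monomial_in_R[of K f "\<lambda>_. 1", OF this] show ?thesis by simp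
      qed
      have "S.monomial f N1 \<in> poly_grading R w'" "S.monomial f N2 \<in> poly_grading R (\<beta> - \<delta> g)"
        using deg[of N1] deg[of N2] sz by (simp_all add: N12)
      moreover have "S.monomial f N = S.monomial f N1 * S.monomial f N2"
        unfolding N12 by (rule S.monomial_union)
      ultimately show ?thesis by blast
    qed
    then have "S.monomial f ` bimonomials X p w 0 \<subseteq>
        {x * y | x y. x \<in> poly_grading R w' \<and> y \<in> poly_grading R (\<beta> - \<delta> g)}"
      by (rule image_subsetI)
    then show ?thesis
      by (rule subsetD[OF S.span_mono subsetD[OF gen1 add.prems(2)]])
  qed
  then show ?case
  proof (induction rule: S.span_induct_alt)
    case base
    show ?case by (simp add: S.span_zero)
  next
    case (step c z t)
    then obtain x y where "z = x * y" "x \<in> poly_grading R w'" "y \<in> poly_grading R (\<beta> - \<delta> g)" by blast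
    then have "z * [:\<Prod>g\<in>#add_mset g M. g:] \<in> ?T u (size (add_mset g M))" by (simp only: *)
    from S.span_add[OF S.span_scale[OF this, of c] step(2)] show ?case
      by (simp only: distrib_right S.scale_mult_left)
  qed
qed

text \<open>The right-hand side is the graded piece of the power of J, described by coefficients.
  The inclusion from right to left is the one that uses generation in degrees at most \<beta>; it is
  proved for one power of U at a time.\<close>

lemma span_bimonomials_eq_coeffs:
  assumes I: "I = ideal_span G" and \<delta>: "\<And>g. g \<in> G \<Longrightarrow> g \<in> R (\<delta> g) \<and> \<delta> g \<le> \<beta>"
    and gen1: "\<And>n. poly_grading R n \<subseteq> S.span (S.monomial f ` bimonomials X p n 0)"
    and f1: "\<And>i. i \<in> X \<Longrightarrow> p i \<Longrightarrow> f i \<in> poly_grading R 1"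
    and f2: "\<And>i. i \<in> X \<Longrightarrow> \<not> p i \<Longrightarrow> f i \<in> extend_ideal I \<inter> poly_grading R \<beta>"
    and gen2: "extend_ideal I \<inter> poly_grading R \<beta> \<subseteq> S.span (f ` {i\<in>X. \<not> p i})"
  shows "S.span (S.monomial f ` bimonomials X p u v) =
    {q \<in> poly_grading R (u + \<beta> * v). \<forall>i. coeff q i \<in> ideal_pow I v}" (is "?T = ?V")
proof
  have idI: "is_ideal I" unfolding I by (rule ideal_subspace_span)
  note idP = ideal_subspace_pow[of I v]
  have "S.subspace ?V"
  proof (rule S.subspaceI)
    show "kscale (poly_scalar \<iota>) c x \<in> ?V" if "x \<in> ?V" for c x
      using that S.subspace_scale[OF S.subspace_R, of x _ c] module.subspace_scale[OF module_times idP]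
      by (simp add: kscale_def poly_scalar_def)
  qed (simp_all add: S.zero_closed S.add_closed module.subspace_0[OF module_times idP]
         module.subspace_add[OF module_times idP])
  moreover have "S.monomial f M \<in> ?V" if M: "M \<in> bimonomials X p u v" for M
  proof -
    have "S.monomial f M \<in> poly_grading R (u + \<beta> * v)"
      by (rule S.monomial_in_R_bimonomials[OF M]) (use f1 f2 in auto)
    moreover have "coeff (S.monomial f M) i \<in> ideal_pow I v" for i
      using coeff_monomial_ideal_pow[OF idI, of X p f M i] f2 M by (auto simp: bimonomials_def)
    ultimately show ?thesis by blast
  qed
  ultimately show "?T \<subseteq> ?V" by (intro S.span_minimal) auto
  have pow: "ideal_pow I v = ideal_span ((\<lambda>M. \<Prod>g\<in>#M. g) ` {M. set_mset M \<subseteq> G \<and> size M = v})"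
    using ideal_pow_span[of "\<lambda>x. x" G v] by (simp add: I monomial_def)
  \<comment> \<open>An element of the power of I need not be homogeneous. In the component of degree
    k of a multiple of v generators, only the component of the cofactor in degree k minus the sum of
    their degrees survives.\<close>
  have mon: "monom (comp r k) i \<in> ?T" if "r \<in> ideal_pow I v" "i + k = u + \<beta> * v" for r i k
    using that(1) unfolding pow
  proof (induction rule: ideal_span_induct)
    case base
    show ?case by (simp add: S.span_zero)
  next
    case (step c x y)
    then obtain M where M: "x = (\<Prod>g\<in>#M. g)" "set_mset M \<subseteq> G" "size M = v" by blast
    let ?e = "\<Sum>g\<in>#M. \<delta> g"
    have "x \<in> R ?e"
      using monomial_in_R[of M "\<lambda>x. x" \<delta>] \<delta> M by (auto simp: monomial_def)
    then have "comp (x * c) k = (if ?e \<le> k then x * comp c (k - ?e) else 0)"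
      by (rule comp_homogeneous_mult)
    moreover have "monom (x * comp c (k - ?e)) i \<in> ?T" if "?e \<le> k"
    proof -
      have "monom (comp c (k - ?e)) i * [:\<Prod>g\<in>#M. g:] \<in> S.span (S.monomial f ` bimonomials X p u (size M))"
      proof (rule mult_generators_in_span[OF I \<delta> gen1 f1 gen2 M(2)])
        show "monom (comp c (k - ?e)) i \<in> poly_grading R (i + (k - ?e))"
          by (rule monom_in_poly_grading[OF comp(1)])
        show "i + (k - ?e) + ?e = u + \<beta> * size M" using \<open>i + k = u + \<beta> * v\<close> \<open>?e \<le> k\<close> M(3) by simp
      qed
      moreover have "monom (comp c (k - ?e)) i * [:x:] = monom (x * comp c (k - ?e)) i"
        by (simp add: smult_monom mult.commute)
      ultimately show ?thesis using M by simp
    qed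
    ultimately have "monom (comp (x * c) k) i \<in> ?T" by (auto simp: S.span_zero)
    then have "monom (comp (x * c) k) i + monom (comp y k) i \<in> ?T" using step(2) by (rule S.span_add)
    then show ?case by (simp add: comp_add add_monom mult.commute)
  qed
  show "?V \<subseteq> ?T"
  proof
    fix q assume q: "q \<in> ?V"
    have "monom (coeff q i) i \<in> ?T" for i
    proof (cases "i \<le> u + \<beta> * v")
      case True
      then have "coeff q i \<in> R (u + \<beta> * v - i)" using q by (simp add: poly_grading_iff)
      then have "comp (coeff q i) (u + \<beta> * v - i) = coeff q i" by (simp add: comp_homogeneous)
      then show ?thesis using mon[of "coeff q i" i "u + \<beta> * v - i"] q True by simp
    next
      case False
      then show ?thesis using q by (simp add: poly_grading_iff S.span_zero)
    qed
    then have "(\<Sum>i\<le>degree q. monom (coeff q i) i) \<in> ?T" by (intro S.span_sum)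
    then show "q \<in> ?T" by (simp add: poly_as_sum_of_monoms)
  qed
qed

text \<open>For d > 0 the factor \<open>Suc n\<close> in \<open>growth_le\<close> cancels to a bound
  with exponent d - 1; summing over w + 1 degrees restores the exponent d.\<close>

lemma dim_poly_grading_bound:
  assumes "growth_le d (\<lambda>n. dim (R n))" "d > 0"
  shows "\<exists>C. \<forall>w. S.dim (poly_grading R w) \<le> C * Suc w ^ d"
proof -
  obtain C where C: "\<And>n. dim (R n) * Suc n \<le> C * Suc n ^ d" using assms(1) unfolding growth_le_def by blast
  obtain e where d: "d = Suc e" using assms(2) gr0_conv_Suc by blast
  have "S.dim (poly_grading R w) \<le> C * Suc w ^ d" for w
  proof -
    have "S.dim (poly_grading R w) = (\<Sum>u=0..w. dim (R u))"
      using dim_poly_grading_coeffs[OF subspace_UNIV, of w] by simp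
    also have "\<dots> \<le> of_nat (card {0..w}) * (C * Suc w ^ e)"
    proof (rule sum_bounded_above)
      fix u assume "u \<in> {0..w}"
      have "dim (R u) * Suc u \<le> (C * Suc u ^ e) * Suc u" using C[of u] by (simp add: d mult_ac)
      then have "dim (R u) \<le> C * Suc u ^ e" by (metis mult_le_cancel2 zero_less_Suc)
      also have "\<dots> \<le> C * Suc w ^ e" using \<open>u \<in> {0..w}\<close> by (intro mult_le_mono2 power_mono) auto
      finally show "dim (R u) \<le> C * Suc w ^ e" .
    qed
    finally show ?thesis by (simp add: d mult_ac)
  qed
  then show ?thesis by blast
qed

text \<open>Both kinds of generators share one index set in \<open>nat\<close>, as the monomial
  order requires. The bidegree belongs to the index, since for \<beta> = 1 the same element may
  occur in both roles.\<close>

lemma bigraded_generators: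
  fixes J :: "'a poly set"
  obtains X p and f :: "nat \<Rightarrow> 'a poly" where "finite X"
    "\<forall>i\<in>X. p i \<longrightarrow> f i \<in> poly_grading R 1"
    "\<forall>i\<in>X. \<not> p i \<longrightarrow> f i \<in> J \<inter> poly_grading R \<beta>"
    "poly_grading R 1 \<subseteq> S.span (f ` {i\<in>X. p i})"
    "J \<inter> poly_grading R \<beta> \<subseteq> S.span (f ` {i\<in>X. \<not> p i})"
    "\<forall>n. poly_grading R n \<subseteq> S.span (S.monomial f ` bimonomials X p n 0)"
proof -
  obtain f m where f: "\<forall>i<m. f i \<in> poly_grading R 1" "poly_grading R 1 \<subseteq> S.span (f ` {..<m::nat})"
    using S.generators_R1 by blast
  obtain W where W: "finite W" "poly_grading R \<beta> \<subseteq> S.span W" using S.finite_dim_R by blast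
  have "J \<inter> poly_grading R \<beta> \<subseteq> S.span W" using W(2) by blast
  then obtain B where B: "finite B" "B \<subseteq> J \<inter> poly_grading R \<beta>" "J \<inter> poly_grading R \<beta> \<subseteq> S.span B"
    by (rule S.finite_basis[OF W(1)])
  obtain g :: "nat \<Rightarrow> 'a poly" and n where g: "B = g ` {i::nat. i < n}"
    using finite_imp_nat_seg_image_inj_on[OF B(1)] by blast
  define h where "h i = (if i < m then f i else g (i - m))" for i
  have X1: "{i\<in>{..<m + n}. i < m} = {..<m}" by auto
  have h1: "h ` {i\<in>{..<m + n}. i < m} = f ` {..<m}" unfolding X1 by (auto simp: h_def)
  have h2: "h ` {i\<in>{..<m + n}. \<not> i < m} = B"
  proof
    show "h ` {i\<in>{..<m + n}. \<not> i < m} \<subseteq> B" by (auto simp: h_def g)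
    show "B \<subseteq> h ` {i\<in>{..<m + n}. \<not> i < m}"
    proof
      fix b assume "b \<in> B"
      then obtain i where "b = g i" "i < n" by (auto simp: g)
      then show "b \<in> h ` {i\<in>{..<m + n}. \<not> i < m}" by (intro image_eqI[of _ _ "m + i"]) (auto simp: h_def)
    qed
  qed
  show ?thesis
  proof (rule that[of "{..<m + n}" "\<lambda>i. i < m" h])
    show "\<forall>i\<in>{..<m + n}. i < m \<longrightarrow> h i \<in> poly_grading R 1" using f(1) by (simp add: h_def)
    show "\<forall>i\<in>{..<m + n}. \<not> i < m \<longrightarrow> h i \<in> J \<inter> poly_grading R \<beta>"
      using B(2) h2 by blast
    show "\<forall>k. poly_grading R k \<subseteq> S.span (S.monomial h ` bimonomials {..<m + n} (\<lambda>i. i < m) k 0)"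
    proof
      fix k
      have sub: "{M. set_mset M \<subseteq> {..<m} \<and> size M = k} \<subseteq> bimonomials {..<m + n} (\<lambda>i. i < m) k 0"
      proof
        fix M assume M: "M \<in> {M. set_mset M \<subseteq> {..<m} \<and> size M = k}"
        then have "filter_mset (\<lambda>i. i < m) M = M" by (subst filter_mset_eq_conv) auto
        moreover have "filter_mset (\<lambda>i. \<not> i < m) M = {#}" using M by auto
        ultimately show "M \<in> bimonomials {..<m + n} (\<lambda>i. i < m) k 0"
          using M unfolding bimonomials_def by (auto simp del: filter_mset_eq_conv)
      qed
      have "poly_grading R k = S.span (S.monomial h ` {M. set_mset M \<subseteq> {..<m} \<and> size M = k})"
        using f h1 unfolding X1 by (intro S.R_eq_span_monomials) (auto simp: h_def)
      then show "poly_grading R k \<subseteq> S.span (S.monomial h ` bimonomials {..<m + n} (\<lambda>i. i < m) k 0)"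
        using S.span_mono[OF image_mono[OF sub, of "S.monomial h"]] by simp
    qed
  qed (use f(2) B(3) h1 h2 in auto)
qed

end

theorem proposition5p4:
  fixes \<iota> :: "'k::field \<Rightarrow> 'a::idom"
    and R :: "nat \<Rightarrow> 'a set"
    and I :: "'a set"
    and J \<nn> :: "'a poly set"
    and d \<beta> c :: nat
  assumes "standard_graded_algebra \<iota> R"
    and "krull_dim TYPE('a) = enat d"
    and "d > 0"
    and "homogeneous_ideal R I"
    and "I \<noteq> {0}"
  defines "\<nn> \<equiv> poly_irrelevant_ideal \<iota> R"
    and "J \<equiv> extend_ideal I"
  assumes "\<beta> > 0"
    and "generated_in_degrees_le R \<beta> I"
    and "c > \<beta>"
  shows "\<exists>v0 L. degree L < d \<and>
     (let e = mixed_multiplicity (poly_scalar \<iota>) d \<nn> (degree_part_ideal (poly_grading R) \<beta> J);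
          K = (\<Sum>i=0..d. of_int (e i) / (fact i * fact (d - i)) * (of_nat c - of_nat \<beta>) ^ (d - i))
      in numerical_poly (monom K d + L) \<and>
         (\<forall>v\<ge>v0. of_nat (\<Sum>u=0..c * v. vector_space.dim (kscale \<iota>) (ideal_pow I v \<inter> R u))
                  = K * of_nat v ^ d + poly L (of_nat v)))"
proof -
  interpret R: standard_graded_algebra \<iota> R by fact
  interpret S: standard_graded_algebra "poly_scalar \<iota>" "poly_grading R"
    by (rule R.standard_graded_algebra_poly)
  let ?\<aa> = "degree_part_ideal (poly_grading R) \<beta> J"
  obtain G where G: "G \<subseteq> (\<Union>u\<in>{..\<beta>}. R u)" "I = ideal_span G"
    using assms(9) by (auto simp: generated_in_degrees_le_def)
  then have "\<forall>g\<in>G. \<exists>u. g \<in> R u \<and> u \<le> \<beta>" by blast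
  then obtain \<delta> where \<delta>: "\<And>g. g \<in> G \<Longrightarrow> g \<in> R (\<delta> g) \<and> \<delta> g \<le> \<beta>" by metis
  obtain X p and f :: "nat \<Rightarrow> 'a poly" where gens: "finite X"
    "\<forall>i\<in>X. p i \<longrightarrow> f i \<in> poly_grading R 1"
    "\<forall>i\<in>X. \<not> p i \<longrightarrow> f i \<in> J \<inter> poly_grading R \<beta>"
    "poly_grading R 1 \<subseteq> S.span (f ` {i\<in>X. p i})"
    "J \<inter> poly_grading R \<beta> \<subseteq> S.span (f ` {i\<in>X. \<not> p i})"
    "\<forall>n. poly_grading R n \<subseteq> S.span (S.monomial f ` bimonomials X p n 0)"
    by (rule R.bigraded_generators[of J \<beta>])
  have f: "finite X"
    "\<And>i. i \<in> X \<Longrightarrow> p i \<Longrightarrow> f i \<in> poly_grading R 1"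
    "\<And>i. i \<in> X \<Longrightarrow> \<not> p i \<Longrightarrow> f i \<in> J \<inter> poly_grading R \<beta>"
    "poly_grading R 1 \<subseteq> S.span (f ` {i\<in>X. p i})"
    "J \<inter> poly_grading R \<beta> \<subseteq> S.span (f ` {i\<in>X. \<not> p i})"
    "\<And>n. poly_grading R n \<subseteq> S.span (S.monomial f ` bimonomials X p n 0)"
    using gens by blast+
  define T where "T u v = S.span (S.monomial f ` bimonomials X p u v)" for u v
  have T: "T u v = {q \<in> poly_grading R (u + \<beta> * v). \<forall>i. coeff q i \<in> ideal_pow I v}" for u v
    unfolding T_def
    by (rule R.span_bimonomials_eq_coeffs[OF G(2) \<delta> f(6,2)]) (use f(3,5) in \<open>auto simp: J_def\<close>)
  \<comment> \<open>This replaces S_1 and the degree \<beta> part of J by the finitely many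
    \<open>f i\<close> as ideal generators.\<close>
  have span_eq: "ideal_span A = ideal_span B" if "B \<subseteq> A" "A \<subseteq> S.span B" for A B
  proof
    have "S.span B \<subseteq> ideal_span B"
      by (intro S.span_minimal ideal_span_superset S.is_ideal_imp_subspace ideal_subspace_span)
    then show "ideal_span A \<subseteq> ideal_span B"
      using that(2) by (intro ideal_span_minimal ideal_subspace_span) auto
  qed (rule ideal_span_mono[OF that(1)])
  have \<nn>: "\<nn> = ideal_span (f ` {i\<in>X. p i})"
    unfolding \<nn>_def R.poly_irrelevant_ideal_eq using f(2,4) by (intro span_eq) auto
  have \<aa>: "?\<aa> = ideal_span (f ` {i\<in>X. \<not> p i})"
    unfolding degree_part_ideal_def using f(3,5) by (intro span_eq) auto
  have quot: "quot_dim (poly_scalar \<iota>) (ideal_prod (ideal_pow \<nn> u) (ideal_pow ?\<aa> v))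
      (ideal_prod (ideal_pow \<nn> (Suc u)) (ideal_pow ?\<aa> v)) = S.dim (T u v)" for u v
    unfolding \<nn> \<aa> S.ideal_prod_pow_span T_def
    by (rule S.quot_dim_bimonomials) (use f in auto)
  obtain C where C: "\<And>w. S.dim (poly_grading R w) \<le> C * Suc w ^ d"
    using R.dim_poly_grading_bound[OF R.growth_le_krull_dim[OF assms(2)] assms(3)] by auto
  have bound: "S.dim (T u v) \<le> C * Suc (u + \<beta> * v) ^ d" for u v
  proof -
    have "T u v \<subseteq> S.span (poly_grading R (u + \<beta> * v))"
      unfolding T using S.span_superset by blast
    then have "S.dim (T u v) \<le> S.dim (poly_grading R (u + \<beta> * v))"
      by (rule S.dim_mono_R) (rule subset_refl)
    then show ?thesis using C order_trans by blast
  qed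
  have ev: "eventually_poly2 (\<lambda>u v. of_nat (S.dim (T u v)))"
    unfolding T_def by (rule S.hilbert_eventually_poly2[OF f(1)])
  obtain Q u0 v0 where td: "total_degree_le d Q"
    and Q: "\<And>u v. u \<ge> u0 \<Longrightarrow> v \<ge> v0 \<Longrightarrow> of_nat (S.dim (T u v)) = poly (poly Q [:of_nat u:]) (of_nat v)"
    using bounded_hilbert_poly[of "\<lambda>u v. S.dim (T u v)", OF ev bound] by blast
  have bh: "is_bhattacharya_poly (poly_scalar \<iota>) d \<nn> ?\<aa> Q"
    unfolding is_bhattacharya_poly_def quot using td Q unfolding total_degree_le_def by blast
  define e where "e = mixed_multiplicity (poly_scalar \<iota>) d \<nn> ?\<aa>"
  define K where "K = (\<Sum>i=0..d. of_int (e i) / (fact i * fact (d - i)) * (of_nat c - of_nat \<beta>) ^ (d - i) :: rat)"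
  \<comment> \<open>The ray u = (c - \<beta>) v; on it u + \<beta>v = cv, the upper limit of the sum
    in the theorem.\<close>
  define W where "W = poly Q [:0, of_nat (c - \<beta>):]"
  define N where "N = max u0 v0"
  have cb: "rat_of_nat (c - \<beta>) = of_nat c - of_nat \<beta>" using assms(10) by (simp add: of_nat_diff)
  have "coeff W d = (\<Sum>i\<le>d. rat_of_nat (c - \<beta>) ^ i * coeff (coeff Q i) (d - i))"
    by (simp add: W_def coeff_ray)
  \<comment> \<open>Reversing the summation turns the exponent of u into that of v, which is the
    index of e_i.\<close>
  also have "\<dots> = (\<Sum>i\<le>d. rat_of_nat (c - \<beta>) ^ (d - i) * coeff (coeff Q (d - i)) i)"
    by (rule sum.reindex_bij_witness[of _ "\<lambda>i. d - i" "\<lambda>i. d - i"]) auto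
  also have "\<dots> = K"
    unfolding K_def cb atLeast0AtMost
    by (rule sum.cong) (simp_all add: mixed_multiplicity_coeff[OF bh] e_def mult.commute)
  finally have Wd: "coeff W d = K" .
  have "coeff W n = 0" if "n > d" for n
  proof -
    have "coeff (coeff Q a) (n - a) = 0" if "a \<le> n" for a
      using td \<open>n > d\<close> that unfolding total_degree_le_def by force
    then show ?thesis by (simp add: W_def coeff_ray)
  qed
  then have "degree (W - monom K d) < d"
    using Wd assms(3) by (intro degree_lessI) auto
  moreover have dims: "(\<Sum>u=0..c * v. R.dim (ideal_pow I v \<inter> R u)) = S.dim (T ((c - \<beta>) * v) v)" for v
  proof -
    have "(c - \<beta>) * v + \<beta> * v = c * v" using assms(10) by (simp flip: add_mult_distrib)
    then show ?thesis
      using R.dim_poly_grading_coeffs[OF R.is_ideal_imp_subspace[OF ideal_subspace_pow[of I v]], of "c * v"]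
      by (simp add: T)
  qed
  have W: "rat_of_nat (S.dim (T ((c - \<beta>) * v) v)) = poly W (of_nat v)" if "v \<ge> N" for v
  proof -
    \<comment> \<open>From c > \<beta> it follows that u \<ge> v on the ray, so v \<ge> N puts both
      coordinates past the thresholds of Q.\<close>
    have "1 * v \<le> (c - \<beta>) * v" using assms(10) by (intro mult_le_mono1) simp
    moreover have "u0 \<le> v" "v0 \<le> v" using that by (simp_all add: N_def)
    ultimately have "u0 \<le> (c - \<beta>) * v" by linarith
    from Q[OF this \<open>v0 \<le> v\<close>] show ?thesis by (simp add: W_def poly_ray)
  qed
  have "numerical_poly W"
    unfolding numerical_poly_def using W by (metis Ints_of_nat)
  then have "numerical_poly (monom K d + (W - monom K d))" by simp
  moreover have "\<forall>v\<ge>N. of_nat (\<Sum>u=0..c * v. R.dim (ideal_pow I v \<inter> R u))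
      = K * of_nat v ^ d + poly (W - monom K d) (of_nat v)"
    unfolding dims using W by (simp add: poly_monom)
  ultimately show ?thesis
    unfolding Let_def e_def[symmetric] K_def[symmetric] by blast
qed

end
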